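(* Let $X$ be a Hausdorff sequentially complete locally convex space over $\mathbb{C}$. Suppose that $\alpha\in(0,2)$, $\sigma\in(-1,0)$, $\beta\geq 0$, $\mathcal{A}$ is a closed MLO in $X$, $C\in L(X)$, $C\mathcal{A}\subseteq\mathcal{A}C$, and $\mathcal{A}$ is a subgenerator of an exponentially equicontinuous $(g_{\alpha},g_{\beta+1})$-regularized $C$-resolvent family $(R(t))_{t\geq 0}$ such that the operator family $\{(t^{a}+t^{b})^{-1}R(t):t>0\}\subseteq L(X)$ is equicontinuous for two real numbers $a,b$ with $-1<a\leq b$. Let $\eta>1+b$ and $\eta\geq 1+\beta$. Define $$ F(t):=t^{|\sigma|(\eta-\beta-1)}+\Bigl(t^{|\sigma|(\eta-b-1)}\chi_{(0,1]}(t)+t^{|\sigma|(\eta-a-1)}\chi_{[1,\infty)}(t)\Bigr),\quad t>0. $$ Then the operator $\mathcal{A}^{-1}$ is a subgenerator of a global $(g_{\alpha|\sigma|},g_{1+|\sigma|(\eta-\beta-1)})$-regularized $C$-resolvent family $(S(t))_{t\geq 0}\subseteq L(X)$ and the operator family $\{[F(t)]^{-1}S(t):t>0\}\subseteq L(X)$ is equicontinuous.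
   Context: MLOs: a map $\mathcal{A}:X\to P(X)$ is a multivalued linear operator (MLO) in $X$ if $D(\mathcal{A}):=\{x:\mathcal{A}x\neq\emptyset\}$ is a linear subspace, $\mathcal{A}x+\mathcal{A}y\subseteq\mathcal{A}(x+y)$ and $\lambda\mathcal{A}x\subseteq\mathcal{A}(\lambda x)$ for $x,y\in D(\mathcal{A})$, $\lambda\in\mathbb{C}$; it is identified with its graph in $X\times X$ (a linear subspace), is closed if the graph is closed, and inclusions are inclusions of graphs. $\mathcal{A}^{-1}=\{(y,x):(x,y)\in\mathcal{A}\}$. $g_{\zeta}(t):=t^{\zeta-1}/\Gamma(\zeta)$ for $\zeta>0$, $t>0$ (extended continuously to $t=0$ when $\zeta\geq 1$); $\chi_{\Omega}$ is the characteristic function of $\Omega$. Families: let $k\in C([0,\infty))$, $k\neq 0$, $a\in L^{1}_{loc}([0,\infty))$, $a\neq 0$. For an MLO $\mathcal{M}$ in $X$ and $C\in L(X)$ (not necessarily injective) with $C\mathcal{M}\subseteq\mathcal{M}C$, a strongly continuous family $(R(t))_{t\geq 0}\subseteq L(X)$ is a (global) $(a,k)$-regularized $C$-resolvent family with a subgenerator $\mathcal{M}$ if: $\int_{0}^{t}a(t-s)R(s)y\,ds=R(t)x-k(t)Cx$ for all $t\geq 0$ and $(x,y)\in\mathcal{M}$; $R(t)C=CR(t)$; and $R(t)\mathcal{M}\subseteq\mathcal{M}R(t)$ for all $t\geq 0$. It is exponentially equicontinuous if $\{e^{-\omega t}R(t):t\geq 0\}$ is equicontinuous for some $\omega\in\mathbb{R}$.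 *)

theory Defs
  imports "HOL-Analysis.Analysis"
begin

section \<open>Sequentially complete locally convex spaces over the complex numbers\<close>

class scaleC = scaleR +
  fixes scaleC :: "complex \<Rightarrow> 'a \<Rightarrow> 'a" (infixr \<open>*\<^sub>C\<close> 75)
  assumes scaleR_scaleC: "scaleR r = scaleC (complex_of_real r)"

class complex_vector = scaleC + ab_group_add +
  assumes scaleC_add_right: "c *\<^sub>C (x + y) = c *\<^sub>C x + c *\<^sub>C y"
    and scaleC_add_left: "(c + d) *\<^sub>C x = c *\<^sub>C x + d *\<^sub>C x"
    and scaleC_scaleC: "c *\<^sub>C d *\<^sub>C x = (c * d) *\<^sub>C x"
    and scaleC_one: "1 *\<^sub>C x = x"

text \<open>
  The real structure is the restriction of the complex one, so that library notions for real vector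
  spaces apply.
\<close>

subclass (in complex_vector) real_vector
  by unfold_locales
    (simp_all add: scaleR_scaleC scaleC_add_right scaleC_add_left scaleC_scaleC scaleC_one)

global_interpretation complex_vector: vector_space "scaleC :: complex \<Rightarrow> 'a \<Rightarrow> 'a::complex_vector"
  by unfold_locales
    (rule scaleC_add_right, rule scaleC_add_left, rule scaleC_scaleC, rule scaleC_one)

class complex_locally_convex_space = complex_vector + topological_ab_group_add +
  assumes tendsto_scaleC_Pair: "LIM z (nhds c \<times>\<^sub>F nhds x). fst z *\<^sub>C snd z :> nhds (c *\<^sub>C x)"
    and locally_convex:
      "open U \<Longrightarrow> 0 \<in> U \<Longrightarrow> \<exists>V. open V \<and> 0 \<in> V \<and> V \<subseteq> U \<and>
        (\<forall>x\<in>V. \<forall>y\<in>V. \<forall>u\<ge>0. \<forall>v\<ge>0. u + v = 1 \<longrightarrow> u *\<^sub>R x + v *\<^sub>R y \<in> V)"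

text \<open>\<open>convex\<close> cannot occur in the class specification, which therefore contains its unfolding.\<close>

lemma convex_neighbourhood_0:
  fixes U :: "'a::complex_locally_convex_space set"
  assumes "open U" and "0 \<in> U"
  obtains V where "open V" "0 \<in> V" "V \<subseteq> U" "convex V"
  using locally_convex[OF assms] unfolding convex_def by blast

text \<open>
  Cauchy sequences are those of the uniformity of the additive topological group; no
  \<open>uniform_space\<close> structure on the type is required.
\<close>

class sequentially_complete_lcs = complex_locally_convex_space + t2_space +
  assumes sequentially_complete:
    "(\<And>U. open U \<Longrightarrow> 0 \<in> U \<Longrightarrow> \<exists>N. \<forall>m\<ge>N. \<forall>n\<ge>N. X m - X n \<in> U) \<Longrightarrow>
      \<exists>x. filterlim X (nhds x) sequentially"


section \<open>Continuous linear operators and equicontinuity\<close>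

definition cont_linear_ops :: "('a::complex_locally_convex_space \<Rightarrow> 'a) set" where
  "cont_linear_ops = {T. Vector_Spaces.linear (*\<^sub>C) (*\<^sub>C) T \<and> continuous_on UNIV T}"

text \<open>For families of linear operators, equicontinuity at 0 is equicontinuity.\<close>

definition equicontinuous_ops :: "('a::complex_locally_convex_space \<Rightarrow> 'a) set \<Rightarrow> bool" where
  "equicontinuous_ops F \<longleftrightarrow>
     F \<subseteq> cont_linear_ops \<and>
     (\<forall>U. open U \<and> 0 \<in> U \<longrightarrow> (\<exists>V. open V \<and> 0 \<in> V \<and> (\<forall>T\<in>F. T ` V \<subseteq> U)))"


section \<open>Multivalued linear operators\<close>

text \<open>
  A multivalued operator is represented by its graph, so that the value at \<open>x\<close> is
  \<open>A `` {x}\<close>, the domain is \<open>Domain A\<close> and the inverse is \<open>converse A\<close>.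
\<close>

definition is_MLO :: "('a::complex_vector \<times> 'a) set \<Rightarrow> bool" where
  "is_MLO A \<longleftrightarrow>
     complex_vector.subspace (Domain A) \<and>
     (\<forall>x\<in>Domain A. \<forall>y\<in>Domain A. {u + v |u v. u \<in> A `` {x} \<and> v \<in> A `` {y}} \<subseteq> A `` {x + y}) \<and>
     (\<forall>x\<in>Domain A. \<forall>c. (\<lambda>u. c *\<^sub>C u) ` (A `` {x}) \<subseteq> A `` {c *\<^sub>C x})"

definition op_graph :: "('a \<Rightarrow> 'a) \<Rightarrow> ('a \<times> 'a) set" where
  "op_graph T = {(x, T x) |x. True}"

text \<open>
  \<open>T A \<subseteq> A T\<close>, for the products of multivalued operators. Relation composition \<open>O\<close>
  is written in the order of application, hence the reversal.
\<close>

definition op_commutes_MLO :: "('a \<Rightarrow> 'a) \<Rightarrow> ('a \<times> 'a) set \<Rightarrow> bool" where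
  "op_commutes_MLO T A \<longleftrightarrow> A O op_graph T \<subseteq> op_graph T O A"


section \<open>Integration of vector-valued functions\<close>

definition continuous_seminorm :: "('a::complex_locally_convex_space \<Rightarrow> real) \<Rightarrow> bool" where
  "continuous_seminorm p \<longleftrightarrow>
     (\<forall>x y. p (x + y) \<le> p x + p y) \<and>
     (\<forall>c x. p (c *\<^sub>C x) = cmod c * p x) \<and>
     continuous_on UNIV p"

text \<open>
  The Bochner-type integral in a sequentially complete locally convex space: \<open>f\<close> is the
  almost everywhere limit of a sequence of simple functions which is Cauchy in mean with respect
  to every continuous seminorm, and the integral is the limit of the integrals of these functions.
  The library's Bochner integral is restricted to normed spaces.
\<close>

definition has_lcs_integral ::
    "'b measure \<Rightarrow> ('b \<Rightarrow> 'a::sequentially_complete_lcs) \<Rightarrow> 'a \<Rightarrow> bool" where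
  "has_lcs_integral M f y \<longleftrightarrow>
     (\<exists>h :: nat \<Rightarrow> 'b \<Rightarrow> 'a.
        (\<forall>n. Bochner_Integration.simple_bochner_integrable M (h n)) \<and>
        (AE s in M. (\<lambda>n. h n s) \<longlonglongrightarrow> f s) \<and>
        (\<forall>p. continuous_seminorm p \<longrightarrow>
          (\<forall>e>0. \<exists>N. \<forall>m\<ge>N. \<forall>n\<ge>N. (LINT s|M. p (h m s - h n s)) < e)) \<and>
        (\<lambda>n. Bochner_Integration.simple_bochner_integral M (h n)) \<longlonglongrightarrow> y)"


section \<open>Regularized resolvent families\<close>

text \<open>
  The kernel \<open>t powr (z - 1) / Gamma z\<close>, with the continuous extension to \<open>t = 0\<close>
  for \<open>z \<ge> 1\<close>. The case \<open>z = 1\<close> is separate because \<open>0 powr 0 = 0\<close>.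
\<close>

definition g_kernel :: "real \<Rightarrow> real \<Rightarrow> real" where
  "g_kernel z t = (if t = 0 \<and> z = 1 then 1 else t powr (z - 1) / Gamma z)"

text \<open>
  The kernels \<open>a\<close> and \<open>k\<close> are functions on the nonnegative half-line and \<open>R\<close> is
  a family indexed by it; values at negative arguments are irrelevant. As an element of the space
  of locally integrable functions, \<open>a\<close> is nonzero if it does not vanish almost everywhere.
\<close>

definition regularized_resolvent_family ::
    "(real \<Rightarrow> complex) \<Rightarrow> (real \<Rightarrow> complex) \<Rightarrow>
     ('a::sequentially_complete_lcs \<Rightarrow> 'a) \<Rightarrow> ('a \<times> 'a) set \<Rightarrow> (real \<Rightarrow> 'a \<Rightarrow> 'a) \<Rightarrow> bool" where
  "regularized_resolvent_family a k C M R \<longleftrightarrow>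
     continuous_on {0..} k \<and> (\<exists>t\<ge>0. k t \<noteq> 0) \<and>
     (\<forall>T\<ge>0. a absolutely_integrable_on {0..T}) \<and> \<not> (AE t in lebesgue_on {0..}. a t = 0) \<and>
     is_MLO M \<and> C \<in> cont_linear_ops \<and> op_commutes_MLO C M \<and>
     (\<forall>t\<ge>0. R t \<in> cont_linear_ops) \<and>
     (\<forall>x. continuous_on {0..} (\<lambda>t. R t x)) \<and>
     (\<forall>t\<ge>0. \<forall>(x, y)\<in>M.
        has_lcs_integral (lebesgue_on {0..t}) (\<lambda>s. a (t - s) *\<^sub>C R s y) (R t x - k t *\<^sub>C C x)) \<and>
     (\<forall>t\<ge>0. R t \<circ> C = C \<circ> R t) \<and>
     (\<forall>t\<ge>0. op_commutes_MLO (R t) M)"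

definition exponentially_equicontinuous ::
    "(real \<Rightarrow> 'a::complex_locally_convex_space \<Rightarrow> 'a) \<Rightarrow> bool" where
  "exponentially_equicontinuous R \<longleftrightarrow>
     (\<exists>\<omega>::real. equicontinuous_ops {(\<lambda>x. exp (- \<omega> * t) *\<^sub>R R t x) |t. t \<ge> 0})"

end

theory Submission
  imports Defs "HOL-Probability.Probability"
begin

text \<open>
  Put \<open>\<rho> = \<bar>\<sigma>\<bar>\<close>. Formally, \<open>R\<close> has the Laplace transform
  \<open>z\<^sup>-\<^sup>\<beta>\<^sup>-\<^sup>1 (I - z\<^sup>-\<^sup>\<alpha> A)\<^sup>-\<^sup>1 C\<close>. The identity \<open>(I - z\<^sup>\<alpha> A\<^sup>-\<^sup>1)\<^sup>-\<^sup>1 = I - (I - z\<^sup>-\<^sup>\<alpha> A)\<^sup>-\<^sup>1\<close>,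
  taken at \<open>z = \<lambda>\<^sup>-\<^sup>\<rho>\<close>, therefore forces
  \<open>S t x = g (1 + \<rho> (\<eta> - \<beta> - 1)) t C x - \<integral> K t s (R s x) ds\<close> over \<open>s > 0\<close>,
  where \<open>K t s\<close> is the inverse Laplace transform of \<open>\<lambda> \<mapsto> \<lambda>\<^sup>-\<^sup>1\<^sup>-\<^sup>\<rho>\<^sup>\<eta> exp (- s \<lambda>\<^sup>-\<^sup>\<rho>)\<close>, a Wright
  function. Since \<open>\<rho> < 1\<close>, \<open>Re \<lambda>\<^sup>-\<^sup>\<rho> \<ge> cos (\<rho> \<pi> / 2) \<bar>\<lambda>\<bar>\<^sup>-\<^sup>\<rho>\<close> on the line \<open>Re \<lambda> = 1\<close>, and integrating
  the inversion formula on this line against \<open>s\<^sup>c\<close> shows that \<open>\<integral> \<bar>K t s\<bar> s\<^sup>c ds\<close> is a constant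
  multiple of \<open>t\<close> to the power \<open>\<rho> (\<eta> - c - 1)\<close>, provided that \<open>\<eta> > c + 1 > 0\<close>; for \<open>c = a, b\<close>
  this is the asserted bound. The resolvent equation for \<open>A\<^sup>-\<^sup>1\<close> is the one for \<open>A\<close> integrated
  against \<open>K\<close>: convolution in \<open>t\<close> with \<open>g (\<rho> \<alpha>)\<close> raises the exponent \<open>1 + \<rho> \<eta>\<close> of \<open>K\<close> by \<open>\<rho> \<alpha>\<close>, and
  the Weyl fractional integral of order \<open>\<alpha>\<close> in \<open>s\<close> lowers it by the same amount. By the
  Hahn--Banach theorem such identities need only be verified after applying a functional.
\<close>

section \<open>Continuous seminorms\<close>

text \<open>The exponent 1 + \<rho> \<eta> is the sum of 1 + \<rho> (\<eta> - \<beta> - 1), which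
  belongs to the new regularizing kernel, and \<rho> (\<beta> + 1), which undoes the factor z powr
  (- \<beta> - 1) in the transform of R. The formal calculation only serves to find K; no
  vector-valued Laplace transform occurs below. Two representations of the Wright function share the
  work. Its power series gives the convolution in t term by term, through Beta integrals. The terms
  of the series are not integrable over the half-line in s, so moments and Weyl integrals come from
  the line integral instead. The bridge between the two is Hankel's formula for 1 / Gamma,
  absolutely convergent for exponents above 1; this is why \<delta> > 1 recurs. Since K t s is t
  powr (\<delta> - 1) times a function of s t powr \<rho>, the single line Re \<lambda> = 1 serves
  every t. Sequential completeness yields limits of sequences only. Vector integrals are therefore
  limits of explicit sequences, namely Riemann sums on a grid and then truncations at integers, and
  the Cauchy property is checked on all functionals below a given seminorm simultaneously.\<close>

lemma tendsto_scaleC: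
  fixes g :: "'b \<Rightarrow> 'a::complex_locally_convex_space"
  assumes "(f \<longlongrightarrow> c) F" "(g \<longlongrightarrow> x) F"
  shows "((\<lambda>z. f z *\<^sub>C g z) \<longlongrightarrow> c *\<^sub>C x) F"
proof -
  have "filterlim (\<lambda>z. (f z, g z)) (nhds c \<times>\<^sub>F nhds x) F"
    using assms by (rule filterlim_Pair)
  from filterlim_compose[OF tendsto_scaleC_Pair this] show ?thesis by simp
qed

lemma continuous_on_scaleC:
  fixes g :: "'b::topological_space \<Rightarrow> 'a::complex_locally_convex_space"
  assumes "continuous_on S f" "continuous_on S g"
  shows "continuous_on S (\<lambda>z. f z *\<^sub>C g z)"
  using assms unfolding continuous_on_def by (auto intro: tendsto_scaleC)

lemma open_scaleC_preimage:
  fixes N :: "'a::complex_locally_convex_space set"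
  assumes "open N"
  shows "open {y. c *\<^sub>C y \<in> N}"
proof -
  have "continuous_on UNIV (\<lambda>y::'a. c *\<^sub>C y)"
    by (intro continuous_on_scaleC continuous_intros)
  from open_vimage[OF assms this] show ?thesis by (simp add: vimage_def)
qed

lemma linear_scaleC: "linear (\<lambda>x::'a::complex_vector. c *\<^sub>C x)"
  by (rule linearI) (simp_all add: scaleC_add_right scaleR_scaleC scaleC_scaleC mult.commute)

context
  fixes p :: "'a::complex_locally_convex_space \<Rightarrow> real"
  assumes p: "continuous_seminorm p"
begin

lemma seminorm_add: "p (x + y) \<le> p x + p y"
  and seminorm_scaleC: "p (c *\<^sub>C x) = cmod c * p x"
  and seminorm_cont: "continuous_on UNIV p"
  using p unfolding continuous_seminorm_def by auto

lemma seminorm_scaleR: "p (r *\<^sub>R x) = \<bar>r\<bar> * p x"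
  by (simp add: scaleR_scaleC seminorm_scaleC)

lemma seminorm_0: "p 0 = 0"
  using seminorm_scaleR[of 0 0] by simp

lemma seminorm_minus: "p (- x) = p x"
  using seminorm_scaleR[of "-1" x] by simp

lemma seminorm_nonneg: "0 \<le> p x"
  using seminorm_add[of x "-x"] by (simp add: seminorm_0 seminorm_minus)

lemma seminorm_minus_commute: "p (x - y) = p (y - x)"
  using seminorm_minus[of "x - y"] by simp

lemma seminorm_triangle: "p (x - z) \<le> p (x - y) + p (y - z)"
  using seminorm_add[of "x - y" "y - z"] by simp

lemma open_seminorm_ball: "open {x. p x < e}"
  by (intro open_Collect_less seminorm_cont continuous_intros)

end

text \<open>Subadditivity and homogeneity give |p x - p y| \<le> p (x - y), so smallness near 0 is
  continuity everywhere.\<close>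

lemma continuous_seminormI_bounded:
  fixes p :: "'a::complex_locally_convex_space \<Rightarrow> real"
  assumes add: "\<And>x y. p (x + y) \<le> p x + p y"
    and hom: "\<And>c x. p (c *\<^sub>C x) = cmod c * p x"
    and small: "\<And>e. e > 0 \<Longrightarrow> \<exists>V. open V \<and> 0 \<in> V \<and> (\<forall>x\<in>V. p x \<le> e)"
  shows "continuous_seminorm p"
proof -
  have d: "\<bar>p x - p y\<bar> \<le> p (x - y)" for x y
    using add[of "x - y" y] add[of "y - x" x] hom[of "-1" "x - y"]
    by (simp add: complex_vector.scale_minus_left scaleC_one)
  have "continuous_on UNIV p"
    unfolding continuous_on_def
  proof (intro ballI tendstoI)
    fix x :: 'a and e :: real
    assume "e > 0"
    then obtain V where V: "open V" "0 \<in> V" "\<And>x. x \<in> V \<Longrightarrow> p x \<le> e / 2"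
      using small[of "e/2"] by auto
    have "((\<lambda>y. y - x) \<longlongrightarrow> x - x) (at x within UNIV)"
      by (intro tendsto_intros)
    then have "\<forall>\<^sub>F y in at x within UNIV. y - x \<in> V"
      by (rule topological_tendstoD) (use V in auto)
    then show "\<forall>\<^sub>F y in at x within UNIV. dist (p y) (p x) < e"
    proof eventually_elim
      case (elim y)
      from V(3)[OF this] d[of y x] \<open>e > 0\<close> show ?case by (simp add: dist_real_def)
    qed
  qed
  with add hom show ?thesis unfolding continuous_seminorm_def by auto
qed

text \<open>The Minkowski functional of the convex hull of a balanced neighbourhood.\<close>

lemma seminorm_below_neighbourhood:
  fixes U :: "'a::complex_locally_convex_space set"
  assumes "open U" "0 \<in> U"
  obtains p where "continuous_seminorm p" "\<And>x. p x < 1 \<Longrightarrow> x \<in> U"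
proof -
  obtain V where V: "open V" "0 \<in> V" "V \<subseteq> U" "convex V"
    using convex_neighbourhood_0[OF assms] .
  \<comment> \<open>Joint continuity of scaling at (0, 0) provides a disc of scalars and a
    neighbourhood N whose product \<open>G\<close> stays in V. \<open>G\<close> is balanced because
    the scalars fill a disc.\<close>
  have "\<forall>\<^sub>F z in nhds (0::complex) \<times>\<^sub>F nhds (0::'a). fst z *\<^sub>C snd z \<in> V"
    by (rule topological_tendstoD[OF tendsto_scaleC_Pair[of 0 "0::'a"]])
      (use V in \<open>auto simp: complex_vector.scale_zero_left\<close>)
  then obtain P Q where PQ: "eventually P (nhds (0::complex))" "eventually Q (nhds (0::'a))"
     "\<And>c x. P c \<Longrightarrow> Q x \<Longrightarrow> c *\<^sub>C x \<in> V"
    unfolding eventually_prod_filter by auto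
  from PQ(1) obtain \<delta> where \<delta>: "\<delta> > 0" "\<And>c. cmod c < \<delta> \<Longrightarrow> P c"
    unfolding eventually_nhds_metric by (auto simp: dist_norm)
  from PQ(2) obtain N where N: "open N" "0 \<in> N" "\<And>x. x \<in> N \<Longrightarrow> Q x"
    unfolding eventually_nhds by auto
  define G where "G = {c *\<^sub>C x |c x. cmod c < \<delta> \<and> x \<in> N}"
  define B where "B = convex hull G"
  have "B \<subseteq> V"
    unfolding B_def by (rule hull_minimal) (use \<delta> N PQ V in \<open>auto simp: G_def\<close>)
  have bal: "d *\<^sub>C x \<in> B" if "cmod d \<le> 1" "x \<in> B" for d x
  proof -
    have "(*\<^sub>C) d ` G \<subseteq> G"
    proof
      fix y assume "y \<in> (*\<^sub>C) d ` G"
      then obtain c x where y: "y = (d * c) *\<^sub>C x" "cmod c < \<delta>" "x \<in> N"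
        by (auto simp: G_def scaleC_scaleC)
      have "cmod (d * c) \<le> 1 * cmod c"
        unfolding norm_mult by (rule mult_right_mono) (use that in auto)
      with y show "y \<in> G" unfolding G_def by force
    qed
    then have "convex hull ((*\<^sub>C) d ` G) \<subseteq> B"
      unfolding B_def by (rule hull_mono)
    moreover have "(*\<^sub>C) d ` B = convex hull ((*\<^sub>C) d ` G)"
      unfolding B_def by (rule convex_hull_linear_image[OF linear_scaleC])
    ultimately show ?thesis using that by blast
  qed
  \<comment> \<open>\<open>N'\<close> is the multiple \<delta>/2 of N, written as a preimage so that
    it is visibly open; it lies in \<open>G\<close> because \<delta>/2 < \<delta>.\<close>
  define N' where "N' = {y. complex_of_real (2/\<delta>) *\<^sub>C y \<in> N}"
  have N': "open N'" "0 \<in> N'"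
    unfolding N'_def using N by (auto intro: open_scaleC_preimage simp: complex_vector.scale_zero_right)
  have N'B: "N' \<subseteq> B"
  proof
    fix y assume "y \<in> N'"
    then have "complex_of_real (\<delta>/2) *\<^sub>C (complex_of_real (2/\<delta>) *\<^sub>C y) \<in> G"
      unfolding G_def N'_def mem_Collect_eq using \<delta>(1)
      by (intro exI[of _ "complex_of_real (\<delta>/2)"] exI[of _ "complex_of_real (2/\<delta>) *\<^sub>C y"]) (auto simp: norm_divide)
    moreover have "complex_of_real (\<delta>/2) *\<^sub>C (complex_of_real (2/\<delta>) *\<^sub>C y) = y"
      using \<delta>(1) by (simp add: scaleC_scaleC scaleC_one)
    ultimately show "y \<in> B" unfolding B_def by (simp add: hull_inc)
  qed
  have zB: "0 \<in> B" using N' N'B by auto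
  have cB: "convex B" unfolding B_def by simp
  define S where "S = (\<lambda>x. {t. t > 0 \<and> (1/t) *\<^sub>R x \<in> B})"
  define p where "p = (\<lambda>x. Inf (S x))"
  have bdd: "bdd_below (S x)" for x unfolding S_def by (rule bdd_belowI[of _ 0]) auto
  have ne: "S x \<noteq> {}" for x
  proof -
    have "((\<lambda>t. complex_of_real t *\<^sub>C x) \<longlongrightarrow> complex_of_real 0 *\<^sub>C x) (at_right 0)"
      by (intro tendsto_scaleC tendsto_intros)
    then have "\<forall>\<^sub>F t in at_right 0. complex_of_real t *\<^sub>C x \<in> N'"
      by (rule topological_tendstoD) (use N' in \<open>auto simp: complex_vector.scale_zero_left\<close>)
    moreover have "\<forall>\<^sub>F t::real in at_right 0. t > 0" by (rule eventually_at_right_less)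
    ultimately have "\<forall>\<^sub>F t in at_right 0. t > 0 \<and> complex_of_real t *\<^sub>C x \<in> N'"
      by (rule eventually_conj[rotated])
    then obtain t where "t > 0" "complex_of_real t *\<^sub>C x \<in> N'"
      using eventually_happens'[OF trivial_limit_at_right_real] by blast
    with N'B have "1/t \<in> S x" unfolding S_def by (auto simp: scaleR_scaleC)
    then show ?thesis by auto
  qed
  have ple: "p x \<le> t" if "t > 0" "(1/t) *\<^sub>R x \<in> B" for x t
    unfolding p_def by (rule cInf_lower[OF _ bdd]) (use that in \<open>auto simp: S_def\<close>)
  have pge: "z \<le> p x" if "\<And>t. t > 0 \<Longrightarrow> (1/t) *\<^sub>R x \<in> B \<Longrightarrow> z \<le> t" for x z
    unfolding p_def by (rule cInf_greatest[OF ne]) (use that in \<open>auto simp: S_def\<close>)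
  have p0: "0 \<le> p x" for x by (rule pge) auto
  have hom1: "p (c *\<^sub>C x) \<le> cmod c * p x" if "c \<noteq> 0" for c x
  proof -
    have "p (c *\<^sub>C x) / cmod c \<le> p x"
    proof (rule pge)
      fix t :: real assume t: "t > 0" "(1/t) *\<^sub>R x \<in> B"
      have "(c / of_real (cmod c)) *\<^sub>C ((1/t) *\<^sub>R x) \<in> B"
        by (rule bal) (use t that in \<open>auto simp: norm_divide\<close>)
      also have "(c / of_real (cmod c)) *\<^sub>C ((1/t) *\<^sub>R x) = (1 / (cmod c * t)) *\<^sub>R (c *\<^sub>C x)"
        by (simp add: scaleR_scaleC scaleC_scaleC field_simps)
      finally have "p (c *\<^sub>C x) \<le> cmod c * t"
        by (intro ple) (use t that in auto)
      then show "p (c *\<^sub>C x) / cmod c \<le> t" using that by (simp add: field_simps)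
    qed
    then show ?thesis using that by (simp add: field_simps)
  qed
  have hom: "p (c *\<^sub>C x) = cmod c * p x" for c x
  proof (cases "c = 0")
    case True
    have "p 0 \<le> e" if "e > 0" for e by (rule ple) (use that zB in auto)
    then have "p 0 \<le> 0" by (meson dense_ge)
    with p0[of 0] True show ?thesis by (simp add: complex_vector.scale_zero_left)
  next
    case False
    have "p (inverse c *\<^sub>C (c *\<^sub>C x)) \<le> cmod (inverse c) * p (c *\<^sub>C x)"
      by (rule hom1) (use False in auto)
    then have "cmod c * p x \<le> p (c *\<^sub>C x)"
      using False by (simp add: scaleC_scaleC scaleC_one norm_inverse norm_divide field_simps)
    with hom1[OF False, of x] show ?thesis by simp
  qed
  have add: "p (x + y) \<le> p x + p y" for x y
  proof -
    have "p (x + y) - p y \<le> p x"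
    proof (rule pge)
      fix t :: real assume t: "t > 0" "(1/t) *\<^sub>R x \<in> B"
      have "p (x + y) - t \<le> p y"
      proof (rule pge)
        fix u :: real assume u: "u > 0" "(1/u) *\<^sub>R y \<in> B"
        have "(t/(t+u)) *\<^sub>R ((1/t) *\<^sub>R x) + (u/(t+u)) *\<^sub>R ((1/u) *\<^sub>R y) \<in> B"
          by (rule convexD[OF cB]) (use t u in \<open>auto simp: add_divide_distrib[symmetric]\<close>)
        also have "(t/(t+u)) *\<^sub>R ((1/t) *\<^sub>R x) + (u/(t+u)) *\<^sub>R ((1/u) *\<^sub>R y) = (1/(t+u)) *\<^sub>R (x + y)"
          using t u by (simp add: scaleR_add_right)
        finally have "p (x + y) \<le> t + u" by (intro ple) (use t u in auto)
        then show "p (x + y) - t \<le> u" by simp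
      qed
      then show "p (x + y) - p y \<le> t" by simp
    qed
    then show ?thesis by simp
  qed
  have "continuous_seminorm p"
  proof (rule continuous_seminormI_bounded[OF add hom])
    fix e :: real assume "e > 0"
    show "\<exists>V. open V \<and> 0 \<in> V \<and> (\<forall>x\<in>V. p x \<le> e)"
      by (rule exI[of _ "{x. complex_of_real (1/e) *\<^sub>C x \<in> N'}"])
        (use \<open>e > 0\<close> N' N'B in \<open>auto intro!: open_scaleC_preimage ple simp: complex_vector.scale_zero_right scaleR_scaleC\<close>)
  qed
  moreover have "x \<in> U" if "p x < 1" for x
  proof -
    obtain t where t: "t > 0" "(1/t) *\<^sub>R x \<in> B" "t < 1"
      using \<open>p x < 1\<close> cInf_lessD[OF ne, of x 1] unfolding p_def by (auto simp: S_def)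
    have "complex_of_real t *\<^sub>C ((1/t) *\<^sub>R x) \<in> B" by (rule bal) (use t in auto)
    then have "x \<in> B" using t by (simp add: scaleR_scaleC scaleC_scaleC scaleC_one)
    with \<open>B \<subseteq> V\<close> V show ?thesis by auto
  qed
  ultimately show ?thesis using that by blast
qed

lemma tendsto_iff_seminorms:
  fixes f :: "'b \<Rightarrow> 'a::complex_locally_convex_space"
  shows "(f \<longlongrightarrow> l) F \<longleftrightarrow> (\<forall>p. continuous_seminorm p \<longrightarrow> ((\<lambda>x. p (f x - l)) \<longlongrightarrow> 0) F)"
proof safe
  fix p :: "'a \<Rightarrow> real"
  assume f: "(f \<longlongrightarrow> l) F" and p: "continuous_seminorm p"
  have "((\<lambda>x. f x - l) \<longlongrightarrow> l - l) F" by (intro tendsto_intros f)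
  then have "((\<lambda>x. p (f x - l)) \<longlongrightarrow> p (l - l)) F"
    using seminorm_cont[OF p]
    by (metis (full_types) UNIV_I continuous_on_def tendsto_compose)
  then show "((\<lambda>x. p (f x - l)) \<longlongrightarrow> 0) F" by (simp add: seminorm_0[OF p])
next
  assume *: "\<forall>p. continuous_seminorm p \<longrightarrow> ((\<lambda>x. p (f x - l)) \<longlongrightarrow> 0) F"
  show "(f \<longlongrightarrow> l) F"
  proof (rule topological_tendstoI)
    fix S assume S: "open S" "l \<in> S"
    have "continuous_on UNIV (\<lambda>y. y + l)" by (intro continuous_intros)
    then have "open ((\<lambda>y. y + l) -` S)" using S(1) by (rule open_vimage[rotated])
    then obtain p where p: "continuous_seminorm p" "\<And>x. p x < 1 \<Longrightarrow> x \<in> (\<lambda>y. y + l) -` S"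
      using seminorm_below_neighbourhood[of "(\<lambda>y. y + l) -` S"] S(2) by auto
    have "\<forall>\<^sub>F x in F. p (f x - l) < 1"
      using * p(1) by (intro order_tendstoD(2)[of _ 0]) auto
    then show "\<forall>\<^sub>F x in F. f x \<in> S"
      by eventually_elim (use p(2) in force)
  qed
qed

text \<open>The Hausdorff property enters through uniqueness of limits: the constant sequence x
  converges to y in every seminorm.\<close>

lemma seminorm_eqI:
  fixes x y :: "'a::sequentially_complete_lcs"
  assumes "\<And>p. continuous_seminorm p \<Longrightarrow> p (x - y) = 0"
  shows "x = y"
proof -
  have "((\<lambda>_::nat. x) \<longlongrightarrow> y) sequentially"
    unfolding tendsto_iff_seminorms by (simp add: assms)
  from LIMSEQ_unique[OF tendsto_const this] show ?thesis .
qed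

lemma Cauchy_seminorms_convergent:
  fixes X :: "nat \<Rightarrow> 'a::sequentially_complete_lcs"
  assumes "\<And>p e. continuous_seminorm p \<Longrightarrow> e > 0 \<Longrightarrow> \<exists>N. \<forall>m\<ge>N. \<forall>n\<ge>N. p (X m - X n) < e"
  shows "\<exists>x. X \<longlonglongrightarrow> x"
proof (rule sequentially_complete)
  fix U :: "'a set" assume "open U" "0 \<in> U"
  then obtain p where "continuous_seminorm p" "\<And>x. p x < 1 \<Longrightarrow> x \<in> U"
    using seminorm_below_neighbourhood by blast
  with assms[of p 1] show "\<exists>N. \<forall>m\<ge>N. \<forall>n\<ge>N. X m - X n \<in> U"
    by (meson zero_less_one)
qed

section \<open>Continuity and equicontinuity of operators in terms of seminorms\<close>

lemma cont_linear_opsD: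
  assumes "T \<in> cont_linear_ops"
  shows "T (x + y) = T x + T y" "T (c *\<^sub>C x) = c *\<^sub>C T x" "T (x - y) = T x - T y" "T 0 = 0"
    "T (r *\<^sub>R x) = r *\<^sub>R T x" "continuous_on UNIV T"
proof -
  interpret Vector_Spaces.linear "(*\<^sub>C)" "(*\<^sub>C)" T
    using assms by (simp add: cont_linear_ops_def)
  show "T (x + y) = T x + T y" "T (c *\<^sub>C x) = c *\<^sub>C T x" "T (x - y) = T x - T y" "T 0 = 0"
    "T (r *\<^sub>R x) = r *\<^sub>R T x" "continuous_on UNIV T"
    using assms by (auto simp: cont_linear_ops_def add diff scale scaleR_scaleC)
qed

lemma cont_linear_opsI:
  fixes T :: "'a::complex_locally_convex_space \<Rightarrow> 'a"
  assumes "\<And>x y. T (x + y) = T x + T y" "\<And>c x. T (c *\<^sub>C x) = c *\<^sub>C T x"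
    and "\<And>p. continuous_seminorm p \<Longrightarrow> \<exists>q. continuous_seminorm q \<and> (\<forall>x. p (T x) \<le> q x)"
  shows "T \<in> cont_linear_ops"
proof -
  have l: "Vector_Spaces.linear (*\<^sub>C) (*\<^sub>C) T"
    by unfold_locales (simp_all add: assms)
  then interpret Vector_Spaces.linear "(*\<^sub>C)" "(*\<^sub>C)" T .
  have "continuous_on UNIV T"
    unfolding continuous_on_def
  proof (intro ballI, subst tendsto_iff_seminorms, intro allI impI)
    fix x :: 'a and p :: "'a \<Rightarrow> real" assume "continuous_seminorm p"
    then obtain q where q: "continuous_seminorm q" "\<And>x. p (T x) \<le> q x"
      using assms(3) by blast
    have "((\<lambda>y. y) \<longlongrightarrow> x) (at x within UNIV)" by (rule tendsto_ident_at)
    then have "((\<lambda>y. q (y - x)) \<longlongrightarrow> 0) (at x within UNIV)"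
      using q(1) unfolding tendsto_iff_seminorms[of "\<lambda>y. y"] by blast
    then show "((\<lambda>y. p (T y - T x)) \<longlongrightarrow> 0) (at x within UNIV)"
      by (rule tendsto_sandwich[rotated 3])
        (auto simp: diff[symmetric] q seminorm_nonneg[OF \<open>continuous_seminorm p\<close>])
  qed
  with l show ?thesis by (simp add: cont_linear_ops_def)
qed

lemma equicontinuous_ops_seminormD:
  assumes "equicontinuous_ops F" "continuous_seminorm p"
  shows "\<exists>q. continuous_seminorm q \<and> (\<forall>T\<in>F. \<forall>x. p (T x) \<le> q x)"
proof -
  have "open {x. p x < 1}" "0 \<in> {x. p x < 1}"
    using open_seminorm_ball[OF assms(2)] seminorm_0[OF assms(2)] by auto
  then obtain V where V: "open V" "0 \<in> V" "\<And>T. T \<in> F \<Longrightarrow> T ` V \<subseteq> {x. p x < 1}"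
    using assms(1) unfolding equicontinuous_ops_def by meson
  obtain q where q: "continuous_seminorm q" "\<And>x. q x < 1 \<Longrightarrow> x \<in> V"
    using seminorm_below_neighbourhood[OF V(1,2)] by blast
  \<comment> \<open>Comparison with every s > q x avoids a division by q x, which may be
    zero.\<close>
  have "p (T x) \<le> q x" if "T \<in> F" for T x
  proof (rule dense_ge)
    fix s assume s: "q x < s"
    have "s > 0" using s seminorm_nonneg[OF q(1), of x] by linarith
    have T: "T \<in> cont_linear_ops" using that assms(1) by (auto simp: equicontinuous_ops_def)
    have "q ((1/s) *\<^sub>R x) < 1"
      using s \<open>s > 0\<close> by (simp add: seminorm_scaleR[OF q(1)])
    then have "p (T ((1/s) *\<^sub>R x)) < 1" using V(3)[OF that] q(2) by blast
    then show "p (T x) \<le> s"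
      using \<open>s > 0\<close> by (simp add: cont_linear_opsD[OF T] seminorm_scaleR[OF assms(2)] field_simps)
  qed
  with q show ?thesis by blast
qed

lemma cont_linear_ops_seminormD:
  assumes "T \<in> cont_linear_ops" "continuous_seminorm p"
  shows "\<exists>q. continuous_seminorm q \<and> (\<forall>x. p (T x) \<le> q x)"
proof -
  have "continuous_seminorm (\<lambda>x. p (T x))"
    unfolding continuous_seminorm_def
    using continuous_on_compose[OF cont_linear_opsD(6)[OF assms(1)]
        continuous_on_subset[OF seminorm_cont[OF assms(2)]]]
    by (auto simp: cont_linear_opsD[OF assms(1)] seminorm_add[OF assms(2)]
        seminorm_scaleC[OF assms(2)] o_def)
  then show ?thesis by blast
qed

lemma equicontinuous_opsI:
  assumes "F \<subseteq> cont_linear_ops"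
    and "\<And>p. continuous_seminorm p \<Longrightarrow> \<exists>q. continuous_seminorm q \<and> (\<forall>T\<in>F. \<forall>x. p (T x) \<le> q x)"
  shows "equicontinuous_ops F"
  unfolding equicontinuous_ops_def
proof (intro conjI assms(1) allI impI)
  fix U :: "'a set" assume "open U \<and> 0 \<in> U"
  then obtain p where p: "continuous_seminorm p" "\<And>x. p x < 1 \<Longrightarrow> x \<in> U"
    using seminorm_below_neighbourhood by blast
  obtain q where q: "continuous_seminorm q" "\<And>T x. T \<in> F \<Longrightarrow> p (T x) \<le> q x"
    using assms(2)[OF p(1)] by blast
  have "T x \<in> U" if "T \<in> F" "q x < 1" for T x
    using p(2)[of "T x"] q(2)[OF that(1), of x] that(2) by simp
  then show "\<exists>V. open V \<and> 0 \<in> V \<and> (\<forall>T\<in>F. T ` V \<subseteq> U)"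
    using open_seminorm_ball[OF q(1)] seminorm_0[OF q(1)]
    by (intro exI[of _ "{x. q x < 1}"]) auto
qed

lemma continuous_seminorm_add_scale:
  assumes "continuous_seminorm p" "continuous_seminorm q" "0 \<le> c" "0 \<le> d"
  shows "continuous_seminorm (\<lambda>x. c * p x + d * q x)"
  unfolding continuous_seminorm_def
proof (intro conjI allI)
  fix x y
  show "c * p (x + y) + d * q (x + y) \<le> c * p x + d * q x + (c * p y + d * q y)"
    using mult_left_mono[OF seminorm_add[OF assms(1)] assms(3), of x y]
      mult_left_mono[OF seminorm_add[OF assms(2)] assms(4), of x y]
    by (simp add: algebra_simps)
next
  show "continuous_on UNIV (\<lambda>x. c * p x + d * q x)"
    by (intro continuous_intros seminorm_cont assms)
qed (simp add: seminorm_scaleC assms algebra_simps)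

section \<open>The Hahn--Banach theorem\<close>

definition sublinear :: "('a::real_vector \<Rightarrow> real) \<Rightarrow> bool" where
  "sublinear q \<longleftrightarrow> (\<forall>x y. q (x + y) \<le> q x + q y) \<and> (\<forall>r x. r \<ge> 0 \<longrightarrow> q (r *\<^sub>R x) = r * q x)"

lemma sublinear_ge: "sublinear q \<Longrightarrow> - q (- x) \<le> q x"
proof -
  assume q: "sublinear q"
  have "q (x + (-x)) \<le> q x + q (- x)" using q unfolding sublinear_def by blast
  moreover have "q (0 *\<^sub>R x) = 0 * q x" using q unfolding sublinear_def by blast
  ultimately show ?thesis by simp
qed

text \<open>The infimum of q (x + t z) - t q z over t \<ge> 0 is sublinear, and t = 0 and t = 1 give
  the two bounds. A sublinear functional that equals all its shifts is superadditive, hence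
  additive; this replaces the extension of functionals by one dimension.\<close>

lemma sublinear_shift:
  fixes q :: "'a::real_vector \<Rightarrow> real"
  assumes q: "sublinear q"
  shows "\<exists>q'. sublinear q' \<and> (\<forall>x. q' x \<le> q x) \<and> (\<forall>x. q' x \<le> q (x + z) - q z)"
proof -
  define S where "S = (\<lambda>x. {q (x + t *\<^sub>R z) - t * q z |t. t \<ge> 0})"
  define q' where "q' = (\<lambda>x. Inf (S x))"
  have add: "q (x + y) \<le> q x + q y" and hom: "r \<ge> 0 \<Longrightarrow> q (r *\<^sub>R x) = r * q x" for x y r
    using q unfolding sublinear_def by auto
  have ne: "S x \<noteq> {}" for x unfolding S_def by (auto intro!: exI[of _ 0])
  have bdd: "bdd_below (S x)" for x
  proof (rule bdd_belowI[of _ "- q (-x)"])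
    fix s assume "s \<in> S x"
    then obtain t where t: "t \<ge> 0" "s = q (x + t *\<^sub>R z) - t * q z" unfolding S_def by auto
    have "q (t *\<^sub>R z) \<le> q (x + t *\<^sub>R z) + q (- x)" using add[of "x + t *\<^sub>R z" "-x"] by simp
    with t hom[of t z] show "- q (- x) \<le> s" by simp
  qed
  have le: "q' x \<le> q (x + t *\<^sub>R z) - t * q z" if "t \<ge> 0" for x t
    unfolding q'_def by (rule cInf_lower[OF _ bdd]) (use that in \<open>auto simp: S_def\<close>)
  have ge: "c \<le> q' x" if "\<And>t. t \<ge> 0 \<Longrightarrow> c \<le> q (x + t *\<^sub>R z) - t * q z" for x c
    unfolding q'_def by (rule cInf_greatest[OF ne]) (use that in \<open>auto simp: S_def\<close>)
  have 1: "q' (x + y) \<le> q' x + q' y" for x y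
  proof -
    have "q' (x + y) - q' y \<le> q' x"
    proof (rule ge)
      fix t :: real assume t: "t \<ge> 0"
      have "q' (x + y) - (q (x + t *\<^sub>R z) - t * q z) \<le> q' y"
      proof (rule ge)
        fix u :: real assume u: "u \<ge> 0"
        have "q' (x + y) \<le> q (x + y + (t + u) *\<^sub>R z) - (t + u) * q z"
          by (rule le) (use t u in auto)
        also have "x + y + (t + u) *\<^sub>R z = (x + t *\<^sub>R z) + (y + u *\<^sub>R z)" by (simp add: algebra_simps)
        finally show "q' (x + y) - (q (x + t *\<^sub>R z) - t * q z) \<le> q (y + u *\<^sub>R z) - u * q z"
          using add[of "x + t *\<^sub>R z" "y + u *\<^sub>R z"] by (simp add: algebra_simps)
      qed
      then show "q' (x + y) - q' y \<le> q (x + t *\<^sub>R z) - t * q z" by simp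
    qed
    then show ?thesis by simp
  qed
  have 2: "q' (r *\<^sub>R x) \<le> r * q' x" if "r > 0" for r x
  proof -
    have "q' (r *\<^sub>R x) / r \<le> q' x"
    proof (rule ge)
      fix t :: real assume t: "t \<ge> 0"
      have "q' (r *\<^sub>R x) \<le> q (r *\<^sub>R x + (r * t) *\<^sub>R z) - (r * t) * q z" by (rule le) (use t that in auto)
      also have "r *\<^sub>R x + (r * t) *\<^sub>R z = r *\<^sub>R (x + t *\<^sub>R z)" by (simp add: algebra_simps)
      finally show "q' (r *\<^sub>R x) / r \<le> q (x + t *\<^sub>R z) - t * q z"
        using that hom[of r "x + t *\<^sub>R z"] by (simp add: field_simps)
    qed
    then show ?thesis using that by (simp add: field_simps)
  qed
  have "q' 0 \<le> 0" using le[of 0 0] hom[of 0 0] by simp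
  moreover have "0 \<le> q' 0" by (rule ge) (use hom in auto)
  ultimately have q0: "q' 0 = 0" by simp
  have 3: "q' (r *\<^sub>R x) = r * q' x" if "r \<ge> 0" for r x
  proof (cases "r = 0")
    case False
    then have r: "r > 0" using that by simp
    have "q' ((1/r) *\<^sub>R (r *\<^sub>R x)) \<le> (1/r) * q' (r *\<^sub>R x)" by (rule 2) (use r in auto)
    then have "r * q' x \<le> q' (r *\<^sub>R x)" using r by (simp add: field_simps)
    with 2[OF r, of x] show ?thesis by simp
  qed (simp add: q0)
  show ?thesis
    by (intro exI[of _ q'] conjI allI) (use 1 3 le[of 0] le[of 1] in \<open>auto simp: sublinear_def\<close>)
qed

text \<open>A minimal sublinear functional is linear, since it coincides with all its shifts.\<close>

lemma Hahn_Banach_real: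
  fixes p :: "'a::real_vector \<Rightarrow> real"
  assumes p: "sublinear p"
  obtains f where "linear f" "\<And>x. f x \<le> p x" "f x0 = p x0"
proof -
  \<comment> \<open>Shifting by x0 before minimizing secures equality at x0: every f below
    \<open>p'\<close> satisfies f (- x0) \<le> p (- x0 + x0) - p x0 = - p x0.\<close>
  obtain p' where p': "sublinear p'" "\<And>x. p' x \<le> p x" "\<And>x. p' x \<le> p (x + x0) - p x0"
    using sublinear_shift[OF p] by blast
  define Q where "Q = {q. sublinear q \<and> (\<forall>x. q x \<le> p' x)}"
  \<comment> \<open>Zorn's lemma is applied to the reversed pointwise order, so its maximal element
    is a minimal functional and the bound of a chain is its pointwise infimum.\<close>
  have "\<exists>m\<in>Q. \<forall>q\<in>Q. (\<forall>x. q x \<le> m x) \<longrightarrow> q = m"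
  proof (rule predicate_Zorn[where P = "\<lambda>q r. \<forall>x. r x \<le> q x"])
    show "partial_order_on Q (relation_of (\<lambda>q r. \<forall>x. r x \<le> q x) Q)"
      unfolding partial_order_on_def preorder_on_def refl_on_def trans_def antisym_def relation_of_def
      by (auto intro: order_trans simp: fun_eq_iff order_eq_iff)
  next
    fix C assume C: "C \<in> Chains (relation_of (\<lambda>q r. \<forall>x. r x \<le> q x) Q)"
    have CQ: "C \<subseteq> Q" using C unfolding Chains_def relation_of_def by auto
    have lin: "(\<forall>x. q x \<le> r x) \<or> (\<forall>x. r x \<le> q x)" if "q \<in> C" "r \<in> C" for q r
      using C that unfolding Chains_def relation_of_def by auto
    show "\<exists>u\<in>Q. \<forall>q\<in>C. \<forall>x. u x \<le> q x"
    proof (cases "C = {}")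
      case True
      have "p' \<in> Q" using p' by (auto simp: Q_def)
      with True show ?thesis by auto
    next
      case False
      define u where "u = (\<lambda>x. INF q\<in>C. q x)"
      have bdd: "bdd_below ((\<lambda>q. q x) ` C)" for x
      proof (rule bdd_belowI2)
        fix q assume "q \<in> C"
        then have "sublinear q" "q (- x) \<le> p' (- x)" using CQ by (auto simp: Q_def)
        with sublinear_ge[of q x] show "- p' (- x) \<le> q x" by simp
      qed
      have ule: "u x \<le> q x" if "q \<in> C" for q x
        unfolding u_def by (rule cINF_lower[OF bdd that])
      have uge: "c \<le> u x" if "\<And>q. q \<in> C \<Longrightarrow> c \<le> q x" for c x
        unfolding u_def by (rule cINF_greatest[OF False that])
      have sub: "q (x + y) \<le> q x + q y" "r \<ge> 0 \<Longrightarrow> q (r *\<^sub>R x) = r * q x" if "q \<in> C" for q x y r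
        using that CQ unfolding Q_def sublinear_def by auto
      have u_add: "u (x + y) \<le> u x + u y" for x y
      proof -
        have "u (x + y) - u y \<le> u x"
        proof (rule uge)
          fix q assume q: "q \<in> C"
          have "u (x + y) - q x \<le> u y"
          proof (rule uge)
            fix r assume r: "r \<in> C"
            \<comment> \<open>One of two members of a chain is the smaller everywhere; its
              subadditivity bounds u (x + y), since u lies below both.\<close>
            from lin[OF q r] show "u (x + y) - q x \<le> r y"
            proof
              assume "\<forall>x. q x \<le> r x"
              then have "q y \<le> r y" by blast
              then have "u (x + y) \<le> q x + r y"
                using ule[OF q, of "x + y"] sub(1)[OF q, of x y] by linarith
              then show ?thesis by simp
            next
              assume "\<forall>x. r x \<le> q x"
              then have "r x \<le> q x" by blast
              then have "u (x + y) \<le> q x + r y"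
                using ule[OF r, of "x + y"] sub(1)[OF r, of x y] by linarith
              then show ?thesis by simp
            qed
          qed
          then show "u (x + y) - u y \<le> q x" by simp
        qed
        then show ?thesis by simp
      qed
      have hl: "u (r *\<^sub>R x) \<le> r * u x" if "r > 0" for r x
      proof -
        have "u (r *\<^sub>R x) / r \<le> u x"
        proof (rule uge)
          fix q assume "q \<in> C"
          with ule[OF this, of "r *\<^sub>R x"] sub(2)[OF this, of r x] that
          show "u (r *\<^sub>R x) / r \<le> q x" by (simp add: field_simps)
        qed
        then show ?thesis using that by (simp add: field_simps)
      qed
      have u0: "u 0 = 0"
      proof (rule antisym)
        obtain q where "q \<in> C" using False by auto
        from ule[OF this, of 0] sub(2)[OF this, of 0 0] show "u 0 \<le> 0" by simp
        have "q 0 = 0" if "q \<in> C" for q using sub(2)[OF that, of 0 0] by simp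
        then show "0 \<le> u 0" by (intro uge) (metis order_refl)
      qed
      have u_hom: "u (r *\<^sub>R x) = r * u x" if "r \<ge> 0" for r x
      proof (cases "r = 0")
        case False
        then have r: "r > 0" using that by simp
        have "u ((1/r) *\<^sub>R (r *\<^sub>R x)) \<le> (1/r) * u (r *\<^sub>R x)" by (rule hl) (use r in auto)
        then have "r * u x \<le> u (r *\<^sub>R x)" using r by (simp add: field_simps)
        with hl[OF r, of x] show ?thesis by simp
      qed (simp add: u0)
      have "sublinear u" using u_add u_hom unfolding sublinear_def by simp
      moreover have "u x \<le> p' x" for x
      proof -
        obtain q where "q \<in> C" using False by auto
        with ule[OF this, of x] CQ show ?thesis by (force simp: Q_def intro: order_trans)
      qed
      ultimately have "u \<in> Q" by (auto simp: Q_def)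
      with ule show ?thesis by blast
    qed
  qed
  then obtain f where fQ: "f \<in> Q" and minQ: "\<And>q. q \<in> Q \<Longrightarrow> (\<And>x. q x \<le> f x) \<Longrightarrow> q = f"
    by blast
  have f: "sublinear f" "f x \<le> p' x" for x using fQ by (auto simp: Q_def)
  have min: "q = f" if "sublinear q" "\<And>x. q x \<le> f x" for q
    by (rule minQ) (use that f(2) in \<open>auto simp: Q_def intro: order_trans\<close>)
  have add1: "f x + f z \<le> f (x + z)" for x z
  proof -
    obtain q where q: "sublinear q" "\<And>x. q x \<le> f x" "\<And>x. q x \<le> f (x + z) - f z"
      using sublinear_shift[OF f(1), of z] by blast
    from min[OF q(1,2)] q(3)[of x] show ?thesis by simp
  qed
  have add: "f (x + z) = f x + f z" for x z
    using add1[of x z] f(1) by (simp add: sublinear_def order_antisym)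
  have hom: "r \<ge> 0 \<Longrightarrow> f (r *\<^sub>R x) = r * f x" for r x
    using f(1) unfolding sublinear_def by blast
  have f0: "f 0 = 0" using hom[of 0 0] by simp
  have fm: "f (- x) = - f x" for x using add[of x "-x"] f0 by simp
  have "f (r *\<^sub>R x) = r * f x" for r x
  proof (cases "r \<ge> 0")
    case False
    then have "f ((-r) *\<^sub>R x) = (-r) * f x" by (intro hom) auto
    then show ?thesis using fm[of "r *\<^sub>R x"] by simp
  qed (rule hom)
  then have "linear f" by (intro linearI) (auto simp: add)
  moreover have "f x \<le> p x" for x using f(2) p'(2) order_trans by blast
  moreover have "f x0 = p x0"
  proof (rule antisym)
    show "f x0 \<le> p x0" by fact
    have "p 0 = 0" using p unfolding sublinear_def by (metis mult_zero_left order_refl scaleR_zero_left)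
    then have "f (- x0) \<le> - p x0" using f(2)[of "-x0"] p'(3)[of "-x0"] by simp
    then show "p x0 \<le> f x0" by (simp add: fm)
  qed
  ultimately show ?thesis using that by blast
qed

section \<open>Continuous functionals and the complex Hahn-Banach theorem\<close>

definition cont_functional :: "('a::complex_locally_convex_space \<Rightarrow> complex) \<Rightarrow> bool" where
  "cont_functional \<psi> \<longleftrightarrow>
     (\<forall>x y. \<psi> (x + y) = \<psi> x + \<psi> y) \<and> (\<forall>c x. \<psi> (c *\<^sub>C x) = c * \<psi> x) \<and> continuous_on UNIV \<psi>"

context
  fixes \<psi> :: "'a::complex_locally_convex_space \<Rightarrow> complex"
  assumes \<psi>: "cont_functional \<psi>"
begin

lemma functional_add: "\<psi> (x + y) = \<psi> x + \<psi> y"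
  and functional_scaleC: "\<psi> (c *\<^sub>C x) = c * \<psi> x"
  and functional_cont: "continuous_on UNIV \<psi>"
  using \<psi> unfolding cont_functional_def by auto

lemma functional_scaleR: "\<psi> (r *\<^sub>R x) = of_real r * \<psi> x"
  by (simp add: scaleR_scaleC functional_scaleC)

lemma functional_minus: "\<psi> (- x) = - \<psi> x"
  using functional_scaleR[of "-1" x] by simp

lemma functional_diff: "\<psi> (x - y) = \<psi> x - \<psi> y"
  using functional_add[of x "-y"] functional_minus by simp

lemma functional_0: "\<psi> 0 = 0"
  using functional_diff[of 0 0] by simp

lemma functional_sum: "finite I \<Longrightarrow> \<psi> (\<Sum>i\<in>I. f i) = (\<Sum>i\<in>I. \<psi> (f i))"
  by (induction I rule: finite_induct) (simp_all add: functional_0 functional_add)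

lemma continuous_seminorm_functional: "continuous_seminorm (\<lambda>x. cmod (\<psi> x))"
  unfolding continuous_seminorm_def
  by (auto simp: functional_add functional_scaleC norm_mult norm_triangle_ineq
      intro!: continuous_intros functional_cont)

lemma tendsto_functional: "(f \<longlongrightarrow> l) F \<Longrightarrow> ((\<lambda>x. \<psi> (f x)) \<longlongrightarrow> \<psi> l) F"
  using functional_cont by (metis UNIV_I continuous_on_def tendsto_compose)

end

lemma Hahn_Banach_seminorm:
  fixes p :: "'a::complex_locally_convex_space \<Rightarrow> real"
  assumes p: "continuous_seminorm p"
  obtains \<psi> where "cont_functional \<psi>" "\<And>x. cmod (\<psi> x) \<le> p x" "\<psi> x0 = of_real (p x0)"
proof -
  have "sublinear p"
    unfolding sublinear_def by (auto simp: seminorm_add[OF p] seminorm_scaleR[OF p])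
  then obtain f where f: "linear f" "\<And>x. f x \<le> p x" "f x0 = p x0"
    using Hahn_Banach_real by blast
  interpret f: linear f by fact
  define \<psi> where "\<psi> x = Complex (f x) (- f (\<i> *\<^sub>C x))" for x
  have ii: "\<i> *\<^sub>C \<i> *\<^sub>C x = - x" for x :: 'a
    by (simp add: scaleC_scaleC complex_vector.scale_minus_left scaleC_one)
  have add: "\<psi> (x + y) = \<psi> x + \<psi> y" for x y
    by (simp add: \<psi>_def scaleC_add_right f.add complex_eq_iff)
  have hr: "\<psi> (complex_of_real r *\<^sub>C x) = of_real r * \<psi> x" for r x
  proof -
    have "\<i> *\<^sub>C complex_of_real r *\<^sub>C x = r *\<^sub>R (\<i> *\<^sub>C x)"
      by (simp add: scaleR_scaleC scaleC_scaleC mult.commute)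
    then show ?thesis
      by (simp add: \<psi>_def scaleR_scaleC[symmetric] f.scaleR complex_eq_iff)
  qed
  have hi: "\<psi> (\<i> *\<^sub>C x) = \<i> * \<psi> x" for x
    by (simp add: \<psi>_def ii f.neg complex_eq_iff)
  have hom: "\<psi> (c *\<^sub>C x) = c * \<psi> x" for c x
  proof -
    have "c *\<^sub>C x = complex_of_real (Re c) *\<^sub>C x + \<i> *\<^sub>C complex_of_real (Im c) *\<^sub>C x"
      by (metis complex_eq scaleC_add_left scaleC_scaleC)
    then have "\<psi> (c *\<^sub>C x) = (of_real (Re c) + \<i> * of_real (Im c)) * \<psi> x"
      by (simp only: add hr hi distrib_right mult.assoc)
    then show ?thesis by (simp add: complex_eq[symmetric])
  qed
  have bd: "cmod (\<psi> x) \<le> p x" for x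
  proof (cases "\<psi> x = 0")
    case False
    \<comment> \<open>The unimodular c rotates the value at x onto the positive real axis, where
      only the real part f counts and its bound by p applies.\<close>
    define c where "c = cnj (sgn (\<psi> x))"
    have "cmod c = 1" using False by (simp add: c_def norm_sgn)
    have "c * \<psi> x = \<psi> x * cnj (\<psi> x) / of_real (cmod (\<psi> x))"
      by (simp add: c_def sgn_eq)
    also have "\<dots> = of_real (cmod (\<psi> x))"
      using False by (simp add: complex_norm_square[symmetric] power2_eq_square)
    finally have "c * \<psi> x = of_real (cmod (\<psi> x))" .
    then have "cmod (\<psi> x) = Re (\<psi> (c *\<^sub>C x))" by (simp add: hom)
    also have "\<dots> = f (c *\<^sub>C x)" by (simp add: \<psi>_def)
    also have "\<dots> \<le> p (c *\<^sub>C x)" by (rule f(2))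
    also have "\<dots> = p x" by (simp add: seminorm_scaleC[OF p] \<open>cmod c = 1\<close>)
    finally show ?thesis .
  qed (simp add: seminorm_nonneg[OF p])
  have "continuous_on UNIV \<psi>"
    unfolding continuous_on_def
  proof (intro ballI)
    fix x :: 'a
    have *: "((\<lambda>y. y) \<longlongrightarrow> x) (at x within UNIV)" by (rule tendsto_ident_at)
    have p0: "((\<lambda>y. p (y - x)) \<longlongrightarrow> 0) (at x within UNIV)"
      using * p unfolding tendsto_iff_seminorms[of "\<lambda>y. y"] by blast
    have "((\<lambda>y. \<psi> y - \<psi> x) \<longlongrightarrow> 0) (at x within UNIV)"
    proof (rule tendsto_0_le[OF p0, of _ 1], rule always_eventually, intro allI)
      fix y
      have "\<psi> y = \<psi> (y - x) + \<psi> x" using add[of "y - x" x] by simp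
      with bd[of "y - x"] show "norm (\<psi> y - \<psi> x) \<le> norm (p (y - x)) * 1" by simp
    qed
    then show "(\<psi> \<longlongrightarrow> \<psi> x) (at x within UNIV)" by (rule LIM_zero_cancel)
  qed
  with add hom have "cont_functional \<psi>" unfolding cont_functional_def by auto
  moreover have "\<psi> x0 = of_real (p x0)"
  proof -
    have "Re (\<psi> x0) = p x0" by (simp add: \<psi>_def f)
    moreover have "Im (\<psi> x0) = 0"
    proof -
      have "(Re (\<psi> x0))\<^sup>2 + (Im (\<psi> x0))\<^sup>2 \<le> (p x0)\<^sup>2"
        using power_mono[OF bd[of x0], of 2] by (simp add: cmod_power2)
      with \<open>Re (\<psi> x0) = p x0\<close> show ?thesis by simp
    qed
    ultimately show ?thesis by (simp add: complex_eq_iff)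
  qed
  ultimately show ?thesis using bd that by blast
qed

lemma functional_eqI:
  fixes x y :: "'a::sequentially_complete_lcs"
  assumes "\<And>\<psi>. cont_functional \<psi> \<Longrightarrow> \<psi> x = \<psi> y"
  shows "x = y"
proof (rule seminorm_eqI)
  fix p :: "'a \<Rightarrow> real" assume "continuous_seminorm p"
  then obtain \<psi> where "cont_functional \<psi>" "\<psi> (x - y) = of_real (p (x - y))"
    using Hahn_Banach_seminorm by blast
  with assms[of \<psi>] show "p (x - y) = 0" by (simp add: functional_diff)
qed

section \<open>Weak integrals\<close>

lemma integrable_indicator_times:
  fixes g :: "'b \<Rightarrow> real"
  assumes "integrable M g" "A \<in> sets M"
  shows "integrable M (\<lambda>s. indicator A s * g s)"
  using integrable_mult_indicator[OF assms(2,1)] by simp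

text \<open>The Pettis integral of f against a scalar kernel. The domain of integration is encoded
  in the zeros of g, so that \<open>lborel\<close> is the only measure needed and values of f
  outside that domain are immaterial.\<close>

definition weak_integral ::
    "(real \<Rightarrow> real) \<Rightarrow> (real \<Rightarrow> 'a::complex_locally_convex_space) \<Rightarrow> 'a \<Rightarrow> bool" where
  "weak_integral g f y \<longleftrightarrow>
     (\<forall>\<psi>. cont_functional \<psi> \<longrightarrow> has_bochner_integral lborel (\<lambda>s. of_real (g s) * \<psi> (f s)) (\<psi> y))"

lemma weak_integralD:
  "weak_integral g f y \<Longrightarrow> cont_functional \<psi> \<Longrightarrow>
    has_bochner_integral lborel (\<lambda>s. of_real (g s) * \<psi> (f s)) (\<psi> y)"
  unfolding weak_integral_def by blast

lemma weak_integral_unique: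
  fixes y z :: "'a::sequentially_complete_lcs"
  assumes "weak_integral g f y" "weak_integral g f z"
  shows "y = z"
  by (rule functional_eqI)
    (use assms[THEN weak_integralD] has_bochner_integral_eq in blast)

lemma weak_integral_cong:
  assumes "\<And>s. g s \<noteq> 0 \<Longrightarrow> f s = f' s"
  shows "weak_integral g f y \<longleftrightarrow> weak_integral g f' y"
proof -
  have "of_real (g s) * \<psi> (f s) = of_real (g s) * \<psi> (f' s)" for \<psi> :: "'a \<Rightarrow> complex" and s
    using assms[of s] by (cases "g s = 0") auto
  then show ?thesis unfolding weak_integral_def by (simp only:)
qed

lemma weak_integral_diff_kernel:
  assumes "weak_integral g f y" "weak_integral g' f y'"
  shows "weak_integral (\<lambda>s. g s - g' s) f (y - y')"
  unfolding weak_integral_def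
proof (intro allI impI)
  fix \<psi> :: "'a \<Rightarrow> complex" assume \<psi>: "cont_functional \<psi>"
  from has_bochner_integral_diff[OF weak_integralD[OF assms(1) \<psi>] weak_integralD[OF assms(2) \<psi>]]
  show "has_bochner_integral lborel (\<lambda>s. of_real (g s - g' s) * \<psi> (f s)) (\<psi> (y - y'))"
    by (simp add: functional_diff[OF \<psi>] left_diff_distrib)
qed

lemma weak_integral_add:
  assumes "weak_integral g f y" "weak_integral g f' y'"
  shows "weak_integral g (\<lambda>s. f s + f' s) (y + y')"
  unfolding weak_integral_def
proof (intro allI impI)
  fix \<psi> :: "'a \<Rightarrow> complex" assume \<psi>: "cont_functional \<psi>"
  from has_bochner_integral_add[OF weak_integralD[OF assms(1) \<psi>] weak_integralD[OF assms(2) \<psi>]]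
  show "has_bochner_integral lborel (\<lambda>s. of_real (g s) * \<psi> (f s + f' s)) (\<psi> (y + y'))"
    by (simp add: functional_add[OF \<psi>] distrib_left)
qed

lemma cont_functional_comp:
  assumes "cont_functional \<psi>" "T \<in> cont_linear_ops"
  shows "cont_functional (\<lambda>x. \<psi> (T x))"
  using assms(1) continuous_on_compose2[OF functional_cont[OF assms(1)] cont_linear_opsD(6)[OF assms(2)]]
  unfolding cont_functional_def by (simp add: cont_linear_opsD[OF assms(2)])

lemma scaleC_cont_linear_ops: "(*\<^sub>C) c \<in> cont_linear_ops"
  unfolding cont_linear_ops_def
  by (auto intro!: continuous_on_scaleC continuous_intros complex_vector.linear_scale_self)

lemma weak_integral_op:
  assumes "weak_integral g f y" "T \<in> cont_linear_ops"
  shows "weak_integral g (\<lambda>s. T (f s)) (T y)"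
  unfolding weak_integral_def
  using weak_integralD[OF assms(1) cont_functional_comp[OF _ assms(2)]] by blast

text \<open>Some functional below p attains p at y. Vector estimates thus follow from scalar ones
  that are uniform over the functionals below p.\<close>

lemma seminorm_le_if_functionals_le:
  fixes y :: "'a::complex_locally_convex_space"
  assumes "continuous_seminorm p"
    and "\<And>\<psi>. cont_functional \<psi> \<Longrightarrow> (\<And>x. cmod (\<psi> x) \<le> p x) \<Longrightarrow> cmod (\<psi> y) \<le> B"
  shows "p y \<le> B"
proof -
  obtain \<psi> where "cont_functional \<psi>" "\<And>x. cmod (\<psi> x) \<le> p x" "\<psi> y = of_real (p y)"
    using Hahn_Banach_seminorm[OF assms(1), of y] by blast
  with assms(2)[of \<psi>] seminorm_nonneg[OF assms(1), of y] show ?thesis by simp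
qed

text \<open>The majorant h takes the place of the integral of |g| p (f), whose integrand is not
  known to be measurable.\<close>

lemma weak_integral_bound:
  assumes "weak_integral g f y" "continuous_seminorm p" "integrable lborel h"
    and "\<And>s. \<bar>g s\<bar> * p (f s) \<le> h s"
  shows "p y \<le> (\<integral>s. h s \<partial>lborel)"
proof (rule seminorm_le_if_functionals_le[OF assms(2)])
  fix \<psi> assume \<psi>: "cont_functional \<psi>" "\<And>x. cmod (\<psi> x) \<le> p x"
  note w = weak_integralD[OF assms(1) \<psi>(1)]
  have "cmod (of_real (g s) * \<psi> (f s)) \<le> h s" for s
    using mult_left_mono[OF \<psi>(2)[of "f s"], of "\<bar>g s\<bar>"] assms(4)[of s] by (simp add: norm_mult)
  then have "cmod (\<integral>s. of_real (g s) * \<psi> (f s) \<partial>lborel) \<le> (\<integral>s. h s \<partial>lborel)"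
    by (intro Bochner_Integration.integral_norm_bound_integral assms(3))
      (use w in \<open>auto simp: has_bochner_integral_iff\<close>)
  then show "cmod (\<psi> y) \<le> (\<integral>s. h s \<partial>lborel)"
    using w by (simp add: has_bochner_integral_iff)
qed

text \<open>The proof is by contradiction along sequences in the compact interval, because the
  target type carries no uniform structure.\<close>

lemma uniformly_continuous_seminorm:
  fixes f :: "real \<Rightarrow> 'a::complex_locally_convex_space"
  assumes f: "continuous_on {0..T} f" and p: "continuous_seminorm p" and "e > 0"
  shows "\<exists>d>0. \<forall>s\<in>{0..T}. \<forall>s'\<in>{0..T}. \<bar>s - s'\<bar> < d \<longrightarrow> p (f s - f s') < e"
proof (rule ccontr)
  assume "\<not> ?thesis"
  then have "\<exists>s s'. s \<in> {0..T} \<and> s' \<in> {0..T} \<and> \<bar>s - s'\<bar> < 1 / real (Suc n) \<and> p (f s - f s') \<ge> e" for n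
    by (metis not_less of_nat_0_less_iff zero_less_Suc zero_less_divide_1_iff)
  then obtain s s' where s: "\<And>n. s n \<in> {0..T}" "\<And>n. s' n \<in> {0..T}" "\<And>n. \<bar>s n - s' n\<bar> < 1 / real (Suc n)"
    "\<And>n. p (f (s n) - f (s' n)) \<ge> e"
    by metis
  have "seq_compact {0..T}" by (simp add: compact_imp_seq_compact)
  then obtain l r where l: "l \<in> {0..T}" "strict_mono r" "(s \<circ> r) \<longlonglongrightarrow> l"
    using seq_compactE[of "{0..T}" s] s(1) by blast
  have d0: "(\<lambda>n. s n - s' n) \<longlonglongrightarrow> 0"
    by (rule tendsto_rabs_zero_cancel, rule tendsto_sandwich[OF _ _ tendsto_const LIMSEQ_Suc[OF lim_1_over_n]])
      (use s(3) in \<open>auto intro!: always_eventually less_imp_le simp del: of_nat_Suc\<close>)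
  have "(\<lambda>n. (s \<circ> r) n - (s (r n) - s' (r n))) \<longlonglongrightarrow> l - 0"
    by (intro tendsto_diff l(3) LIMSEQ_subseq_LIMSEQ[OF d0 l(2), unfolded o_def])
  then have s'l: "(\<lambda>n. s' (r n)) \<longlonglongrightarrow> l" by simp
  have sl: "(\<lambda>n. s (r n)) \<longlonglongrightarrow> l" using l(3) by (simp add: o_def)
  have "(\<lambda>n. f (s (r n))) \<longlonglongrightarrow> f l" "(\<lambda>n. f (s' (r n))) \<longlonglongrightarrow> f l"
    using continuous_on_tendsto_compose[OF f sl l(1)] continuous_on_tendsto_compose[OF f s'l l(1)] s(1,2)
    by auto
  then have "(\<lambda>n. f (s (r n)) - f (s' (r n))) \<longlonglongrightarrow> f l - f l" by (rule tendsto_diff)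
  then have "(\<lambda>n. p (f (s (r n)) - f (s' (r n)))) \<longlonglongrightarrow> 0"
    using p unfolding tendsto_iff_seminorms by auto
  then have "\<forall>\<^sub>F n in sequentially. p (f (s (r n)) - f (s' (r n))) < e"
    using \<open>e > 0\<close> by (rule order_tendstoD(2))
  then obtain n where "p (f (s (r n)) - f (s' (r n))) < e"
    using eventually_happens'[OF sequentially_bot] by blast
  with s(4)[of "r n"] show False by simp
qed

section \<open>Riemann sums with exact weights\<close>

definition grid :: "nat \<Rightarrow> real \<Rightarrow> real" where
  "grid n s = real (nat \<lfloor>real (Suc n) * s\<rfloor>) / real (Suc n)"

lemma grid_bounds:
  assumes "s \<ge> 0"
  shows "0 \<le> grid n s" "grid n s \<le> s" "s - grid n s < 1 / real (Suc n)"
proof -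
  have "0 \<le> \<lfloor>real (Suc n) * s\<rfloor>" using assms by simp
  then have *: "real (nat \<lfloor>real (Suc n) * s\<rfloor>) = real_of_int \<lfloor>real (Suc n) * s\<rfloor>" by simp
  have g: "real (Suc n) * grid n s = real_of_int \<lfloor>real (Suc n) * s\<rfloor>"
    unfolding grid_def * by simp
  show "0 \<le> grid n s" unfolding grid_def by simp
  have "real (Suc n) * grid n s \<le> real (Suc n) * s" unfolding g by linarith
  then show "grid n s \<le> s" by (simp del: of_nat_Suc)
  have "real (Suc n) * s < real (Suc n) * grid n s + 1" unfolding g by linarith
  then show "s - grid n s < 1 / real (Suc n)"
    by (simp add: field_simps del: of_nat_Suc)
qed

lemma grid_tendsto:
  assumes "s \<ge> 0"
  shows "(\<lambda>n. grid n s) \<longlonglongrightarrow> s"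
proof -
  have "(\<lambda>n. s - grid n s) \<longlonglongrightarrow> 0"
    by (rule tendsto_sandwich[OF _ _ tendsto_const LIMSEQ_Suc[OF lim_1_over_n]])
      (use grid_bounds[OF assms] in \<open>auto intro!: always_eventually less_imp_le simp del: of_nat_Suc\<close>)
  then have "(\<lambda>n. s - (s - grid n s)) \<longlonglongrightarrow> s - 0" by (intro tendsto_intros)
  then show ?thesis by simp
qed

lemma borel_measurable_grid[measurable]: "grid n \<in> borel_measurable borel"
  unfolding grid_def by measurable

text \<open>The weights are exact integrals of g over the grid cells and only f is sampled, so g may
  have an integrable singularity. Cell 0 contains all negative s, because \<open>nat\<close> sends
  negative integers to 0; this is harmless, as g vanishes there in every use.\<close>

definition Riemann_sum :: "(real \<Rightarrow> real) \<Rightarrow> (real \<Rightarrow> 'a::real_vector) \<Rightarrow> real \<Rightarrow> nat \<Rightarrow> 'a" where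
  "Riemann_sum g f T n = (\<Sum>i\<le>nat \<lfloor>real (Suc n) * T\<rfloor>.
     (\<integral>s. indicator {s. nat \<lfloor>real (Suc n) * s\<rfloor> = i} s * g s \<partial>lborel) *\<^sub>R f (real i / real (Suc n)))"

text \<open>On cell i the grid point is i / (n + 1). Applying a functional to the sum therefore
  amounts to replacing f s by f (grid n s) under the integral.\<close>

lemma functional_Riemann_sum:
  assumes \<psi>: "cont_functional \<psi>" and g: "integrable lborel g"
    and g0: "\<And>s. s \<notin> {0..T} \<Longrightarrow> g s = 0"
  shows "has_bochner_integral lborel (\<lambda>s. of_real (g s) * \<psi> (f (grid n s))) (\<psi> (Riemann_sum g f T n))"
proof -
  let ?N = "nat \<lfloor>real (Suc n) * T\<rfloor>"
  let ?I = "\<lambda>i s. indicator {s. nat \<lfloor>real (Suc n) * s\<rfloor> = i} s :: real"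
  have gi: "has_bochner_integral lborel (\<lambda>s. ?I i s * g s) (\<integral>s. ?I i s * g s \<partial>lborel)" for i
    by (rule has_bochner_integral_integrable) (intro integrable_indicator_times g, measurable)
  have "has_bochner_integral lborel
      (\<lambda>s. \<Sum>i\<le>?N. of_real (?I i s * g s) * \<psi> (f (real i / real (Suc n))))
      (\<Sum>i\<le>?N. of_real (\<integral>s. ?I i s * g s \<partial>lborel) * \<psi> (f (real i / real (Suc n))))"
    by (intro has_bochner_integral_sum has_bochner_integral_mult_left has_bochner_integral_of_real gi)
  moreover have "(\<Sum>i\<le>?N. of_real (?I i s * g s) * \<psi> (f (real i / real (Suc n)))) = of_real (g s) * \<psi> (f (grid n s))" for s
  proof (cases "s \<in> {0..T}")
    case True
    define k where "k = nat \<lfloor>real (Suc n) * s\<rfloor>"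
    have "k \<le> ?N" unfolding k_def using True by (intro nat_mono floor_mono mult_left_mono) auto
    have "(\<Sum>i\<le>?N. of_real (?I i s * g s) * \<psi> (f (real i / real (Suc n)))) =
        (\<Sum>i\<le>?N. if i = k then of_real (g s) * \<psi> (f (real k / real (Suc n))) else 0)"
      by (intro sum.cong) (auto simp: k_def)
    also have "\<dots> = of_real (g s) * \<psi> (f (real k / real (Suc n)))"
      using \<open>k \<le> ?N\<close> by simp
    finally show ?thesis unfolding k_def grid_def .
  qed (simp add: g0)
  moreover have "(\<Sum>i\<le>?N. of_real (\<integral>s. ?I i s * g s \<partial>lborel) * \<psi> (f (real i / real (Suc n)))) = \<psi> (Riemann_sum g f T n)"
    unfolding Riemann_sum_def by (simp only: functional_sum[OF \<psi> finite_atMost] functional_scaleR[OF \<psi>])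
  ultimately show ?thesis by (simp only:)
qed

lemma functional_kernel_integrable:
  fixes f :: "real \<Rightarrow> 'a::complex_locally_convex_space"
  assumes \<psi>: "cont_functional \<psi>" and f: "continuous_on {0..T} f" and g: "integrable lborel g"
    and g0: "\<And>s. s \<notin> {0..T} \<Longrightarrow> g s = 0"
  shows "integrable lborel (\<lambda>s. of_real (g s) * \<psi> (f s))"
proof -
  have c: "continuous_on {0..T} (\<lambda>s. \<psi> (f s))"
    by (rule continuous_on_compose2[OF functional_cont[OF \<psi>] f]) auto
  have "compact ((\<lambda>s. \<psi> (f s)) ` {0..T})" by (rule compact_continuous_image[OF c]) simp
  then obtain B where B: "\<And>s. s \<in> {0..T} \<Longrightarrow> cmod (\<psi> (f s)) \<le> B"
    using compact_imp_bounded[of "(\<lambda>s. \<psi> (f s)) ` {0..T}"] unfolding bounded_iff by blast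
  have m: "(\<lambda>s. indicator {0..T} s *\<^sub>R \<psi> (f s)) \<in> borel_measurable lborel"
    using borel_measurable_continuous_on_indicator[OF _ c] by simp
  have [measurable]: "g \<in> borel_measurable lborel" using g by simp
  have eq: "of_real (g s) * \<psi> (f s) = of_real (g s) * (indicator {0..T} s *\<^sub>R \<psi> (f s))" for s
    using g0[of s] by (cases "s \<in> {0..T}") auto
  have "integrable lborel (\<lambda>s. of_real (g s) * (indicator {0..T} s *\<^sub>R \<psi> (f s)))"
  proof (rule Bochner_Integration.integrable_bound[OF integrable_mult_left[OF g, of B]])
    show "(\<lambda>s. complex_of_real (g s) * (indicator {0..T} s *\<^sub>R \<psi> (f s))) \<in> borel_measurable lborel"
      using m by measurable
    show "AE s in lborel. norm (complex_of_real (g s) * (indicator {0..T} s *\<^sub>R \<psi> (f s))) \<le> norm (g s * B)"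
    proof (intro AE_I2)
      fix s
      show "norm (complex_of_real (g s) * (indicator {0..T} s *\<^sub>R \<psi> (f s))) \<le> norm (g s * B)"
        using g0[of s] B[of s] by (cases "s \<in> {0..T}") (auto simp: norm_mult abs_mult intro!: mult_left_mono)
    qed
  qed
  then show ?thesis unfolding eq .
qed

text \<open>N is chosen before the functional: uniform continuity of f in p controls all functionals
  below p simultaneously. This uniformity turns scalar convergence into the Cauchy property for
  p.\<close>

lemma Riemann_sum_approx:
  fixes f :: "real \<Rightarrow> 'a::complex_locally_convex_space"
  assumes f: "continuous_on {0..T} f" and g: "integrable lborel g"
    and g0: "\<And>s. s \<notin> {0..T} \<Longrightarrow> g s = 0"
    and p: "continuous_seminorm p" and e: "e > 0"
  shows "\<exists>N. \<forall>n\<ge>N. \<forall>\<psi>. cont_functional \<psi> \<longrightarrow> (\<forall>x. cmod (\<psi> x) \<le> p x) \<longrightarrow>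
     cmod (\<psi> (Riemann_sum g f T n) - (\<integral>s. of_real (g s) * \<psi> (f s) \<partial>lborel)) < e"
proof -
  define M where "M = (\<integral>s. \<bar>g s\<bar> \<partial>lborel)"
  have M: "M \<ge> 0" unfolding M_def by simp
  \<comment> \<open>M + 1 instead of M covers the case that g vanishes almost everywhere.\<close>
  define e' where "e' = e / (M + 1)"
  have e': "e' > 0" "e' * M < e" unfolding e'_def using M e by (auto simp: field_simps)
  obtain d where d: "d > 0" "\<And>s s'. s \<in> {0..T} \<Longrightarrow> s' \<in> {0..T} \<Longrightarrow> \<bar>s - s'\<bar> < d \<Longrightarrow> p (f s - f s') < e'"
    using uniformly_continuous_seminorm[OF f p e'(1)] by blast
  obtain N where N: "1 / real (Suc N) < d" using d(1) nat_approx_posE by blast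
  show ?thesis
  proof (intro exI[of _ N] allI impI)
    fix n \<psi> assume n: "n \<ge> N" and \<psi>: "cont_functional \<psi>" "\<forall>x. cmod (\<psi> x) \<le> p x"
    note h1 = functional_Riemann_sum[OF \<psi>(1) g g0, of T f n]
    note h2 = functional_kernel_integrable[OF \<psi>(1) f g g0]
    have "1 / real (Suc n) \<le> 1 / real (Suc N)" using n by (intro divide_left_mono) auto
    then have nd: "1 / real (Suc n) < d" using N by simp
    have b: "cmod (of_real (g s) * \<psi> (f (grid n s)) - of_real (g s) * \<psi> (f s)) \<le> e' * \<bar>g s\<bar>" for s
    proof (cases "s \<in> {0..T}")
      case True
      have gr: "grid n s \<in> {0..T}" "\<bar>grid n s - s\<bar> < d"
        using grid_bounds[of s n] True nd by auto
      have "cmod (\<psi> (f (grid n s)) - \<psi> (f s)) \<le> p (f (grid n s) - f s)"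
        using \<psi>(2) by (simp add: functional_diff[OF \<psi>(1), symmetric])
      also have "\<dots> \<le> e'" using d(2)[OF gr(1) True gr(2)] by simp
      finally have "\<bar>g s\<bar> * cmod (\<psi> (f (grid n s)) - \<psi> (f s)) \<le> \<bar>g s\<bar> * e'"
        by (intro mult_left_mono) auto
      then show ?thesis by (simp add: norm_mult right_diff_distrib[symmetric] mult.commute)
    qed (use g0 e' in auto)
    have "cmod (\<psi> (Riemann_sum g f T n) - (\<integral>s. of_real (g s) * \<psi> (f s) \<partial>lborel))
       = cmod (\<integral>s. of_real (g s) * \<psi> (f (grid n s)) - of_real (g s) * \<psi> (f s) \<partial>lborel)"
      using h1 h2 by (simp add: has_bochner_integral_iff)
    also have "\<dots> \<le> (\<integral>s. e' * \<bar>g s\<bar> \<partial>lborel)"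
      by (intro Bochner_Integration.integral_norm_bound_integral b Bochner_Integration.integrable_diff)
        (use h1 h2 g in \<open>auto simp: has_bochner_integral_iff\<close>)
    also have "\<dots> = e' * M" by (simp add: M_def)
    also have "\<dots> < e" by (rule e')
    finally show "cmod (\<psi> (Riemann_sum g f T n) - (\<integral>s. of_real (g s) * \<psi> (f s) \<partial>lborel)) < e" .
  qed
qed

text \<open>The sums form a Cauchy sequence for every seminorm, so sequential completeness applies;
  each functional then identifies the limit. The convergence itself is part of the conclusion
  because closed relations are passed to the limit along these sums.\<close>

lemma Riemann_sum_tendsto_weak_integral:
  fixes f :: "real \<Rightarrow> 'a::sequentially_complete_lcs"
  assumes f: "continuous_on {0..T} f" and g: "integrable lborel g"
    and g0: "\<And>s. s \<notin> {0..T} \<Longrightarrow> g s = 0"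
  shows "\<exists>y. Riemann_sum g f T \<longlonglongrightarrow> y \<and> weak_integral g f y"
proof -
  let ?X = "Riemann_sum g f T"
  have "\<exists>y. ?X \<longlonglongrightarrow> y"
  proof (rule Cauchy_seminorms_convergent)
    fix p :: "'a \<Rightarrow> real" and e :: real assume p: "continuous_seminorm p" and e: "e > 0"
    obtain N where N: "\<And>n \<psi>. n \<ge> N \<Longrightarrow> cont_functional \<psi> \<Longrightarrow> (\<And>x. cmod (\<psi> x) \<le> p x) \<Longrightarrow>
       cmod (\<psi> (?X n) - (\<integral>s. of_real (g s) * \<psi> (f s) \<partial>lborel)) < e / 3"
      using Riemann_sum_approx[OF f g g0 p, of "e / 3"] e by (meson divide_pos_pos zero_less_numeral)
    have le: "p (?X m - ?X n) \<le> e / 3 + e / 3" if "m \<ge> N" "n \<ge> N" for m n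
    proof (rule seminorm_le_if_functionals_le[OF p])
      fix \<psi> assume \<psi>: "cont_functional \<psi>" "\<And>x. cmod (\<psi> x) \<le> p x"
      show "cmod (\<psi> (?X m - ?X n)) \<le> e / 3 + e / 3"
        using norm_triangle_lt[of "\<psi> (?X m) - (\<integral>s. of_real (g s) * \<psi> (f s) \<partial>lborel)" "(\<integral>s. of_real (g s) * \<psi> (f s) \<partial>lborel) - \<psi> (?X n)" "e / 3 + e / 3"]
          N[OF that(1) \<psi>] N[OF that(2) \<psi>]
        by (simp add: functional_diff[OF \<psi>(1)] norm_minus_commute)
    qed
    have "p (?X m - ?X n) < e" if "m \<ge> N" "n \<ge> N" for m n
      using le[OF that] e by simp
    then show "\<exists>N. \<forall>m\<ge>N. \<forall>n\<ge>N. p (?X m - ?X n) < e" by blast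
  qed
  then obtain y where y: "?X \<longlonglongrightarrow> y" ..
  have "weak_integral g f y"
    unfolding weak_integral_def
  proof (intro allI impI)
    fix \<psi> :: "'a \<Rightarrow> complex" assume \<psi>: "cont_functional \<psi>"
    have "(\<lambda>n. \<psi> (?X n)) \<longlonglongrightarrow> (\<integral>s. of_real (g s) * \<psi> (f s) \<partial>lborel)"
    proof (rule LIMSEQ_I)
      fix e :: real assume "e > 0"
      from Riemann_sum_approx[OF f g g0 continuous_seminorm_functional[OF \<psi>] this] \<psi>
      show "\<exists>N. \<forall>n\<ge>N. cmod (\<psi> (?X n) - (\<integral>s. of_real (g s) * \<psi> (f s) \<partial>lborel)) < e" by blast
    qed
    from LIMSEQ_unique[OF this tendsto_functional[OF \<psi> y]]
    show "has_bochner_integral lborel (\<lambda>s. of_real (g s) * \<psi> (f s)) (\<psi> y)"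
      using functional_kernel_integrable[OF \<psi> f g g0] by (simp add: has_bochner_integral_iff)
  qed
  with y show ?thesis by blast
qed

text \<open>Truncation at integers reduces the half-line to compact intervals; the tails of the
  majorants h make the truncated integrals Cauchy. The approximants are returned together with the
  limit for the argument on closed relations.\<close>

lemma truncated_weak_integral_tendsto:
  fixes f :: "real \<Rightarrow> 'a::sequentially_complete_lcs"
  assumes f: "continuous_on {0..} f"
    and gm[measurable]: "g \<in> borel_measurable borel" and g: "\<And>n. integrable lborel (\<lambda>s. indicator {..real n} s * g s)"
    and g0: "\<And>s. s < 0 \<Longrightarrow> g s = 0"
    and h: "\<And>p. continuous_seminorm p \<Longrightarrow> \<exists>h. integrable lborel h \<and> (\<forall>s. \<bar>g s\<bar> * p (f s) \<le> h s)"
  shows "\<exists>Y y. (\<forall>n. weak_integral (\<lambda>s. indicator {..real n} s * g s) f (Y n)) \<and> Y \<longlonglongrightarrow> y \<and> weak_integral g f y"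
proof -
  have "\<exists>Y. weak_integral (\<lambda>s. indicator {..real n} s * g s) f Y" for n
  proof -
    have "continuous_on {0..real n} f" by (rule continuous_on_subset[OF f]) auto
    moreover note g[of n]
    moreover have "indicator {..real n} s * g s = 0" if "s \<notin> {0..real n}" for s
      using that g0[of s] by (cases "s < 0") (auto simp: indicator_def)
    ultimately show ?thesis
      using Riemann_sum_tendsto_weak_integral[of "real n" f "\<lambda>s. indicator {..real n} s * g s"] by blast
  qed
  then obtain Y where Y: "\<And>n. weak_integral (\<lambda>s. indicator {..real n} s * g s) f (Y n)" by metis
  have "\<exists>y. Y \<longlonglongrightarrow> y"
  proof (rule Cauchy_seminorms_convergent)
    fix p :: "'a \<Rightarrow> real" and e :: real assume p: "continuous_seminorm p" and e: "e > 0"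
    obtain h where h: "integrable lborel h" "\<And>s. \<bar>g s\<bar> * p (f s) \<le> h s" using h[OF p] by blast
    have h0: "h s \<ge> 0" for s
      using h(2)[of s] seminorm_nonneg[OF p, of "f s"] by (meson abs_ge_zero mult_nonneg_nonneg order_trans)
    have [measurable]: "h \<in> borel_measurable lborel" using h(1) by simp
    have "(\<lambda>n. \<integral>s. indicator {real n<..} s * h s \<partial>lborel) \<longlonglongrightarrow> (\<integral>s. 0 \<partial>(lborel :: real measure))"
    proof (rule integral_dominated_convergence[where w = h])
      show "AE s in lborel. (\<lambda>n. indicator {real n<..} s * h s) \<longlonglongrightarrow> 0"
      proof (intro AE_I2)
        fix s :: real
        have "\<forall>\<^sub>F n in sequentially. real n \<ge> s"
          using filterlim_real_sequentially by (simp add: filterlim_at_top)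
        then have "\<forall>\<^sub>F n in sequentially. 0 = indicator {real n<..} s * h s"
          by eventually_elim (simp add: indicator_def)
        from Lim_transform_eventually[OF tendsto_const this] show "(\<lambda>n. indicator {real n<..} s * h s) \<longlonglongrightarrow> 0" .
      qed
      show "AE s in lborel. norm (indicator {real n<..} s * h s) \<le> h s" for n
        using h0 by (auto simp: indicator_def intro!: AE_I2)
    qed (use h in auto)
    then have "\<forall>\<^sub>F n in sequentially. (\<integral>s. indicator {real n<..} s * h s \<partial>lborel) < e"
      using e by (intro order_tendstoD(2)) auto
    then obtain N where N: "(\<integral>s. indicator {real N<..} s * h s \<partial>lborel) < e"
      using eventually_happens'[OF sequentially_bot] by blast
    have "p (Y m - Y n) < e" if "m \<ge> N" "n \<ge> N" for m n
    proof -
      have "p (Y m - Y n) \<le> (\<integral>s. indicator {real N<..} s * h s \<partial>lborel)"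
      proof (rule weak_integral_bound[OF weak_integral_diff_kernel[OF Y Y] p])
        show "integrable lborel (\<lambda>s. indicator {real N<..} s * h s)"
          by (intro integrable_indicator_times h) auto
        fix s
        \<comment> \<open>Two truncations at or beyond N differ only where s > N, so their distance
          is at most the tail of h.\<close>
        have "\<bar>indicator {..real m} s * g s - indicator {..real n} s * g s\<bar> \<le> indicator {real N<..} s * \<bar>g s\<bar>"
          using that by (auto simp: indicator_def)
        then have "\<bar>indicator {..real m} s * g s - indicator {..real n} s * g s\<bar> * p (f s) \<le> indicator {real N<..} s * \<bar>g s\<bar> * p (f s)"
          by (rule mult_right_mono[OF _ seminorm_nonneg[OF p]])
        also have "\<dots> \<le> indicator {real N<..} s * h s"
          using h(2)[of s] by (simp add: mult.assoc mult_left_mono)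
        finally show "\<bar>indicator {..real m} s * g s - indicator {..real n} s * g s\<bar> * p (f s) \<le> indicator {real N<..} s * h s" .
      qed
      with N show ?thesis by simp
    qed
    then show "\<exists>N. \<forall>m\<ge>N. \<forall>n\<ge>N. p (Y m - Y n) < e" by blast
  qed
  then obtain y where y: "Y \<longlonglongrightarrow> y" ..
  have "weak_integral g f y"
    unfolding weak_integral_def
  proof (intro allI impI)
    fix \<psi> :: "'a \<Rightarrow> complex" assume \<psi>: "cont_functional \<psi>"
    obtain h where h: "integrable lborel h" "\<And>s. \<bar>g s\<bar> * cmod (\<psi> (f s)) \<le> h s"
      using h[OF continuous_seminorm_functional[OF \<psi>]] by blast
    have c: "continuous_on {0..} (\<lambda>s. \<psi> (f s))"
      by (rule continuous_on_compose2[OF functional_cont[OF \<psi>] f]) auto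
    have m: "(\<lambda>s. indicator {0..} s *\<^sub>R \<psi> (f s)) \<in> borel_measurable lborel"
      using borel_measurable_continuous_on_indicator[OF _ c] by simp
    have eq: "of_real (g s) * \<psi> (f s) = of_real (g s) * (indicator {0..} s *\<^sub>R \<psi> (f s))" for s
      using g0[of s] by (cases "s \<ge> 0") auto
    have meas: "(\<lambda>s. of_real (g s) * \<psi> (f s)) \<in> borel_measurable lborel"
      unfolding eq using m by measurable
    have int: "integrable lborel (\<lambda>s. of_real (g s) * \<psi> (f s))"
    proof (rule Bochner_Integration.integrable_bound[OF h(1) meas], rule AE_I2)
      fix s
      show "norm (of_real (g s) * \<psi> (f s)) \<le> norm (h s)" using h(2)[of s] by (simp add: norm_mult)
    qed
    have "(\<lambda>n. \<integral>s. of_real (indicator {..real n} s * g s) * \<psi> (f s) \<partial>lborel) \<longlonglongrightarrow> (\<integral>s. of_real (g s) * \<psi> (f s) \<partial>lborel)"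
    proof (rule integral_dominated_convergence[where w = h])
      show "AE s in lborel. (\<lambda>n. of_real (indicator {..real n} s * g s) * \<psi> (f s)) \<longlonglongrightarrow> of_real (g s) * \<psi> (f s)"
      proof (intro AE_I2)
        fix s :: real
        have "\<forall>\<^sub>F n in sequentially. real n \<ge> s"
          using filterlim_real_sequentially by (simp add: filterlim_at_top)
        then have "\<forall>\<^sub>F n in sequentially. of_real (g s) * \<psi> (f s) = of_real (indicator {..real n} s * g s) * \<psi> (f s)"
          by eventually_elim (simp add: indicator_def)
        from Lim_transform_eventually[OF tendsto_const this] show "(\<lambda>n. of_real (indicator {..real n} s * g s) * \<psi> (f s)) \<longlonglongrightarrow> of_real (g s) * \<psi> (f s)" .
      qed
      show "AE s in lborel. norm (of_real (indicator {..real n} s * g s) * \<psi> (f s)) \<le> h s" for n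
      proof (intro AE_I2)
        fix s
        have "norm (of_real (indicator {..real n} s * g s) * \<psi> (f s)) \<le> \<bar>g s\<bar> * cmod (\<psi> (f s))"
          by (auto simp: norm_mult indicator_def)
        with h(2)[of s] show "norm (of_real (indicator {..real n} s * g s) * \<psi> (f s)) \<le> h s" by simp
      qed
      show "(\<lambda>s. of_real (indicator {..real n} s * g s) * \<psi> (f s)) \<in> borel_measurable lborel" for n
        unfolding of_real_mult mult.assoc using meas by measurable
    qed (use h meas in auto)
    moreover have "(\<integral>s. of_real (indicator {..real n} s * g s) * \<psi> (f s) \<partial>lborel) = \<psi> (Y n)" for n
      using weak_integralD[OF Y \<psi>, of n] by (simp only: has_bochner_integral_iff)
    ultimately have "(\<lambda>n. \<psi> (Y n)) \<longlonglongrightarrow> (\<integral>s. of_real (g s) * \<psi> (f s) \<partial>lborel)" by (simp only:)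
    from LIMSEQ_unique[OF this tendsto_functional[OF \<psi> y]] int
    show "has_bochner_integral lborel (\<lambda>s. of_real (g s) * \<psi> (f s)) (\<psi> y)"
      by (simp add: has_bochner_integral_iff)
  qed
  with Y y show ?thesis by blast
qed

text \<open>Riemann sums of f1 and f2 use the same real weights, hence are componentwise
  combinations of pairs in A and again pairs in A. Closedness is applied twice, as the grid is
  refined and as the truncation is removed.\<close>

lemma weak_integral_closed_relation:
  fixes f1 f2 :: "real \<Rightarrow> 'a::sequentially_complete_lcs"
  assumes A: "closed A" "\<And>x y x' y'. (x, y) \<in> A \<Longrightarrow> (x', y') \<in> A \<Longrightarrow> (x + x', y + y') \<in> A"
      "\<And>r x y. (x, y) \<in> A \<Longrightarrow> (r *\<^sub>R x, r *\<^sub>R y) \<in> A" "(0, 0) \<in> A"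
    and f: "continuous_on {0..} f1" "continuous_on {0..} f2" and fA: "\<And>s. s \<ge> 0 \<Longrightarrow> (f1 s, f2 s) \<in> A"
    and gm: "g \<in> borel_measurable borel" and g: "\<And>n. integrable lborel (\<lambda>s. indicator {..real n} s * g s)"
    and g0: "\<And>s. s < 0 \<Longrightarrow> g s = 0"
    and h1: "\<And>p. continuous_seminorm p \<Longrightarrow> \<exists>h. integrable lborel h \<and> (\<forall>s. \<bar>g s\<bar> * p (f1 s) \<le> h s)"
    and h2: "\<And>p. continuous_seminorm p \<Longrightarrow> \<exists>h. integrable lborel h \<and> (\<forall>s. \<bar>g s\<bar> * p (f2 s) \<le> h s)"
    and y: "weak_integral g f1 y1" "weak_integral g f2 y2"
  shows "(y1, y2) \<in> A"
proof -
  have sumA: "((\<Sum>i\<in>I. u i), (\<Sum>i\<in>I. v i)) \<in> A" if "finite I" "\<And>i. i \<in> I \<Longrightarrow> (u i, v i) \<in> A"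
    for I :: "nat set" and u v
    using that by (induction I rule: finite_induct) (auto intro: A)
  have lim: "(a, b) \<in> A" if "\<And>n. (X n, Z n) \<in> A" "X \<longlonglongrightarrow> a" "Z \<longlonglongrightarrow> b" for X Z a b
    by (rule closed_sequentially[OF A(1), of "\<lambda>n. (X n, Z n)"]) (use that in \<open>auto intro: tendsto_Pair\<close>)
  obtain Y1 z1 where Y1: "\<And>n. weak_integral (\<lambda>s. indicator {..real n} s * g s) f1 (Y1 n)" "Y1 \<longlonglongrightarrow> z1" "weak_integral g f1 z1"
    using truncated_weak_integral_tendsto[OF f(1) gm g g0 h1] by blast
  obtain Y2 z2 where Y2: "\<And>n. weak_integral (\<lambda>s. indicator {..real n} s * g s) f2 (Y2 n)" "Y2 \<longlonglongrightarrow> z2" "weak_integral g f2 z2"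
    using truncated_weak_integral_tendsto[OF f(2) gm g g0 h2] by blast
  have "(Y1 n, Y2 n) \<in> A" for n
  proof -
    let ?g = "\<lambda>s. indicator {..real n} s * g s"
    have c: "continuous_on {0..real n} f1" "continuous_on {0..real n} f2"
      by (rule continuous_on_subset[OF f(1)], simp) (rule continuous_on_subset[OF f(2)], simp)
    have gi: "integrable lborel ?g" by (rule g)
    have gz: "?g s = 0" if "s \<notin> {0..real n}" for s
      using that g0[of s] by (cases "s < 0") (auto simp: indicator_def)
    obtain a1 where a1: "Riemann_sum ?g f1 (real n) \<longlonglongrightarrow> a1" "weak_integral ?g f1 a1"
      using Riemann_sum_tendsto_weak_integral[OF c(1) gi gz] by blast
    obtain a2 where a2: "Riemann_sum ?g f2 (real n) \<longlonglongrightarrow> a2" "weak_integral ?g f2 a2"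
      using Riemann_sum_tendsto_weak_integral[OF c(2) gi gz] by blast
    have "(Riemann_sum ?g f1 (real n) k, Riemann_sum ?g f2 (real n) k) \<in> A" for k
      unfolding Riemann_sum_def by (intro sumA A(3) fA) auto
    from lim[OF this a1(1) a2(1)] show ?thesis
      using weak_integral_unique[OF a1(2) Y1(1)] weak_integral_unique[OF a2(2) Y2(1)] by simp
  qed
  from lim[OF this Y1(2) Y2(2)] show ?thesis
    using weak_integral_unique[OF Y1(3) y(1)] weak_integral_unique[OF Y2(3) y(2)] by simp
qed

section \<open>Integration of vector-valued functions on an interval\<close>

text \<open>The simple functions converge almost everywhere and are Cauchy in mean; Fatou's lemma in
  the index m upgrades this to convergence in mean to the limit. Measurability is assumed, because
  an almost everywhere limit need not be measurable when M is incomplete.\<close>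

lemma has_lcs_integral_functional:
  fixes F :: "'b \<Rightarrow> 'a::sequentially_complete_lcs"
  assumes F: "has_lcs_integral M F y" and \<psi>: "cont_functional \<psi>"
    and [measurable]: "(\<lambda>s. \<psi> (F s)) \<in> borel_measurable M"
  shows "has_bochner_integral M (\<lambda>s. \<psi> (F s)) (\<psi> y)"
proof -
  obtain h where hh: "(\<forall>n. Bochner_Integration.simple_bochner_integrable M (h n)) \<and>
     (AE s in M. (\<lambda>n. h n s) \<longlonglongrightarrow> F s) \<and>
     (\<forall>p. continuous_seminorm p \<longrightarrow> (\<forall>e>0. \<exists>N. \<forall>m\<ge>N. \<forall>n\<ge>N. (LINT s|M. p (h m s - h n s)) < e)) \<and>
     (\<lambda>n. Bochner_Integration.simple_bochner_integral M (h n)) \<longlonglongrightarrow> y"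
    using F unfolding has_lcs_integral_def by (rule exE)
  then have h: "Bochner_Integration.simple_bochner_integrable M (h n)"
     "AE s in M. (\<lambda>n. h n s) \<longlonglongrightarrow> F s"
     "continuous_seminorm p \<Longrightarrow> e > 0 \<Longrightarrow> \<exists>N. \<forall>m\<ge>N. \<forall>n\<ge>N. (LINT s|M. p (h m s - h n s)) < e"
     "(\<lambda>n. Bochner_Integration.simple_bochner_integral M (h n)) \<longlonglongrightarrow> y" for n p e
    by blast+
  have lin: "linear \<psi>"
    by (rule linearI) (simp_all add: functional_add[OF \<psi>] functional_scaleR[OF \<psi>] scaleR_conv_of_real)
  have sb: "Bochner_Integration.simple_bochner_integrable M (\<lambda>s. \<psi> (h n s))" for n
    using simple_bochner_integrable_compose2[of "\<lambda>x y. \<psi> x", OF _ h(1)[of n] h(1)[of n]]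
    by (simp add: functional_0[OF \<psi>])
  have sd: "Bochner_Integration.simple_bochner_integrable M (\<lambda>s. cmod (\<psi> (h m s - h n s)))" for m n
    using simple_bochner_integrable_compose2[of "\<lambda>x y. cmod (\<psi> (x - y))", OF _ h(1)[of m] h(1)[of n]]
    by (simp add: functional_0[OF \<psi>])
  have sm[measurable]: "(\<lambda>s. \<psi> (h n s)) \<in> borel_measurable M" for n
    using has_bochner_integral_simple_bochner_integrable[OF sb, of n] by (auto simp: has_bochner_integral_iff)
  show ?thesis
  proof (rule has_bochner_integral.intros[where s = "\<lambda>n s. \<psi> (h n s)"])
    show "(\<lambda>i. \<integral>\<^sup>+ x. ennreal (norm (\<psi> (F x) - \<psi> (h i x))) \<partial>M) \<longlonglongrightarrow> 0"
    proof (rule order_tendstoI)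
      fix a :: ennreal assume "a > 0"
      \<comment> \<open>The bound a may be infinite, so a finite number below it is taken.\<close>
      then obtain c where c: "0 < c" "c < a" using dense by blast
      define e where "e = enn2real c"
      have ce: "c = ennreal e" "e > 0"
        using c(1) order.strict_trans2[OF c(2) top_greatest] by (simp_all add: e_def enn2real_positive_iff)
      obtain N where N: "\<And>m n. m \<ge> N \<Longrightarrow> n \<ge> N \<Longrightarrow> (LINT s|M. cmod (\<psi> (h m s - h n s))) < e"
        using h(3)[OF continuous_seminorm_functional[OF \<psi>] ce(2)] by blast
      have "(\<integral>\<^sup>+ x. ennreal (norm (\<psi> (F x) - \<psi> (h n x))) \<partial>M) < a" if n: "n \<ge> N" for n
      proof -
        have "(\<integral>\<^sup>+ x. ennreal (norm (\<psi> (F x) - \<psi> (h n x))) \<partial>M)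
          = (\<integral>\<^sup>+ x. liminf (\<lambda>m. ennreal (norm (\<psi> (h m x) - \<psi> (h n x)))) \<partial>M)"
        proof (rule nn_integral_cong_AE)
          show "AE x in M. ennreal (norm (\<psi> (F x) - \<psi> (h n x))) = liminf (\<lambda>m. ennreal (norm (\<psi> (h m x) - \<psi> (h n x))))"
            using h(2)
          proof eventually_elim
            case (elim x)
            have "(\<lambda>m. ennreal (norm (\<psi> (h m x) - \<psi> (h n x)))) \<longlonglongrightarrow> ennreal (norm (\<psi> (F x) - \<psi> (h n x)))"
              by (intro tendsto_intros tendsto_ennrealI tendsto_functional[OF \<psi> elim])
            then show ?case by (rule lim_imp_Liminf[OF sequentially_bot, symmetric])
          qed
        qed
        also have "\<dots> \<le> liminf (\<lambda>m. \<integral>\<^sup>+ x. ennreal (norm (\<psi> (h m x) - \<psi> (h n x))) \<partial>M)"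
          by (rule nn_integral_liminf) measurable
        also have "\<dots> \<le> ennreal e"
        proof (rule Liminf_le)
          show "\<forall>\<^sub>F m in sequentially. (\<integral>\<^sup>+ x. ennreal (norm (\<psi> (h m x) - \<psi> (h n x))) \<partial>M) \<le> ennreal e"
            unfolding eventually_sequentially
          proof (intro exI[of _ N] allI impI)
            fix m assume m: "m \<ge> N"
            have "(\<integral>\<^sup>+ x. ennreal (cmod (\<psi> (h m x - h n x))) \<partial>M) = ennreal (LINT x|M. cmod (\<psi> (h m x - h n x)))"
              using has_bochner_integral_simple_bochner_integrable[OF sd, of m n]
              by (intro nn_integral_eq_integral) (auto simp: has_bochner_integral_iff)
            also have "\<dots> \<le> ennreal e" using N[OF m n] by (intro ennreal_leI) simp
            finally show "(\<integral>\<^sup>+ x. ennreal (norm (\<psi> (h m x) - \<psi> (h n x))) \<partial>M) \<le> ennreal e"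
              by (simp add: functional_diff[OF \<psi>])
          qed
        qed simp
        finally show ?thesis using c ce by (simp add: order.strict_trans1)
      qed
      then show "\<forall>\<^sub>F n in sequentially. (\<integral>\<^sup>+ x. ennreal (norm (\<psi> (F x) - \<psi> (h n x))) \<partial>M) < a"
        unfolding eventually_sequentially by blast
    qed simp
    show "(\<lambda>i. Bochner_Integration.simple_bochner_integral M (\<lambda>s. \<psi> (h i s))) \<longlonglongrightarrow> \<psi> y"
      unfolding simple_bochner_integral_linear[OF lin h(1)]
      by (rule tendsto_functional[OF \<psi> h(4)])
  qed (use sb in auto)
qed

text \<open>The definition of resolvent families integrates over \<open>lebesgue_on\<close>, the
  kernel calculus over \<open>lborel\<close>; for Borel integrands the completion changes
  nothing.\<close>

lemma has_bochner_integral_lebesgue_on_iff: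
  fixes f :: "real \<Rightarrow> 'b::{banach, second_countable_topology}"
  assumes A: "A \<in> sets borel" and m: "(\<lambda>s. indicator A s *\<^sub>R f s) \<in> borel_measurable borel"
  shows "has_bochner_integral (lebesgue_on A) f v \<longleftrightarrow> has_bochner_integral lborel (\<lambda>s. indicator A s *\<^sub>R f s) v"
proof -
  have A': "A \<inter> space lebesgue \<in> sets lebesgue" using A by simp
  have m': "(\<lambda>s. indicator A s *\<^sub>R f s) \<in> borel_measurable lborel" using m by simp
  show ?thesis
    unfolding has_bochner_integral_iff integrable_restrict_space[OF A'] integral_restrict_space[OF A']
      integrable_completion[OF m'] integral_completion[OF m'] ..
qed

lemma has_bochner_integral_lebesgue_on:
  fixes f :: "real \<Rightarrow> 'b::{banach, second_countable_topology}"
  assumes "A \<in> sets borel" "has_bochner_integral lborel (\<lambda>s. indicator A s *\<^sub>R f s) v"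
  shows "has_bochner_integral (lebesgue_on A) f v"
  using assms(2) has_bochner_integral_lebesgue_on_iff[OF assms(1), of f v]
  by (auto simp: has_bochner_integral_iff dest: borel_measurable_integrable)

text \<open>The simple functions required by the definition are products of a simple approximation
  of g with f sampled on the grid, which takes finitely many values on [0, t]. The limit of their
  integrals is recognized as y through the functionals below each seminorm.\<close>

lemma weak_integral_imp_has_lcs_integral:
  fixes f :: "real \<Rightarrow> 'a::sequentially_complete_lcs"
  assumes t: "t \<ge> 0" and f: "continuous_on {0..t} f"
    and g: "integrable lborel (\<lambda>s. indicator {0..t} s * g s)"
    and y: "weak_integral (\<lambda>s. indicator {0..t} s * g s) f y"
  shows "has_lcs_integral (lebesgue_on {0..t}) (\<lambda>s. of_real (g s) *\<^sub>C f s) y"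
proof -
  define M where "M = lebesgue_on {0..t}"
  have space: "space M = {0..t}" by (simp add: M_def)
  have gM: "integrable M g"
    using has_bochner_integral_lebesgue_on[of "{0..t}" g "\<integral>s. indicator {0..t} s * g s \<partial>lborel"] g
    by (simp add: M_def has_bochner_integral_iff)
  have \<psi>M: "has_bochner_integral M (\<lambda>s. of_real (g s) * \<psi> (f s)) (\<psi> y)" if "cont_functional \<psi>" for \<psi>
    unfolding M_def using weak_integralD[OF y that]
    by (intro has_bochner_integral_lebesgue_on) (simp_all add: scaleR_conv_of_real mult.assoc)
  have [measurable]: "g \<in> borel_measurable M" using gM by simp
  \<comment> \<open>The approximation theorem supplies the factor 2, which makes 3 |g| a majorant of
    |G n - g|.\<close>
  obtain G where G: "\<And>n. simple_function M (G n)" "\<And>s. s \<in> space M \<Longrightarrow> (\<lambda>n. G n s) \<longlonglongrightarrow> g s"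
     "\<And>n s. s \<in> space M \<Longrightarrow> dist (G n s) 0 \<le> 2 * dist (g s) 0"
    using borel_measurable_implies_sequence_metric[of g M 0] \<open>g \<in> borel_measurable M\<close> by blast
  have G2: "\<bar>G n s\<bar> \<le> 2 * \<bar>g s\<bar>" if "s \<in> space M" for n s
    using G(3)[OF that, of n] by simp
  have [measurable]: "G n \<in> borel_measurable M" for n by (rule borel_measurable_simple_function[OF G(1)])
  have GI: "integrable M (G n)" for n
    by (rule Bochner_Integration.integrable_bound[OF integrable_mult_right[OF gM, of 2]]) (use G2 in \<open>auto simp: abs_mult\<close>)
  define a where "a = (\<lambda>n. LINT s|M. \<bar>G n s - g s\<bar>)"
  have a0: "a \<longlonglongrightarrow> 0"
  proof -
    have "a \<longlonglongrightarrow> (LINT s|M. 0)"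
      unfolding a_def
    proof (rule integral_dominated_convergence[where w = "\<lambda>s. 3 * \<bar>g s\<bar>"])
      show "AE s in M. (\<lambda>n. \<bar>G n s - g s\<bar>) \<longlonglongrightarrow> 0"
      proof (rule AE_I2)
        fix s assume "s \<in> space M"
        then have "(\<lambda>n. \<bar>G n s - g s\<bar>) \<longlonglongrightarrow> \<bar>g s - g s\<bar>" by (intro tendsto_intros G)
        then show "(\<lambda>n. \<bar>G n s - g s\<bar>) \<longlonglongrightarrow> 0" by simp
      qed
      show "AE s in M. norm \<bar>G n s - g s\<bar> \<le> 3 * \<bar>g s\<bar>" for n
      proof (rule AE_I2)
        fix s assume "s \<in> space M"
        from G2[OF this, of n] show "norm \<bar>G n s - g s\<bar> \<le> 3 * \<bar>g s\<bar>"
          unfolding real_norm_def by arith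
      qed
    qed (use gM in auto)
    then show ?thesis by simp
  qed
  have grid_in: "grid n s \<in> {0..t}" if "s \<in> {0..t}" for n s
    using grid_bounds[of s n] that by auto
  have sgrid: "simple_function M (grid n)" for n
  proof (rule simple_function_borel_measurable)
    show "grid n \<in> borel_measurable M" unfolding M_def
      by (intro measurable_restrict_space1 measurable_completion) (simp add: borel_measurable_grid)
    have "grid n ` space M \<subseteq> (\<lambda>i. real i / real (Suc n)) ` {..nat \<lfloor>real (Suc n) * t\<rfloor>}"
      unfolding space grid_def by (intro image_subsetI imageI) (auto intro!: nat_mono floor_mono mult_left_mono simp del: of_nat_Suc)
    then show "finite (grid n ` space M)" by (rule finite_subset) simp
  qed
  define h where "h = (\<lambda>n s. G n s *\<^sub>R f (grid n s))"
  have hs: "simple_function M (h n)" for n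
    unfolding h_def by (rule simple_function_compose2[OF G(1) sgrid])
  have fin: "emeasure M S \<noteq> \<infinity>" for S
  proof -
    have "emeasure M S \<le> emeasure M (space M)" by (rule emeasure_space)
    also have "emeasure M (space M) = ennreal t"
      using t by (simp add: M_def emeasure_restrict_space)
    finally show ?thesis by (auto simp: top_unique)
  qed
  have hsb: "Bochner_Integration.simple_bochner_integrable M (h n)" for n
    by (rule simple_bochner_integrable.intros[OF hs fin])
  have bd: "\<exists>K>0. \<forall>s\<in>{0..t}. p (f s) \<le> K" if p: "continuous_seminorm p" for p
  proof -
    have c: "continuous_on {0..t} (\<lambda>s. p (f s))"
      by (rule continuous_on_compose2[OF seminorm_cont[OF p] f]) auto
    have "compact ((\<lambda>s. p (f s)) ` {0..t})" by (rule compact_continuous_image[OF c]) simp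
    then obtain B where B: "\<And>s. s \<in> {0..t} \<Longrightarrow> \<bar>p (f s)\<bar> \<le> B"
      using compact_imp_bounded[of "(\<lambda>s. p (f s)) ` {0..t}"] unfolding bounded_iff real_norm_def by blast
    have "p (f s) \<le> \<bar>B\<bar> + 1" if "s \<in> {0..t}" for s using B[OF that] by arith
    then show ?thesis by (intro exI[of _ "\<bar>B\<bar> + 1"]) auto
  qed
  have uc: "\<exists>N. \<forall>n\<ge>N. \<forall>s\<in>{0..t}. p (f (grid n s) - f s) < e" if p: "continuous_seminorm p" and e: "e > 0" for p e
  proof -
    obtain d where d: "d > 0" "\<And>s s'. s \<in> {0..t} \<Longrightarrow> s' \<in> {0..t} \<Longrightarrow> \<bar>s - s'\<bar> < d \<Longrightarrow> p (f s - f s') < e"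
      using uniformly_continuous_seminorm[OF f p e] by blast
    obtain N where N: "1 / real (Suc N) < d" using d(1) nat_approx_posE by blast
    have "p (f (grid n s) - f s) < e" if "n \<ge> N" "s \<in> {0..t}" for n s
    proof (rule d(2)[OF grid_in[OF that(2)] that(2)])
      have "1 / real (Suc n) \<le> 1 / real (Suc N)" using that by (intro divide_left_mono) auto
      then show "\<bar>grid n s - s\<bar> < d" using grid_bounds[of s n] that N by auto
    qed
    then show ?thesis by blast
  qed
  define I where "I = (LINT s|M. \<bar>g s\<bar>)"
  have I: "I \<ge> 0" unfolding I_def by simp
  \<comment> \<open>Error budget, with d = e / (8 (I + 1)): two terms K a n stay below e/4 each, and
    the sampling error 4 d I is at most e/2. I + 1 avoids a zero denominator.\<close>
  have main: "\<exists>N K. K > 0 \<and> (\<forall>s\<in>{0..t}. p (f s) \<le> K) \<and>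
      (\<forall>n\<ge>N. K * a n < e / 4 \<and> (\<forall>s\<in>{0..t}. p (f (grid n s) - f s) \<le> e / (8 * (I + 1))))"
    if p: "continuous_seminorm p" and e: "e > 0" for p e
  proof -
    obtain K where K: "K > 0" "\<And>s. s \<in> {0..t} \<Longrightarrow> p (f s) \<le> K" using bd[OF p] by blast
    have "\<forall>\<^sub>F n in sequentially. a n < e / (4 * K)" by (rule order_tendstoD(2)[OF a0]) (use K e in auto)
    then obtain N1 where N1: "\<And>n. n \<ge> N1 \<Longrightarrow> a n < e / (4 * K)" unfolding eventually_sequentially by blast
    have "e / (8 * (I + 1)) > 0" using I e by auto
    then obtain N2 where N2: "\<And>n s. n \<ge> N2 \<Longrightarrow> s \<in> {0..t} \<Longrightarrow> p (f (grid n s) - f s) < e / (8 * (I + 1))"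
      using uc[OF p] by blast
    show ?thesis
    proof (intro exI[of _ "max N1 N2"] exI[of _ K] conjI ballI allI impI K)
      fix n assume n: "max N1 N2 \<le> n"
      show "K * a n < e / 4" using N1[of n] n K by (simp add: field_simps)
      fix s assume "s \<in> {0..t}"
      then show "p (f (grid n s) - f s) \<le> e / (8 * (I + 1))" using N2[of n s] n by simp
    qed
  qed
  have eI: "e / (8 * (I + 1)) * I \<le> e / 8" if "e > 0" for e
    using I that by (simp add: field_simps)
  have Gg: "integrable M (\<lambda>s. \<bar>G n s - g s\<bar>)" for n
    by (intro integrable_abs Bochner_Integration.integrable_diff GI gM)
  show ?thesis
    unfolding has_lcs_integral_def M_def[symmetric]
  proof (intro exI[of _ h] conjI allI impI)
    show "AE s in M. (\<lambda>n. h n s) \<longlonglongrightarrow> of_real (g s) *\<^sub>C f s"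
    proof (rule AE_I2)
      fix s assume s: "s \<in> space M"
      have "(\<lambda>n. f (grid n s)) \<longlonglongrightarrow> f s"
        by (rule continuous_on_tendsto_compose[OF f grid_tendsto]) (use s space grid_in in auto)
      then show "(\<lambda>n. h n s) \<longlonglongrightarrow> of_real (g s) *\<^sub>C f s"
        unfolding h_def scaleR_scaleC using G(2)[OF s] by (intro tendsto_scaleC tendsto_of_real)
    qed
  next
    fix p :: "'a \<Rightarrow> real" and e :: real assume p: "continuous_seminorm p" and e: "e > 0"
    obtain N K where N: "K > 0" "\<And>s. s \<in> {0..t} \<Longrightarrow> p (f s) \<le> K"
      "\<And>n. n \<ge> N \<Longrightarrow> K * a n < e / 4"
      "\<And>n s. n \<ge> N \<Longrightarrow> s \<in> {0..t} \<Longrightarrow> p (f (grid n s) - f s) \<le> e / (8 * (I + 1))"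
      using main[OF p e] by blast
    have "(LINT s|M. p (h m s - h n s)) < e" if mn: "m \<ge> N" "n \<ge> N" for m n
    proof -
      have sb: "Bochner_Integration.simple_bochner_integrable M (\<lambda>s. p (h m s - h n s))"
        using simple_bochner_integrable_compose2[of "\<lambda>x y. p (x - y)", OF _ hsb hsb, of m n]
        by (simp add: seminorm_0[OF p])
      have "(LINT s|M. p (h m s - h n s)) \<le> (LINT s|M. K * \<bar>G m s - g s\<bar> + K * \<bar>G n s - g s\<bar> + 4 * (e / (8 * (I + 1))) * \<bar>g s\<bar>)"
      proof (rule integral_mono)
        show "integrable M (\<lambda>s. p (h m s - h n s))"
          using has_bochner_integral_simple_bochner_integrable[OF sb] by (simp add: has_bochner_integral_iff)
        show "integrable M (\<lambda>s. K * \<bar>G m s - g s\<bar> + K * \<bar>G n s - g s\<bar> + 4 * (e / (8 * (I + 1))) * \<bar>g s\<bar>)"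
          using gM Gg by (intro Bochner_Integration.integrable_add integrable_mult_right) auto
        fix s assume s: "s \<in> space M"
        then have s': "s \<in> {0..t}" using space by simp
        define d where "d = e / (8 * (I + 1))"
        \<comment> \<open>Both factors of h vary with the index. The second term carries |G n s|
          \<le> 2 |g s| and a difference of samples of size at most 2 d, whence the factor 4 in the
          integrated bound.\<close>
        have "h m s - h n s = (G m s - G n s) *\<^sub>R f (grid m s) + G n s *\<^sub>R (f (grid m s) - f (grid n s))"
          by (simp add: h_def algebra_simps)
        then have "p (h m s - h n s) \<le> \<bar>G m s - G n s\<bar> * p (f (grid m s)) + \<bar>G n s\<bar> * p (f (grid m s) - f (grid n s))"
          using seminorm_add[OF p, of "(G m s - G n s) *\<^sub>R f (grid m s)" "G n s *\<^sub>R (f (grid m s) - f (grid n s))"]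
          by (simp add: seminorm_scaleR[OF p])
        also have "\<dots> \<le> (\<bar>G m s - g s\<bar> + \<bar>G n s - g s\<bar>) * K + (2 * \<bar>g s\<bar>) * (d + d)"
        proof (intro add_mono mult_mono)
          show "p (f (grid m s) - f (grid n s)) \<le> d + d"
            using seminorm_triangle[OF p, of "f (grid m s)" "f (grid n s)" "f s"]
              N(4)[OF mn(1) s'] N(4)[OF mn(2) s'] seminorm_minus_commute[OF p, of "f s" "f (grid n s)"]
            unfolding d_def by linarith
          show "p (f (grid m s)) \<le> K" by (rule N(2)[OF grid_in[OF s']])
        qed (use G2[OF s, of n] N(1) in \<open>auto simp: seminorm_nonneg[OF p]\<close>)
        finally show "p (h m s - h n s) \<le> K * \<bar>G m s - g s\<bar> + K * \<bar>G n s - g s\<bar> + 4 * (e / (8 * (I + 1))) * \<bar>g s\<bar>"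
          unfolding d_def[symmetric] by (simp add: algebra_simps)
      qed
      also have "\<dots> = K * a m + K * a n + 4 * (e / (8 * (I + 1)) * I)"
        using gM GI by (simp add: a_def I_def)
      also have "\<dots> < e" using N(3)[OF mn(1)] N(3)[OF mn(2)] eI[OF e] e by linarith
      finally show ?thesis .
    qed
    then show "\<exists>N. \<forall>m\<ge>N. \<forall>n\<ge>N. (LINT s|M. p (h m s - h n s)) < e" by blast
  next
    show "(\<lambda>n. Bochner_Integration.simple_bochner_integral M (h n)) \<longlonglongrightarrow> y"
      unfolding tendsto_iff_seminorms
    proof (intro allI impI LIMSEQ_I)
      fix p :: "'a \<Rightarrow> real" and e :: real assume p: "continuous_seminorm p" and e: "e > 0"
      obtain N K where N: "K > 0" "\<And>s. s \<in> {0..t} \<Longrightarrow> p (f s) \<le> K"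
        "\<And>n. n \<ge> N \<Longrightarrow> K * a n < e / 4"
        "\<And>n s. n \<ge> N \<Longrightarrow> s \<in> {0..t} \<Longrightarrow> p (f (grid n s) - f s) \<le> e / (8 * (I + 1))"
        using main[OF p e] by blast
      have "p (Bochner_Integration.simple_bochner_integral M (h n) - y) < e" if n: "n \<ge> N" for n
      proof -
        have "p (Bochner_Integration.simple_bochner_integral M (h n) - y) \<le> K * a n + e / (8 * (I + 1)) * I"
        proof (rule seminorm_le_if_functionals_le[OF p])
          fix \<psi> assume \<psi>: "cont_functional \<psi>" "\<And>x. cmod (\<psi> x) \<le> p x"
          have lin: "linear \<psi>"
            by (rule linearI) (simp_all add: functional_add[OF \<psi>(1)] functional_scaleR[OF \<psi>(1)] scaleR_conv_of_real)
          have sb: "Bochner_Integration.simple_bochner_integrable M (\<lambda>s. \<psi> (h n s))"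
            using simple_bochner_integrable_compose2[of "\<lambda>x y. \<psi> x", OF _ hsb[of n] hsb[of n]]
            by (simp add: functional_0[OF \<psi>(1)])
          have 1: "has_bochner_integral M (\<lambda>s. \<psi> (h n s)) (\<psi> (Bochner_Integration.simple_bochner_integral M (h n)))"
            using has_bochner_integral_simple_bochner_integrable[OF sb]
            unfolding simple_bochner_integral_linear[OF lin hsb] .
          have 2: "has_bochner_integral M (\<lambda>s. \<psi> (h n s) - of_real (g s) * \<psi> (f s)) (\<psi> (Bochner_Integration.simple_bochner_integral M (h n) - y))"
            unfolding functional_diff[OF \<psi>(1)] by (rule has_bochner_integral_diff[OF 1 \<psi>M[OF \<psi>(1)]])
          have "cmod (LINT s|M. \<psi> (h n s) - of_real (g s) * \<psi> (f s)) \<le> (LINT s|M. K * \<bar>G n s - g s\<bar> + e / (8 * (I + 1)) * \<bar>g s\<bar>)"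
          proof (rule Bochner_Integration.integral_norm_bound_integral)
            show "integrable M (\<lambda>s. \<psi> (h n s) - of_real (g s) * \<psi> (f s))"
              using 2 by (simp add: has_bochner_integral_iff)
            show "integrable M (\<lambda>s. K * \<bar>G n s - g s\<bar> + e / (8 * (I + 1)) * \<bar>g s\<bar>)"
              using gM Gg by (intro Bochner_Integration.integrable_add integrable_mult_right) auto
            fix s assume s: "s \<in> space M"
            then have s': "s \<in> {0..t}" using space by simp
            define d where "d = e / (8 * (I + 1))"
            have "\<psi> (h n s) - of_real (g s) * \<psi> (f s) = of_real (G n s - g s) * \<psi> (f (grid n s)) + of_real (g s) * \<psi> (f (grid n s) - f s)"
              by (simp add: h_def functional_diff[OF \<psi>(1)] functional_scaleR[OF \<psi>(1)] algebra_simps)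
            then have "cmod (\<psi> (h n s) - of_real (g s) * \<psi> (f s)) \<le> \<bar>G n s - g s\<bar> * cmod (\<psi> (f (grid n s))) + \<bar>g s\<bar> * cmod (\<psi> (f (grid n s) - f s))"
              using norm_triangle_ineq[of "of_real (G n s - g s) * \<psi> (f (grid n s))" "of_real (g s) * \<psi> (f (grid n s) - f s)"]
              by (simp only: norm_mult norm_of_real)
            also have "\<dots> \<le> \<bar>G n s - g s\<bar> * K + \<bar>g s\<bar> * d"
            proof (intro add_mono mult_left_mono)
              show "cmod (\<psi> (f (grid n s))) \<le> K" using \<psi>(2) N(2)[OF grid_in[OF s']] order_trans by blast
              show "cmod (\<psi> (f (grid n s) - f s)) \<le> d" using \<psi>(2) N(4)[OF n s'] order_trans unfolding d_def by blast
            qed auto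
            finally show "cmod (\<psi> (h n s) - of_real (g s) * \<psi> (f s)) \<le> K * \<bar>G n s - g s\<bar> + e / (8 * (I + 1)) * \<bar>g s\<bar>"
              unfolding d_def[symmetric] by (simp add: mult.commute)
          qed
          also have "\<dots> = K * a n + e / (8 * (I + 1)) * I"
            using gM GI by (simp add: a_def I_def)
          finally show "cmod (\<psi> (Bochner_Integration.simple_bochner_integral M (h n) - y)) \<le> K * a n + e / (8 * (I + 1)) * I"
            using 2 by (simp only: has_bochner_integral_iff)
        qed
        also have "\<dots> < e" using N(3)[OF n] eI[OF e] e by linarith
        finally show ?thesis .
      qed
      then show "\<exists>N. \<forall>n\<ge>N. norm (p (Bochner_Integration.simple_bochner_integral M (h n) - y) - 0) < e"
        by (auto simp: seminorm_nonneg[OF p])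
    qed
  qed (rule hsb)
qed

section \<open>The Gamma integral on a complex ray and Hankel's formula\<close>

lemma Gamma_integral_scaled_real:
  fixes \<mu> x :: real
  assumes "\<mu> > 0" "x > 0"
  shows "has_bochner_integral lborel
           (\<lambda>v. indicator {0..} v * v powr (\<mu> - 1) * exp (- (v * x))) (Gamma \<mu> * x powr (- \<mu>))"
proof -
  have "has_bochner_integral lborel (\<lambda>t. indicator {0..} t * t powr (\<mu> - 1) / exp t) (Gamma \<mu>)"
    by (rule has_bochner_integral_nn_integral)
      (use assms Gamma_conv_nn_integral_real[of \<mu>] in \<open>auto simp: Gamma_real_nonneg indicator_def\<close>)
  then have "has_bochner_integral lborel
      (\<lambda>v. indicator {0..} (0 + x * v) * (0 + x * v) powr (\<mu> - 1) / exp (0 + x * v)) (Gamma \<mu> /\<^sub>R \<bar>x\<bar>)"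
    by (rule lborel_has_bochner_integral_real_affine_iff[THEN iffD1, rotated]) (use assms in simp)
  then have "has_bochner_integral lborel
      (\<lambda>v. x powr (1 - \<mu>) * (indicator {0..} (0 + x * v) * (0 + x * v) powr (\<mu> - 1) / exp (0 + x * v)))
      (x powr (1 - \<mu>) * (Gamma \<mu> /\<^sub>R \<bar>x\<bar>))"
    by (intro has_bochner_integral_mult_right)
  moreover have "x powr (1 - \<mu>) * (Gamma \<mu> /\<^sub>R \<bar>x\<bar>) = Gamma \<mu> * x powr (- \<mu>)"
    using assms by (simp add: powr_diff powr_minus field_simps)
  moreover have "x powr (1 - \<mu>) * (indicator {0..} (0 + x * v) * (0 + x * v) powr (\<mu> - 1) / exp (0 + x * v))
      = indicator {0..} v * v powr (\<mu> - 1) * exp (- (v * x))" for v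
  proof (cases "v \<ge> 0")
    case True
    then have "(x * v) powr (\<mu> - 1) = x powr (\<mu> - 1) * v powr (\<mu> - 1)"
      using assms by (simp add: powr_mult)
    moreover have "x powr (1 - \<mu>) * x powr (\<mu> - 1) = 1"
      using assms by (simp flip: powr_add)
    ultimately show ?thesis using True assms
      by (simp add: exp_minus field_simps)
  next
    case False
    then have "\<not> 0 \<le> x * v" using assms by (simp add: zero_le_mult_iff)
    with False show ?thesis by simp
  qed
  ultimately show ?thesis by (simp only:)
qed

lemma pochhammer_binomial_sums:
  fixes w :: complex and \<mu> :: real
  assumes "norm w < 1"
  shows "(\<lambda>n. of_real (pochhammer \<mu> n / fact n) * w ^ n) sums ((1 - w) powr (- of_real \<mu>))"
proof -
  have "(\<lambda>n. ((- of_real \<mu>) gchoose n) * (- w) ^ n) sums (1 + - w) powr (- of_real \<mu>)"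
    by (rule gen_binomial_complex) (use assms in simp)
  moreover have "((- of_real \<mu>) gchoose n) * (- w) ^ n = of_real (pochhammer \<mu> n / fact n) * w ^ n" for n
  proof -
    have "(- 1) ^ n * (- 1) ^ n = (1 :: complex)" by (simp flip: power_mult_distrib)
    then have "(- 1) ^ n * p * ((- 1) ^ n * q) = p * q" for p q :: complex
      by (metis mult.assoc mult.left_commute mult_1)
    from this[of "of_real (pochhammer \<mu> n / fact n)" "w ^ n"] show ?thesis
      unfolding gbinomial_pochhammer power_minus[of w] by (simp add: pochhammer_of_real)
  qed
  ultimately show ?thesis by simp
qed

text \<open>No contour is rotated: exp (- v z) is written as exp (- v x) exp (v (x - z)) with a real
  x such that |x - z| < x, the second factor is expanded, and the integrated terms form a binomial
  series.\<close>

lemma Gamma_integral_scaled_complex: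
  fixes \<mu> :: real and z :: complex
  assumes \<mu>: "\<mu> > 0" and z: "Re z > 0"
  shows "has_bochner_integral lborel
           (\<lambda>v. of_real (indicator {0..} v * v powr (\<mu> - 1)) * exp (- (of_real v * z)))
           (of_real (Gamma \<mu>) * z powr (- of_real \<mu>))"
proof -
  \<comment> \<open>|x - z| < x means 2 x Re z > |z|^2; the choice x Re z = |z|^2 satisfies this
    with room to spare.\<close>
  define x where "x = (cmod z)\<^sup>2 / Re z"
  have zn: "z \<noteq> 0" using z by auto
  have x: "x > 0" unfolding x_def using z zn by simp
  have xz: "x * Re z = (cmod z)\<^sup>2" unfolding x_def using z by simp
  have "(cmod (of_real x - z))\<^sup>2 = x\<^sup>2 - 2 * (x * Re z) + (cmod z)\<^sup>2"
    unfolding cmod_power2 by (simp add: power2_eq_square algebra_simps)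
  also have "\<dots> < x\<^sup>2" using xz zn by simp
  finally have lt: "cmod (of_real x - z) < x" using x by (meson less_imp_le power2_less_imp_less)
  define w where "w = (of_real x - z) / of_real x"
  have w: "norm w < 1" unfolding w_def using lt x by (simp add: norm_divide)
  define g where "g = (\<lambda>n v. indicator {0..} v * v powr (\<mu> + real n - 1) * exp (- (v * x)))"
  have g: "has_bochner_integral lborel (g n) (Gamma (\<mu> + n) * x powr (- (\<mu> + n)))" for n
    unfolding g_def by (rule Gamma_integral_scaled_real) (use \<mu> x in auto)
  have g_nonneg: "g n v \<ge> 0" for n v unfolding g_def by (simp add: indicator_def)
  define f where "f = (\<lambda>n v. of_real (g n v) * ((of_real x - z) ^ n / fact n))"
  have g0: "of_real (indicator {0..} v * v powr (\<mu> - 1) * exp (- (v * x))) * (of_real v * (of_real x - z)) ^ n / fact n = f n v" for n v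
  proof (cases "v > 0")
    case True
    then have "v powr (\<mu> + real n - 1) = v powr (\<mu> - 1) * v ^ n"
      by (simp add: powr_add[symmetric] powr_realpow[symmetric] algebra_simps)
    then show ?thesis using True by (simp add: f_def g_def power_mult_distrib)
  qed (auto simp: f_def g_def indicator_def)
  \<comment> \<open>Stated for an arbitrary real r: r = |x - z| serves the integrals of norms, r = x
    the integrals themselves.\<close>
  have coef: "Gamma (\<mu> + n) * x powr (- (\<mu> + n)) * r ^ n / fact n
      = Gamma \<mu> * x powr (-\<mu>) * (pochhammer \<mu> n / fact n * (r / x) ^ n)" for n and r :: real
  proof -
    have "pochhammer \<mu> n = Gamma (\<mu> + n) / Gamma \<mu>"
      by (rule pochhammer_Gamma) (use \<mu> in \<open>auto elim!: nonpos_Ints_cases\<close>)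
    then have "Gamma (\<mu> + n) = pochhammer \<mu> n * Gamma \<mu>" using Gamma_real_pos[OF \<mu>] by simp
    moreover have "x powr (- (\<mu> + n)) = x powr (-\<mu>) / x ^ n"
      using x by (simp add: powr_diff powr_realpow[symmetric])
    ultimately show ?thesis by (simp add: power_divide mult_ac)
  qed
  have fi: "has_bochner_integral lborel (f n) (of_real (Gamma (\<mu> + n) * x powr (- (\<mu> + n))) * ((of_real x - z) ^ n / fact n))" for n
    unfolding f_def by (intro has_bochner_integral_mult_left has_bochner_integral_of_real g)
  have fn: "(\<integral>v. norm (f n v) \<partial>lborel) = Gamma (\<mu> + n) * x powr (- (\<mu> + n)) * cmod (of_real x - z) ^ n / fact n" for n
  proof -
    have "norm (f n v) = g n v * (cmod (of_real x - z) ^ n / fact n)" for v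
      by (simp add: f_def norm_mult norm_divide norm_power g_nonneg)
    then show ?thesis using g[of n] by (simp add: has_bochner_integral_iff)
  qed
  have sums_v: "(\<lambda>n. f n v) sums (of_real (indicator {0..} v * v powr (\<mu> - 1)) * exp (- (of_real v * z)))" for v
  proof -
    have "(\<lambda>n. of_real (indicator {0..} v * v powr (\<mu> - 1) * exp (- (v * x))) * ((of_real v * (of_real x - z)) ^ n /\<^sub>R fact n))
       sums (of_real (indicator {0..} v * v powr (\<mu> - 1) * exp (- (v * x))) * exp (of_real v * (of_real x - z)))"
      by (intro sums_mult exp_converges)
    moreover have "of_real (indicator {0..} v * v powr (\<mu> - 1) * exp (- (v * x))) * exp (of_real v * (of_real x - z))
      = of_real (indicator {0..} v * v powr (\<mu> - 1)) * exp (- (of_real v * z))"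
    proof -
      have "of_real (exp (- (v * x))) * exp (of_real v * (of_real x - z)) = exp (- (of_real v * z))"
      proof -
        have "- (of_real v * z) = complex_of_real (- (v * x)) + of_real v * (of_real x - z)"
          by (simp add: algebra_simps)
        then show ?thesis by (simp only: exp_add exp_of_real)
      qed
      then show ?thesis by (simp only: of_real_mult mult.assoc)
    qed
    moreover have "of_real (indicator {0..} v * v powr (\<mu> - 1) * exp (- (v * x))) * ((of_real v * (of_real x - z)) ^ n /\<^sub>R fact n) = f n v" for n
      by (subst g0[symmetric]) (simp add: scaleR_conv_of_real field_simps)
    ultimately show ?thesis by (simp only:)
  qed
  have normf: "summable (\<lambda>n. norm (f n v))" for v
  proof -
    have "summable (\<lambda>n. norm (of_real (indicator {0..} v * v powr (\<mu> - 1) * exp (- (v * x))) :: complex) * norm ((of_real v * (of_real x - z)) ^ n /\<^sub>R fact n))"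
      by (intro summable_mult summable_norm_exp)
    moreover have "norm (of_real (indicator {0..} v * v powr (\<mu> - 1) * exp (- (v * x))) :: complex) * norm ((of_real v * (of_real x - z)) ^ n /\<^sub>R fact n) = norm (f n v)" for n
      unfolding g0[symmetric] by (simp add: norm_mult norm_divide norm_power divide_inverse norm_inverse)
    ultimately show ?thesis by (simp only:)
  qed
  \<comment> \<open>Up to a constant this is the binomial series at |x - z| / x < 1; its convergence
    justifies the exchange of sum and integral.\<close>
  have sumint: "summable (\<lambda>n. \<integral>v. norm (f n v) \<partial>lborel)"
  proof -
    have "(\<lambda>n. of_real (pochhammer \<mu> n / fact n) * of_real (cmod (of_real x - z) / x) ^ n) sums ((1 - of_real (cmod (of_real x - z) / x)) powr (- of_real \<mu> :: complex))"
      by (rule pochhammer_binomial_sums) (use lt x in \<open>auto simp: norm_divide\<close>)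
    moreover have "of_real (pochhammer \<mu> n / fact n) * of_real (cmod (of_real x - z) / x) ^ n =
        complex_of_real (pochhammer \<mu> n / fact n * (cmod (of_real x - z) / x) ^ n)" for n
      by simp
    ultimately have "(\<lambda>n. complex_of_real (pochhammer \<mu> n / fact n * (cmod (of_real x - z) / x) ^ n)) sums
        ((1 - of_real (cmod (of_real x - z) / x)) powr (- of_real \<mu> :: complex))"
      by (simp only:)
    from sums_Re[OF this] have "summable (\<lambda>n. pochhammer \<mu> n / fact n * (cmod (of_real x - z) / x) ^ n)"
      unfolding Re_complex_of_real by (rule sums_summable)
    then show ?thesis unfolding fn coef by (rule summable_mult)
  qed
  have int: "integrable lborel (\<lambda>v. \<Sum>n. f n v)"
    by (rule integrable_suminf) (use fi normf sumint in \<open>auto simp: has_bochner_integral_iff\<close>)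
  have "(\<lambda>n. integral\<^sup>L lborel (f n)) sums (\<integral>v. (\<Sum>n. f n v) \<partial>lborel)"
    by (rule sums_integral) (use fi normf sumint in \<open>auto simp: has_bochner_integral_iff\<close>)
  moreover have "integral\<^sup>L lborel (f n) = of_real (Gamma \<mu> * x powr (-\<mu>)) * (of_real (pochhammer \<mu> n / fact n) * w ^ n)" for n
  proof -
    have "of_real (Gamma (\<mu> + n) * x powr (- (\<mu> + n))) * ((of_real x - z) ^ n / fact n)
       = of_real (Gamma (\<mu> + n) * x powr (- (\<mu> + n)) * x ^ n / fact n) * w ^ n"
      using x by (simp add: w_def power_divide)
    with fi[of n] show ?thesis unfolding coef using x by (simp add: has_bochner_integral_iff)
  qed
  ultimately have "(\<lambda>n. of_real (Gamma \<mu> * x powr (-\<mu>)) * (of_real (pochhammer \<mu> n / fact n) * w ^ n))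
     sums (\<integral>v. (\<Sum>n. f n v) \<partial>lborel)" by simp
  moreover have "(\<lambda>n. of_real (Gamma \<mu> * x powr (-\<mu>)) * (of_real (pochhammer \<mu> n / fact n) * w ^ n))
     sums (of_real (Gamma \<mu> * x powr (-\<mu>)) * (1 - w) powr (- of_real \<mu>))"
    by (intro sums_mult pochhammer_binomial_sums w)
  ultimately have "(\<integral>v. (\<Sum>n. f n v) \<partial>lborel) = of_real (Gamma \<mu> * x powr (-\<mu>)) * (1 - w) powr (- of_real \<mu>)"
    by (rule sums_unique2)
  also have "1 - w = z / of_real x" using x by (simp add: w_def field_simps)
  \<comment> \<open>Division by a positive real leaves the argument unchanged, so the principal
    powers multiply.\<close>
  also have "of_real (Gamma \<mu> * x powr (-\<mu>)) * (z / of_real x) powr (- of_real \<mu>) = of_real (Gamma \<mu>) * z powr (- of_real \<mu>)"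
    using x zn
    by (simp add: powr_def Ln_divide_of_real exp_diff exp_add exp_minus algebra_simps flip: exp_of_real)
      (simp add: divide_inverse)
  finally show ?thesis
    using int sums_v by (simp add: has_bochner_integral_iff sums_iff)
qed

section \<open>Principal powers on the line Re \<lambda> = 1, with \<lambda> = 1 + i y, and Hankel's
  formula\<close>

definition line_powr :: "real \<Rightarrow> real \<Rightarrow> complex" where
  "line_powr c y = Complex 1 y powr of_real c"

lemma Complex_1_neq_0: "Complex 1 y \<noteq> 0"
  by (simp add: complex_eq_iff)

lemma norm_line_powr: "cmod (line_powr c y) = (1 + y\<^sup>2) powr (c / 2)"
proof -
  have "cmod (line_powr c y) = cmod (Complex 1 y) powr c"
    by (simp add: line_powr_def powr_def Complex_1_neq_0 norm_exp_eq_Re)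
  also have "cmod (Complex 1 y) = (1 + y\<^sup>2) powr (1 / 2)"
    by (simp add: complex_norm powr_half_sqrt)
  finally show ?thesis by (simp add: powr_powr)
qed

lemma line_powr_add: "line_powr a y * line_powr b y = line_powr (a + b) y"
  by (simp add: line_powr_def powr_add)

lemma line_powr_power: "line_powr a y ^ n = line_powr (real n * a) y"
  by (simp add: line_powr_def powr_def Complex_1_neq_0 exp_of_nat_mult[symmetric] mult.assoc)

lemma norm_line_powr_le_1: "c \<le> 0 \<Longrightarrow> cmod (line_powr c y) \<le> 1"
  unfolding norm_line_powr using powr_mono[of "c/2" 0 "1 + y\<^sup>2"]
  by (simp add: add_nonneg_eq_0_iff)

lemma line_powr_neq_0: "line_powr c y \<noteq> 0"
  by (simp add: line_powr_def powr_def Complex_1_neq_0)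

lemma Arg_Complex_1: "\<bar>Arg (Complex 1 y)\<bar> < pi / 2"
  using Re_Ln_pos_lt_imp[of "Complex 1 y"] Arg_eq_Im_Ln[OF Complex_1_neq_0, of y]
  by simp

text \<open>|Arg (1 + i y)| < \<pi>/2 and |a| \<le> 1 keep the argument of the power inside the
  principal strip. Hence principal powers compose on the line.\<close>

lemma Ln_line_powr:
  assumes "\<bar>a\<bar> \<le> 1"
  shows "Ln (line_powr a y) = of_real a * Ln (Complex 1 y)"
proof -
  have "\<bar>a * Im (Ln (Complex 1 y))\<bar> \<le> 1 * (pi / 2)"
    unfolding abs_mult using Arg_Complex_1[of y] assms
    by (intro mult_mono) (auto simp: Arg_eq_Im_Ln[OF Complex_1_neq_0])
  then have "\<bar>a * Im (Ln (Complex 1 y))\<bar> < pi" using pi_gt_zero by linarith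
  then show ?thesis
    unfolding line_powr_def powr_def using Complex_1_neq_0[of y]
    by (auto simp: abs_less_iff intro!: Ln_exp)
qed

lemma line_powr_powr: "\<bar>a\<bar> \<le> 1 \<Longrightarrow> line_powr a y powr of_real b = line_powr (a * b) y"
  using line_powr_neq_0[of a y]
  by (simp add: powr_def[of "line_powr a y"] Ln_line_powr)
    (simp add: line_powr_def powr_def Complex_1_neq_0 mult_ac)

text \<open>The power has argument a Arg (1 + i y), of modulus at most |a| \<pi>/2, and cosine
  decreases on [0, \<pi>].\<close>

lemma Re_line_powr_ge:
  assumes "\<bar>a\<bar> \<le> 1"
  shows "Re (line_powr a y) \<ge> cos (a * pi / 2) * cmod (line_powr a y)"
proof -
  have "\<bar>a * Arg (Complex 1 y)\<bar> \<le> \<bar>a\<bar> * (pi / 2)"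
    unfolding abs_mult using Arg_Complex_1[of y] by (intro mult_left_mono) auto
  moreover have "\<bar>a\<bar> * (pi / 2) \<le> pi" using assms pi_gt_zero
    by (simp add: mult_le_cancel_right)
  ultimately have "cos (\<bar>a\<bar> * (pi / 2)) \<le> cos \<bar>a * Arg (Complex 1 y)\<bar>"
    by (intro cos_monotone_0_pi_le) auto
  moreover have "cos (\<bar>a\<bar> * (pi / 2)) = cos (a * pi / 2)"
    by (cases "a \<ge> 0") auto
  ultimately have c: "cos (a * pi / 2) \<le> cos (a * Arg (Complex 1 y))" by simp
  have "Re (line_powr a y) = cmod (line_powr a y) * cos (a * Arg (Complex 1 y))"
    using Complex_1_neq_0[of y]
    by (simp add: line_powr_def powr_def Re_exp norm_exp_eq_Re Arg_eq_Im_Ln)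
  then show ?thesis using mult_left_mono[OF c, of "cmod (line_powr a y)"] by (simp add: mult.commute)
qed

lemma continuous_on_line_powr: "continuous_on UNIV (line_powr c)"
proof -
  have "line_powr c = (\<lambda>y. exp (of_real c * Ln (1 + \<i> * of_real y)))"
    unfolding fun_eq_iff line_powr_def powr_def Complex_eq
    by (auto simp: complex_eq_iff)
  then show ?thesis
    by (auto intro!: continuous_intros simp: complex_nonpos_Reals_iff)
qed

lemma borel_measurable_line_powr[measurable]: "line_powr c \<in> borel_measurable borel"
  by (rule borel_measurable_continuous_onI[OF continuous_on_line_powr])

lemma borel_measurable_Complex_1[measurable]: "Complex 1 \<in> borel_measurable borel"
  by (rule borel_measurable_continuous_onI) (auto simp: Complex_eq intro!: continuous_intros)

lemma integrable_norm_line_powr: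
  assumes "\<delta> > 1"
  shows "integrable lborel (\<lambda>y. cmod (line_powr (- \<delta>) y))"
proof -
  define h where "h = (\<lambda>y::real. indicator {1..} y * y powr (- \<delta>))"
  have "has_bochner_integral lborel h (- (1 powr (- \<delta> + 1) / (- \<delta> + 1)))"
    unfolding h_def
    by (rule has_bochner_integral_nn_integral)
      (use assms nn_integral_has_integral_lebesgue[OF _ has_integral_powr_to_inf[of "-\<delta>" 1]] in \<open>auto simp: field_simps\<close>)
  then have h: "integrable lborel h" by (simp add: has_bochner_integral_iff)
  have h': "integrable lborel (\<lambda>y. h (- y))"
    using lborel_integrable_real_affine[OF h, of "-1" 0] by simp
  have i: "integrable lborel (\<lambda>y. indicator {-1..1::real} y :: real)" by simp
  show ?thesis
  proof (rule Bochner_Integration.integrable_bound)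
    show "integrable lborel (\<lambda>y. indicator {-1..1::real} y + h y + h (- y))"
      using h h' i by (intro Bochner_Integration.integrable_add) auto
    show "AE y in lborel. norm (cmod (line_powr (- \<delta>) y)) \<le> norm (indicator {-1..1::real} y + h y + h (- y))"
    proof (intro AE_I2)
      fix y :: real
      have hn: "h y \<ge> 0" for y unfolding h_def by auto
      have "cmod (line_powr (- \<delta>) y) \<le> \<bar>y\<bar> powr (- \<delta>)" if "\<bar>y\<bar> \<ge> 1"
      proof -
        have "cmod (line_powr (- \<delta>) y) \<le> (y\<^sup>2) powr (- \<delta> / 2)"
          unfolding norm_line_powr using assms that by (intro powr_mono2') auto
        also have "y\<^sup>2 = \<bar>y\<bar> powr 2" using that by (simp add: powr_realpow[symmetric])
        also have "(\<bar>y\<bar> powr 2) powr (- \<delta> / 2) = \<bar>y\<bar> powr (- \<delta>)"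
          unfolding powr_powr by simp
        finally show ?thesis .
      qed
      then have "cmod (line_powr (- \<delta>) y) \<le> indicator {-1..1::real} y + h y + h (- y)"
        using norm_line_powr_le_1[of "-\<delta>" y] assms hn[of y] hn[of "-y"]
        by (cases "y \<ge> 1"; cases "y \<le> -1") (auto simp: h_def indicator_def)
      then show "norm (cmod (line_powr (- \<delta>) y)) \<le> norm (indicator {-1..1::real} y + h y + h (- y))" by simp
    qed
  qed measurable
qed

lemma std_normal_density_Fourier:
  fixes t :: real and n :: real
  assumes "n > 0"
  shows "(\<integral>y. of_real (std_normal_density (y / n)) * iexp (t * y) \<partial>lborel) = of_real (n * exp (- (n * t)\<^sup>2 / 2))"
proof -
  have "char std_normal_distribution (n * t) = (\<integral>x. std_normal_density x *\<^sub>R iexp (n * t * x) \<partial>lborel)"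
    unfolding char_def by (subst integral_density) auto
  also have "\<dots> = \<bar>1 / n\<bar> *\<^sub>R (\<integral>y. std_normal_density (0 + 1 / n * y) *\<^sub>R iexp (n * t * (0 + 1 / n * y)) \<partial>lborel)"
    by (rule lborel_integral_real_affine) (use assms in auto)
  also have "\<dots> = of_real (1 / n) * (\<integral>y. of_real (std_normal_density (y / n)) * iexp (t * y) \<partial>lborel)"
    using assms by (simp add: scaleR_conv_of_real)
  finally show ?thesis using assms
    by (simp add: char_std_normal_distribution field_simps)
qed

lemma integrable_std_normal_density_scaled:
  "n \<noteq> 0 \<Longrightarrow> integrable lborel (\<lambda>y. std_normal_density (y / n))"
  using lborel_integrable_real_affine[of std_normal_density "1 / n" 0]
  by simp

text \<open>Fourier inversion for the Gamma density, by Gaussian regularization.\<close>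

lemma Hankel_integral:
  assumes \<delta>: "\<delta> > 1"
  shows "(\<integral>y. exp (Complex 1 y) * line_powr (- \<delta>) y \<partial>lborel) = of_real (2 * pi / Gamma \<delta>)"
proof -
  define g where "g = (\<lambda>s::real. indicator {0..} s * s powr (\<delta> - 1) * exp (- s))"
  have g_int: "integrable lborel g"
    using Gamma_integral_scaled_real[of \<delta> 1] \<delta> by (simp add: g_def has_bochner_integral_iff)
  have g_meas[measurable]: "g \<in> borel_measurable borel" unfolding g_def by measurable
  have g_nonneg: "g s \<ge> 0" for s unfolding g_def by simp
  obtain K where K: "\<And>s. g s \<le> K"
  proof
    fix s :: real
    \<comment> \<open>s powr a times exp (- s) is largest at s = a, by ln (s / a) \<le> s / a -
      1.\<close>
    define a where "a = \<delta> - 1"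
    have a: "a > 0" using \<delta> by (simp add: a_def)
    show "g s \<le> exp (a * ln a - a)"
    proof (cases "s > 0")
      case True
      have "ln (s / a) \<le> s / a - 1" using True a by (intro ln_le_minus_one) auto
      then have "a * ln s \<le> s - a + a * ln a" using True a by (simp add: ln_div field_simps)
      then have "exp (a * ln s - s) \<le> exp (a * ln a - a)" by simp
      moreover have "g s = exp (a * ln s - s)"
        using True by (simp add: g_def a_def powr_def exp_add[symmetric])
      ultimately show ?thesis by simp
    qed (auto simp: g_def indicator_def)
  qed
  \<comment> \<open>The phase contains 1 - s because the inversion formula is evaluated at the point
    1.\<close>
  have g_F: "(\<integral>s. of_real (g s) * iexp (y * (1 - s)) \<partial>lborel) = of_real (Gamma \<delta>) * (iexp y * line_powr (- \<delta>) y)" for y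
  proof -
    have A: "(\<integral>v. of_real (indicator {0..} v * v powr (\<delta> - 1)) * exp (- (of_real v * Complex 1 y)) \<partial>lborel)
        = of_real (Gamma \<delta>) * line_powr (- \<delta>) y"
      using Gamma_integral_scaled_complex[of \<delta> "Complex 1 y"] \<delta> by (simp add: has_bochner_integral_iff line_powr_def)
    have B: "of_real (g s) * iexp (y * (1 - s)) = iexp y * (of_real (indicator {0..} s * s powr (\<delta> - 1)) * exp (- (of_real s * Complex 1 y)))" for s
    proof -
      have "of_real (exp (- s)) * iexp (y * (1 - s)) = iexp y * exp (- (of_real s * Complex 1 y))"
        unfolding exp_of_real[symmetric] exp_add[symmetric]
        by (simp add: Complex_eq algebra_simps)
      then show ?thesis unfolding g_def by (simp add: mult_ac)
    qed
    show ?thesis unfolding B integral_mult_right_zero A by (simp only: mult_ac)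
  qed
  \<comment> \<open>\<open>I n\<close> is evaluated in two ways. Fubini turns it into a Gaussian
    average of g around 1, which tends to g 1 times the Gaussian integral. Dominated convergence as
    the Gaussian flattens turns it into the density at 0 times the desired integral.\<close>
  define I where "I = (\<lambda>n. \<integral>y. of_real (std_normal_density (y / n)) * (of_real (Gamma \<delta>) * (iexp y * line_powr (- \<delta>) y)) \<partial>lborel)"
  have I_eq: "I n = of_real (\<integral>v. g (1 + v / n) * exp (- v\<^sup>2 / 2) \<partial>lborel)" if n: "n > 0" for n
  proof -
    define f where "f = (\<lambda>s y. of_real (std_normal_density (y / n)) * (of_real (g s) * iexp (y * (1 - s))))"
    have f_meas: "case_prod f \<in> borel_measurable (lborel \<Otimes>\<^sub>M lborel)"
      unfolding f_def by measurable
    have normf: "norm (f s y) = std_normal_density (y / n) * g s" for s y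
      by (simp add: f_def norm_mult g_nonneg)
    have f_int: "integrable (lborel \<Otimes>\<^sub>M lborel) (case_prod f)"
    proof (rule lborel_pair.Fubini_integrable[OF f_meas])
      show "integrable lborel (\<lambda>s. \<integral>y. norm (case_prod f (s, y)) \<partial>lborel)"
        using g_int by (simp add: normf)
      show "AE s in lborel. integrable lborel (\<lambda>y. case_prod f (s, y))"
      proof (rule AE_I2)
        fix s
        show "integrable lborel (\<lambda>y. case_prod f (s, y))"
          by (rule Bochner_Integration.integrable_bound[OF integrable_mult_left[OF integrable_std_normal_density_scaled[of n], of "g s"]])
            (use n f_meas in \<open>auto simp: normf g_nonneg\<close>)
      qed
    qed
    have "I n = (\<integral>y. (\<integral>s. f s y \<partial>lborel) \<partial>lborel)"
      unfolding I_def f_def integral_mult_right_zero g_F ..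
    also have "\<dots> = (\<integral>s. (\<integral>y. f s y \<partial>lborel) \<partial>lborel)"
      by (rule lborel_pair.Fubini_integral[OF f_int])
    also have "\<dots> = (\<integral>s. of_real (g s * (n * exp (- (n * (1 - s))\<^sup>2 / 2))) \<partial>lborel)"
    proof (rule Bochner_Integration.integral_cong[OF refl])
      fix s
      have "(\<integral>y. f s y \<partial>lborel) = (\<integral>y. of_real (g s) * (of_real (std_normal_density (y / n)) * iexp ((1 - s) * y)) \<partial>lborel)"
        unfolding f_def by (simp add: mult_ac)
      also have "\<dots> = of_real (g s) * of_real (n * exp (- (n * (1 - s))\<^sup>2 / 2))"
        by (simp only: integral_mult_right_zero std_normal_density_Fourier[OF n])
      finally show "(\<integral>y. f s y \<partial>lborel) = of_real (g s * (n * exp (- (n * (1 - s))\<^sup>2 / 2)))" by simp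
    qed
    also have "\<dots> = of_real (\<integral>s. g s * (n * exp (- (n * (1 - s))\<^sup>2 / 2)) \<partial>lborel)"
      by (rule integral_complex_of_real)
    also have "(\<integral>s. g s * (n * exp (- (n * (1 - s))\<^sup>2 / 2)) \<partial>lborel)
       = \<bar>1 / n\<bar> *\<^sub>R (\<integral>v. g (1 + 1 / n * v) * (n * exp (- (n * (1 - (1 + 1 / n * v)))\<^sup>2 / 2)) \<partial>lborel)"
      by (rule lborel_integral_real_affine) (use n in auto)
    also have "\<dots> = (\<integral>v. g (1 + v / n) * exp (- v\<^sup>2 / 2) \<partial>lborel)"
      using n by (simp add: mult.left_commute[of _ n])
    finally show ?thesis .
  qed
  have gauss: "has_bochner_integral lborel (\<lambda>v::real. exp (- v\<^sup>2 / 2)) (sqrt (2 * pi))"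
  proof -
    have "has_bochner_integral lborel std_normal_density 1"
      by (simp add: has_bochner_integral_iff)
    then have "has_bochner_integral lborel (\<lambda>v. sqrt (2 * pi) * std_normal_density v) (sqrt (2 * pi) * 1)"
      by (intro has_bochner_integral_mult_right)
    then show ?thesis by (simp add: std_normal_density_def)
  qed
  have lim1: "(\<lambda>k. \<integral>v. g (1 + v / real (Suc k)) * exp (- v\<^sup>2 / 2) \<partial>lborel) \<longlonglongrightarrow> (\<integral>v. g 1 * exp (- v\<^sup>2 / 2) \<partial>lborel)"
  proof (rule integral_dominated_convergence[where w = "\<lambda>v. K * exp (- v\<^sup>2 / 2)"])
    show "integrable lborel (\<lambda>v. K * exp (- v\<^sup>2 / 2))"
      using gauss by (simp add: has_bochner_integral_iff)
    show "AE v in lborel. (\<lambda>k. g (1 + v / real (Suc k)) * exp (- v\<^sup>2 / 2)) \<longlonglongrightarrow> g 1 * exp (- v\<^sup>2 / 2)"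
    proof (intro AE_I2 tendsto_intros)
      fix v :: real
      have l: "(\<lambda>k. 1 + v / real (Suc k)) \<longlonglongrightarrow> 1 + 0"
        by (intro tendsto_intros LIMSEQ_Suc[OF lim_const_over_n])
      have c: "(\<lambda>k. (1 + v / real (Suc k)) powr (\<delta> - 1) * exp (- (1 + v / real (Suc k)))) \<longlonglongrightarrow> 1 powr (\<delta> - 1) * exp (- 1)"
        by (intro tendsto_intros) (use l in auto)
      have "\<forall>\<^sub>F k in sequentially. 1 + v / real (Suc k) > 0"
        by (rule order_tendstoD(1)[OF l]) simp
      then have "\<forall>\<^sub>F k in sequentially. (1 + v / real (Suc k)) powr (\<delta> - 1) * exp (- (1 + v / real (Suc k))) = g (1 + v / real (Suc k))"
        by eventually_elim (simp add: g_def)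
      from Lim_transform_eventually[OF c this] show "(\<lambda>k. g (1 + v / real (Suc k))) \<longlonglongrightarrow> g 1"
        by (simp add: g_def)
    qed
    show "AE v in lborel. norm (g (1 + v / real (Suc k)) * exp (- v\<^sup>2 / 2)) \<le> K * exp (- v\<^sup>2 / 2)" for k
      using K g_nonneg by (auto simp: norm_mult intro!: mult_right_mono AE_I2)
  qed measurable
  have "(\<lambda>k. of_real (\<integral>v. g (1 + v / real (Suc k)) * exp (- v\<^sup>2 / 2) \<partial>lborel)) \<longlonglongrightarrow> complex_of_real (\<integral>v. g 1 * exp (- v\<^sup>2 / 2) \<partial>lborel)"
    by (rule tendsto_of_real[OF lim1])
  moreover have "(\<integral>v. g 1 * exp (- v\<^sup>2 / 2) \<partial>lborel) = exp (- 1) * sqrt (2 * pi)"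
    using gauss by (simp add: has_bochner_integral_iff g_def)
  ultimately have limA: "(\<lambda>k. I (real (Suc k))) \<longlonglongrightarrow> of_real (exp (- 1) * sqrt (2 * pi))"
    by (simp only: I_eq of_nat_0_less_iff zero_less_Suc)
  define J where "J = (\<integral>y. of_real (Gamma \<delta>) * (iexp y * line_powr (- \<delta>) y) \<partial>lborel)"
  have limB: "(\<lambda>k. I (real (Suc k))) \<longlonglongrightarrow> (\<integral>y. of_real (std_normal_density 0) * (of_real (Gamma \<delta>) * (iexp y * line_powr (- \<delta>) y)) \<partial>lborel)"
    unfolding I_def
  proof (rule integral_dominated_convergence[where w = "\<lambda>y. std_normal_density 0 * Gamma \<delta> * cmod (line_powr (- \<delta>) y)"])
    show "integrable lborel (\<lambda>y. std_normal_density 0 * Gamma \<delta> * cmod (line_powr (- \<delta>) y))"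
      by (intro integrable_mult_right integrable_norm_line_powr \<delta>)
    show "AE y in lborel. (\<lambda>k. of_real (std_normal_density (y / real (Suc k))) * (of_real (Gamma \<delta>) * (iexp y * line_powr (- \<delta>) y)))
          \<longlonglongrightarrow> of_real (std_normal_density 0) * (of_real (Gamma \<delta>) * (iexp y * line_powr (- \<delta>) y))"
      unfolding std_normal_density_def
      by (intro AE_I2 tendsto_intros LIMSEQ_Suc[OF lim_const_over_n]) auto
    show "AE y in lborel. norm (of_real (std_normal_density (y / real (Suc k))) * (of_real (Gamma \<delta>) * (iexp y * line_powr (- \<delta>) y)))
        \<le> std_normal_density 0 * Gamma \<delta> * cmod (line_powr (- \<delta>) y)" for k
    proof (intro AE_I2)
      fix y
      have "std_normal_density (y / real (Suc k)) \<le> std_normal_density 0"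
        by (simp add: std_normal_density_def divide_right_mono)
      then show "norm (of_real (std_normal_density (y / real (Suc k))) * (of_real (Gamma \<delta>) * (iexp y * line_powr (- \<delta>) y)))
        \<le> std_normal_density 0 * Gamma \<delta> * cmod (line_powr (- \<delta>) y)"
        using \<delta> by (simp add: norm_mult Gamma_real_nonneg mult_right_mono flip: mult.assoc)
    qed
  qed measurable
  have SJ: "of_real (std_normal_density 0) * J = of_real (exp (- 1) * sqrt (2 * pi))"
    using LIMSEQ_unique[OF limB limA] unfolding J_def by (simp only: integral_mult_right_zero)
  have "of_real (sqrt (2 * pi)) * (of_real (std_normal_density 0) * J) = complex_of_real (exp (- 1) * (sqrt (2 * pi) * sqrt (2 * pi)))"
    unfolding SJ by (simp only: of_real_mult mult_ac)
  then have J: "J = of_real (exp (- 1) * (2 * pi))"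
    by (simp add: std_normal_density_def)
  \<comment> \<open>The factor exp 1 of exp (1 + i y) cancels the value exp (- 1) of g at 1.\<close>
  have "(\<integral>y. exp (Complex 1 y) * line_powr (- \<delta>) y \<partial>lborel) = (\<integral>y. of_real (exp 1 / Gamma \<delta>) * (of_real (Gamma \<delta>) * (iexp y * line_powr (- \<delta>) y)) \<partial>lborel)"
  proof (rule Bochner_Integration.integral_cong[OF refl])
    fix y
    have "exp (Complex 1 y) = of_real (exp 1) * iexp y"
      by (simp add: Complex_eq exp_add flip: exp_of_real)
    moreover have "Gamma \<delta> \<noteq> 0" using Gamma_real_pos[of \<delta>] \<delta> by linarith
    ultimately show "exp (Complex 1 y) * line_powr (- \<delta>) y = of_real (exp 1 / Gamma \<delta>) * (of_real (Gamma \<delta>) * (iexp y * line_powr (- \<delta>) y))"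
      by simp
  qed
  also have "\<dots> = of_real (exp 1 / Gamma \<delta>) * J"
    unfolding J_def by (rule integral_mult_right_zero)
  also have "\<dots> = of_real (2 * pi / Gamma \<delta>)"
    unfolding J by (simp add: exp_minus)
  finally show ?thesis .
qed

section \<open>The Wright function on the negative half-line\<close>

text \<open>The Wright function at \<open>-x\<close>.\<close>

definition wright :: "real \<Rightarrow> real \<Rightarrow> real \<Rightarrow> real" where
  "wright \<rho> \<delta> x = (\<Sum>n. (- x) ^ n / (fact n * Gamma (\<delta> + \<rho> * real n)))"

text \<open>On the line |\<lambda>| \<ge> 1, so the integrand of Hankel's formula at \<delta> + s is
  dominated by the one at \<delta>. A bound uniform in s is enough for the Wright series, since the
  factorial alone makes it converge.\<close>

lemma Gamma_inverse_bound:
  assumes "\<delta> > 1" "s \<ge> 0"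
  shows "1 / Gamma (\<delta> + s) \<le> exp 1 / (2 * pi) * (\<integral>y. cmod (line_powr (- \<delta>) y) \<partial>lborel)"
proof -
  have G: "Gamma (\<delta> + s) > 0" using assms by (intro Gamma_real_pos) auto
  have "2 * pi / Gamma (\<delta> + s) = cmod (\<integral>y. exp (Complex 1 y) * line_powr (- (\<delta> + s)) y \<partial>lborel)"
    using Hankel_integral[of "\<delta> + s"] assms G by (simp add: norm_divide)
  also have "\<dots> \<le> (\<integral>y. exp 1 * cmod (line_powr (- \<delta>) y) \<partial>lborel)"
  proof (rule Bochner_Integration.integral_norm_bound_integral[THEN order_trans])
    have i: "integrable lborel (\<lambda>y. exp 1 * cmod (line_powr (- \<delta>) y))"
      by (intro integrable_mult_right integrable_norm_line_powr assms)
    then show "integrable lborel (\<lambda>y. exp 1 * cmod (line_powr (- \<delta>) y))" .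
    have le: "cmod (exp (Complex 1 y) * line_powr (- (\<delta> + s)) y) \<le> exp 1 * cmod (line_powr (- \<delta>) y)" for y
      unfolding norm_mult norm_line_powr using assms(2)
      by (intro mult_mono powr_mono) (auto simp: norm_exp_eq_Re)
    then show "\<And>y. y \<in> space lborel \<Longrightarrow> cmod (exp (Complex 1 y) * line_powr (- (\<delta> + s)) y) \<le> exp 1 * cmod (line_powr (- \<delta>) y)" by simp
    show "integrable lborel (\<lambda>y. exp (Complex 1 y) * line_powr (- (\<delta> + s)) y)"
      by (rule Bochner_Integration.integrable_bound[OF i]) (use le in auto)
  qed simp
  finally show ?thesis using G pi_gt_zero by (simp add: field_simps)
qed

lemma wright_summable:
  assumes "\<delta> > 1" "\<rho> \<ge> 0"
  shows "summable (\<lambda>n. \<bar>x\<bar> ^ n / (fact n * Gamma (\<delta> + \<rho> * real n)))"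
proof (rule summable_comparison_test'[where N = 0])
  define c where "c = exp 1 / (2 * pi) * (\<integral>y. cmod (line_powr (- \<delta>) y) \<partial>lborel)"
  show "summable (\<lambda>n. c * (\<bar>x\<bar> ^ n /\<^sub>R fact n))"
    by (intro summable_mult summable_exp_generic)
  fix n :: nat
  have "1 / Gamma (\<delta> + \<rho> * real n) \<le> c"
    unfolding c_def by (rule Gamma_inverse_bound) (use assms in auto)
  then have "1 / Gamma (\<delta> + \<rho> * real n) * (\<bar>x\<bar> ^ n / fact n) \<le> c * (\<bar>x\<bar> ^ n / fact n)"
    by (rule mult_right_mono) simp
  moreover have "Gamma (\<delta> + \<rho> * real n) > 0" using assms by (intro Gamma_real_pos add_pos_nonneg) auto
  ultimately show "norm (\<bar>x\<bar> ^ n / (fact n * Gamma (\<delta> + \<rho> * real n))) \<le> c * (\<bar>x\<bar> ^ n /\<^sub>R fact n)"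
    by (simp add: field_simps)
qed

lemma wright_sums:
  assumes "\<delta> > 1" "\<rho> \<ge> 0"
  shows "(\<lambda>n. (- x) ^ n / (fact n * Gamma (\<delta> + \<rho> * real n))) sums wright \<rho> \<delta> x"
proof -
  have G: "Gamma (\<delta> + \<rho> * real n) \<ge> 0" for n
    using assms by (intro Gamma_real_nonneg add_pos_nonneg) auto
  have N: "norm ((- x) ^ n / (fact n * Gamma (\<delta> + \<rho> * real n))) = \<bar>x\<bar> ^ n / (fact n * Gamma (\<delta> + \<rho> * real n))" for n
    unfolding real_norm_def abs_divide abs_mult power_abs using G[of n] by simp
  have "summable (\<lambda>n. norm ((- x) ^ n / (fact n * Gamma (\<delta> + \<rho> * real n))))"
    unfolding N by (rule wright_summable[OF assms])
  then show ?thesis unfolding wright_def by (rule summable_sums[OF summable_norm_cancel])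
qed

lemma wright_0:
  assumes "\<delta> > 1" "\<rho> \<ge> 0"
  shows "wright \<rho> \<delta> 0 = 1 / Gamma \<delta>"
proof -
  have "(- 0) ^ n / (fact n * Gamma (\<delta> + \<rho> * real n)) = (if n = 0 then 1 / Gamma \<delta> else 0)" for n
    by simp
  then show ?thesis
    using sums_unique2[OF wright_sums[OF assms, of 0]] sums_single[of 0 "\<lambda>_. 1 / Gamma \<delta>"]
    by (simp only:)
qed

lemma continuous_on_wright:
  assumes "\<delta> > 1" "\<rho> \<ge> 0"
  shows "continuous_on UNIV (wright \<rho> \<delta>)"
proof -
  define c where "c = (\<lambda>n. (- 1) ^ n / (fact n * Gamma (\<delta> + \<rho> * real n)))"
  have s: "(\<lambda>n. c n * x ^ n) sums wright \<rho> \<delta> x" for x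
  proof -
    have "c n * x ^ n = (- x) ^ n / (fact n * Gamma (\<delta> + \<rho> * real n))" for n
      unfolding c_def by (subst power_minus) simp
    then show ?thesis using wright_sums[OF assms, of x] by (simp only:)
  qed
  then have "wright \<rho> \<delta> = (\<lambda>x. \<Sum>n. c n * x ^ n)" by (auto simp: sums_iff)
  moreover have "isCont (\<lambda>x. \<Sum>n. c n * x ^ n) x" for x
    by (rule isCont_powser_converges_everywhere) (use s in \<open>auto simp: sums_iff\<close>)
  ultimately show ?thesis by (simp add: continuous_on_eq_continuous_at)
qed

lemma borel_measurable_wright[measurable]:
  "\<delta> > 1 \<Longrightarrow> \<rho> \<ge> 0 \<Longrightarrow> wright \<rho> \<delta> \<in> borel_measurable borel"
  by (rule borel_measurable_continuous_onI[OF continuous_on_wright])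

text \<open>Expanding exp (- x \<lambda> powr - \<rho>) and integrating term by term gives Hankel's
  formula at the exponents \<delta> + \<rho> n. As |\<lambda>| powr - \<rho> \<le> 1, the
  exponential series in |x| dominates.\<close>

lemma wright_line_integral:
  assumes \<delta>: "\<delta> > 1" and \<rho>: "\<rho> \<ge> 0"
  shows "has_bochner_integral lborel
    (\<lambda>y. exp (Complex 1 y) * line_powr (- \<delta>) y * exp (- (of_real x * line_powr (- \<rho>) y)))
    (of_real (2 * pi * wright \<rho> \<delta> x))"
proof -
  define f where "f = (\<lambda>n y. exp (Complex 1 y) * line_powr (- (\<delta> + \<rho> * real n)) y * of_real ((- x) ^ n / fact n))"
  have f_alt: "f n y = exp (Complex 1 y) * line_powr (- \<delta>) y * ((- (of_real x * line_powr (- \<rho>) y)) ^ n /\<^sub>R fact n)" for n y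
  proof -
    have "line_powr (- (\<delta> + \<rho> * real n)) y = line_powr (- \<delta>) y * line_powr (- \<rho>) y ^ n"
      by (simp add: line_powr_power line_powr_add algebra_simps)
    moreover have "(- (of_real x * line_powr (- \<rho>) y)) ^ n = of_real ((- x) ^ n) * line_powr (- \<rho>) y ^ n"
      by (simp flip: power_mult_distrib)
    ultimately show ?thesis unfolding f_def scaleR_conv_of_real
      by (simp add: divide_inverse mult_ac)
  qed
  define c where "c = exp 1 * (\<integral>y. cmod (line_powr (- \<delta>) y) \<partial>lborel)"
  have i: "integrable lborel (\<lambda>y. exp 1 * cmod (line_powr (- \<delta>) y) * (\<bar>x\<bar> ^ n / fact n))" for n
    by (intro integrable_mult_left integrable_mult_right integrable_norm_line_powr assms)
  have le: "norm (f n y) \<le> exp 1 * cmod (line_powr (- \<delta>) y) * (\<bar>x\<bar> ^ n / fact n)" for n y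
  proof -
    have "cmod (line_powr (- (\<delta> + \<rho> * real n)) y) \<le> cmod (line_powr (- \<delta>) y)"
      unfolding norm_line_powr using \<rho> by (intro powr_mono) auto
    then show ?thesis
      by (auto simp: f_def norm_mult norm_exp_eq_Re norm_divide norm_power intro!: divide_right_mono mult_right_mono)
  qed
  have f_meas[measurable]: "f n \<in> borel_measurable borel" for n unfolding f_def by measurable
  have fi: "integrable lborel (f n)" for n
    by (rule Bochner_Integration.integrable_bound[OF i[of n]]) (use le in \<open>auto intro: order_trans\<close>)
  have fsum: "(\<lambda>n. f n y) sums (exp (Complex 1 y) * line_powr (- \<delta>) y * exp (- (of_real x * line_powr (- \<rho>) y)))" for y
    unfolding f_alt by (intro sums_mult exp_converges)
  have sn: "summable (\<lambda>n. norm (f n y))" for y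
    unfolding f_alt norm_mult by (intro summable_mult summable_norm_exp)
  have si: "summable (\<lambda>n. \<integral>y. norm (f n y) \<partial>lborel)"
  proof (rule summable_comparison_test'[where N = 0])
    show "summable (\<lambda>n. c * (\<bar>x\<bar> ^ n /\<^sub>R fact n))"
      by (intro summable_mult summable_exp_generic)
    fix n :: nat
    have "(\<integral>y. norm (f n y) \<partial>lborel) \<le> (\<integral>y. exp 1 * cmod (line_powr (- \<delta>) y) * (\<bar>x\<bar> ^ n / fact n) \<partial>lborel)"
      by (intro integral_mono integrable_norm fi i le)
    also have "\<dots> = c * (\<bar>x\<bar> ^ n /\<^sub>R fact n)"
      by (simp add: c_def field_simps)
    finally show "norm (\<integral>y. norm (f n y) \<partial>lborel) \<le> c * (\<bar>x\<bar> ^ n /\<^sub>R fact n)" by simp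
  qed
  have I: "integral\<^sup>L lborel (f n) = of_real (2 * pi * ((- x) ^ n / (fact n * Gamma (\<delta> + \<rho> * real n))))" for n
  proof -
    have "integral\<^sup>L lborel (f n) = (\<integral>y. exp (Complex 1 y) * line_powr (- (\<delta> + \<rho> * real n)) y \<partial>lborel) * of_real ((- x) ^ n / fact n)"
      unfolding f_def by (rule integral_mult_left_zero)
    also have "(\<integral>y. exp (Complex 1 y) * line_powr (- (\<delta> + \<rho> * real n)) y \<partial>lborel) = of_real (2 * pi / Gamma (\<delta> + \<rho> * real n))"
      by (rule Hankel_integral) (use \<delta> \<rho> in \<open>auto intro: less_le_trans\<close>)
    finally show ?thesis by simp
  qed
  have "(\<lambda>n. integral\<^sup>L lborel (f n)) sums (\<integral>y. (\<Sum>n. f n y) \<partial>lborel)"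
    by (rule sums_integral) (use fi sn si in auto)
  moreover have "(\<lambda>n. integral\<^sup>L lborel (f n)) sums of_real (2 * pi * wright \<rho> \<delta> x)"
    unfolding I by (intro sums_of_real sums_mult wright_sums \<delta> \<rho>)
  ultimately have "(\<integral>y. (\<Sum>n. f n y) \<partial>lborel) = of_real (2 * pi * wright \<rho> \<delta> x)"
    by (rule sums_unique2)
  moreover have "integrable lborel (\<lambda>y. \<Sum>n. f n y)"
    by (rule integrable_suminf) (use fi sn si in auto)
  ultimately show ?thesis using fsum by (simp add: has_bochner_integral_iff sums_iff)
qed

section \<open>Exponential decay on the line, moments and Weyl integrals\<close>

abbreviation line_decay :: "real \<Rightarrow> real \<Rightarrow> real" where
  "line_decay \<rho> y \<equiv> cos (\<rho> * pi / 2) * cmod (line_powr (- \<rho>) y)"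

text \<open>What remains of the line integral after taking absolute values; exp 1 is |exp \<lambda>|
  on the line. Unlike |\<open>wright\<close>| it is manifestly nonincreasing in x \<ge> 0, so a
  single value of t can dominate the kernel for all nearby t.\<close>

definition wright_major :: "real \<Rightarrow> real \<Rightarrow> real \<Rightarrow> real" where
  "wright_major \<rho> \<delta> x = exp 1 / (2 * pi) *
     (\<integral>y. cmod (line_powr (- \<delta>) y) * exp (- (x * line_decay \<rho> y)) \<partial>lborel)"

context
  fixes \<rho> :: real
  assumes \<rho>: "0 < \<rho>" "\<rho> < 1"
begin

lemma cos_pos: "cos (\<rho> * pi / 2) > 0"
  using \<rho> by (intro cos_gt_zero_pi) (auto simp: field_simps intro: less_trans[of _ 0])

lemma norm_exp_line_powr_le:
  assumes "x \<ge> 0"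
  shows "cmod (exp (- (of_real x * line_powr (- \<rho>) y))) \<le> exp (- (x * line_decay \<rho> y))"
  using mult_left_mono[OF Re_line_powr_ge[of "-\<rho>" y] assms] \<rho> by (simp add: norm_exp_eq_Re)

lemma integrable_wright_major_integrand:
  assumes "\<delta> > 1" "x \<ge> 0"
  shows "integrable lborel (\<lambda>y. cmod (line_powr (- \<delta>) y) * exp (- (x * line_decay \<rho> y)))"
  by (rule Bochner_Integration.integrable_bound[OF integrable_norm_line_powr[OF assms(1)]])
    (use assms cos_pos in \<open>auto simp: norm_mult intro!: mult_left_le\<close>)

lemma wright_le_major:
  assumes "\<delta> > 1" "x \<ge> 0"
  shows "\<bar>wright \<rho> \<delta> x\<bar> \<le> wright_major \<rho> \<delta> x"
proof -
  note h = wright_line_integral[OF assms(1), of \<rho> x]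
  have "2 * pi * \<bar>wright \<rho> \<delta> x\<bar> = cmod (\<integral>y. exp (Complex 1 y) * line_powr (- \<delta>) y * exp (- (of_real x * line_powr (- \<rho>) y)) \<partial>lborel)"
    using h \<rho> by (simp add: has_bochner_integral_iff norm_mult)
  also have "\<dots> \<le> (\<integral>y. exp 1 * (cmod (line_powr (- \<delta>) y) * exp (- (x * line_decay \<rho> y))) \<partial>lborel)"
  proof (rule Bochner_Integration.integral_norm_bound_integral)
    show "integrable lborel (\<lambda>y. exp (Complex 1 y) * line_powr (- \<delta>) y * exp (- (of_real x * line_powr (- \<rho>) y)))"
      using h \<rho> by (simp add: has_bochner_integral_iff)
    show "integrable lborel (\<lambda>y. exp 1 * (cmod (line_powr (- \<delta>) y) * exp (- (x * line_decay \<rho> y))))"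
      by (intro integrable_mult_right integrable_wright_major_integrand assms)
    fix y
    show "cmod (exp (Complex 1 y) * line_powr (- \<delta>) y * exp (- (of_real x * line_powr (- \<rho>) y))) \<le> exp 1 * (cmod (line_powr (- \<delta>) y) * exp (- (x * line_decay \<rho> y)))"
      using norm_exp_line_powr_le[OF assms(2), of y]
      unfolding norm_mult mult.assoc by (auto simp: norm_exp_eq_Re[of "Complex 1 y"] intro!: mult_left_mono)
  qed
  finally show ?thesis using pi_gt_zero by (simp add: wright_major_def field_simps)
qed

lemma wright_major_antimono:
  assumes "\<delta> > 1" "0 \<le> x" "x \<le> x'"
  shows "wright_major \<rho> \<delta> x' \<le> wright_major \<rho> \<delta> x"
  unfolding wright_major_def using assms cos_pos
  by (intro mult_left_mono integral_mono integrable_wright_major_integrand)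
    (auto intro!: mult_left_mono mult_right_mono)

lemma wright_major_nonneg: "wright_major \<rho> \<delta> x \<ge> 0"
  unfolding wright_major_def by simp

text \<open>The integral over v is a Gamma integral, proportional to |\<lambda>| powr (\<rho>
  \<mu>). What remains on the line is |\<lambda>| powr - (\<delta> - \<rho> \<mu>), integrable
  because \<delta> - \<rho> \<mu> > 1. The same function justifies Fubini for the Weyl
  integral.\<close>

lemma wright_pair_integrable:
  assumes "\<mu> > 0" "\<delta> > 1 + \<rho> * \<mu>"
  shows "integrable (lborel \<Otimes>\<^sub>M lborel)
    (\<lambda>(y, v). cmod (line_powr (- \<delta>) y) *
       (indicator {0..} v * v powr (\<mu> - 1) * exp (- (v * line_decay \<rho> y))))"
    (is "integrable _ ?F")
proof (rule lborel_pair.Fubini_integrable)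
  show m: "?F \<in> borel_measurable (lborel \<Otimes>\<^sub>M lborel)" by measurable
  define k where "k = line_decay \<rho>"
  have k: "k y > 0" for y unfolding k_def using cos_pos line_powr_neq_0 by simp
  have hb: "has_bochner_integral lborel (\<lambda>v. ?F (y, v)) (cmod (line_powr (- \<delta>) y) * (Gamma \<mu> * k y powr (- \<mu>)))" for y
    unfolding prod.case
    unfolding k_def
    by (intro has_bochner_integral_mult_right Gamma_integral_scaled_real assms(1) k[unfolded k_def])
  then show "AE y in lborel. integrable lborel (\<lambda>v. ?F (y, v))"
    by (auto simp: has_bochner_integral_iff)
  have "(\<integral>v. norm (?F (y, v)) \<partial>lborel) = (Gamma \<mu> * cos (\<rho> * pi / 2) powr (- \<mu>)) * cmod (line_powr (- (\<delta> - \<rho> * \<mu>)) y)" for y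
  proof -
    have "norm (?F (y, v)) = ?F (y, v)" for v by simp
    then have "(\<integral>v. norm (?F (y, v)) \<partial>lborel) = cmod (line_powr (- \<delta>) y) * (Gamma \<mu> * k y powr (- \<mu>))"
      using hb[of y] by (simp only: has_bochner_integral_iff)
    also have "k y powr (- \<mu>) = cos (\<rho> * pi / 2) powr (- \<mu>) * cmod (line_powr (\<rho> * \<mu>) y)"
      unfolding k_def norm_line_powr using cos_pos by (simp add: powr_mult powr_powr)
    also have "cmod (line_powr (- \<delta>) y) * (Gamma \<mu> * (cos (\<rho> * pi / 2) powr (- \<mu>) * cmod (line_powr (\<rho> * \<mu>) y)))
      = (Gamma \<mu> * cos (\<rho> * pi / 2) powr (- \<mu>)) * cmod (line_powr (- \<delta>) y * line_powr (\<rho> * \<mu>) y)"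
      by (simp add: norm_mult)
    finally show ?thesis unfolding line_powr_add by simp
  qed
  then show "integrable lborel (\<lambda>y. \<integral>v. norm (?F (y, v)) \<partial>lborel)"
    using assms by (simp only:) (intro integrable_mult_right integrable_norm_line_powr, simp)
qed

lemma integrable_wright_major:
  assumes "\<mu> > 0" "\<delta> > 1 + \<rho> * \<mu>"
  shows "integrable lborel (\<lambda>v. indicator {0..} v * v powr (\<mu> - 1) * wright_major \<rho> \<delta> v)"
proof -
  from lborel_pair.integrable_snd[OF wright_pair_integrable[OF assms]]
  have "integrable lborel (\<lambda>v. \<integral>y. cmod (line_powr (- \<delta>) y) *
       (indicator {0..} v * v powr (\<mu> - 1) * exp (- (v * line_decay \<rho> y))) \<partial>lborel)" .
  then have "integrable lborel (\<lambda>v. exp 1 / (2 * pi) * (\<integral>y. cmod (line_powr (- \<delta>) y) *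
       (indicator {0..} v * v powr (\<mu> - 1) * exp (- (v * line_decay \<rho> y))) \<partial>lborel))"
    by (rule integrable_mult_right)
  moreover have "exp 1 / (2 * pi) * (\<integral>y. cmod (line_powr (- \<delta>) y) *
       (indicator {0..} v * v powr (\<mu> - 1) * exp (- (v * line_decay \<rho> y))) \<partial>lborel)
     = indicator {0..} v * v powr (\<mu> - 1) * wright_major \<rho> \<delta> v" for v
    unfolding wright_major_def mult.left_commute[of "cmod _" "indicator _ _ * _"] integral_mult_right_zero
    by (simp only: mult_ac)
  ultimately show ?thesis by (simp only:)
qed

text \<open>The line integral is inserted for the Wright function and the order of integration
  exchanged. The integral over v is the Gamma integral at z = \<lambda> powr - \<rho>, with value
  Gamma \<mu> times \<lambda> powr (\<rho> \<mu>), and this power lowers \<delta> + \<rho> \<mu> to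
  \<delta>.\<close>

lemma wright_Weyl_integral:
  assumes \<mu>: "\<mu> > 0" and \<delta>: "\<delta> > 1" and x: "x \<ge> 0"
  shows "(\<integral>v. indicator {0..} v * v powr (\<mu> - 1) * wright \<rho> (\<delta> + \<rho> * \<mu>) (x + v) \<partial>lborel) = Gamma \<mu> * wright \<rho> \<delta> x"
proof -
  have \<delta>': "\<delta> + \<rho> * \<mu> > 1 + \<rho> * \<mu>" "\<delta> + \<rho> * \<mu> > 1" using \<delta> mult_pos_pos[OF \<rho>(1) \<mu>] by linarith+
  define G where "G = (\<lambda>y v. exp (Complex 1 y) * line_powr (- (\<delta> + \<rho> * \<mu>)) y * exp (- (of_real (x + v) * line_powr (- \<rho>) y)) * of_real (indicator {0..} v * v powr (\<mu> - 1)))"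
  have G_alt: "G y v = exp (Complex 1 y) * line_powr (- (\<delta> + \<rho> * \<mu>)) y * exp (- (of_real x * line_powr (- \<rho>) y)) *
      (of_real (indicator {0..} v * v powr (\<mu> - 1)) * exp (- (of_real v * line_powr (- \<rho>) y)))" for y v
  proof -
    have "exp (- (of_real (x + v) * line_powr (- \<rho>) y)) = exp (- (of_real x * line_powr (- \<rho>) y)) * exp (- (of_real v * line_powr (- \<rho>) y))"
      unfolding exp_add[symmetric] by (simp add: algebra_simps)
    then show ?thesis unfolding G_def by (simp only: mult_ac)
  qed
  have rp: "Re (line_powr (- \<rho>) y) > 0" for y
  proof -
    have "0 < cos (\<rho> * pi / 2) * cmod (line_powr (- \<rho>) y)"
      using cos_pos line_powr_neq_0[of "-\<rho>" y] by simp
    also have "\<dots> \<le> Re (line_powr (- \<rho>) y)"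
      using Re_line_powr_ge[of "-\<rho>" y] \<rho> by simp
    finally show ?thesis .
  qed
  have int: "integrable (lborel \<Otimes>\<^sub>M lborel) (case_prod G)"
  proof (rule Bochner_Integration.integrable_bound[OF integrable_mult_right[OF wright_pair_integrable[OF \<mu> \<delta>'(1)], of "exp 1"]])
    show "case_prod G \<in> borel_measurable (lborel \<Otimes>\<^sub>M lborel)" unfolding G_def by measurable
    show "AE z in lborel \<Otimes>\<^sub>M lborel. norm (case_prod G z) \<le> norm (exp 1 * (case z of (y, v) \<Rightarrow> cmod (line_powr (- (\<delta> + \<rho> * \<mu>)) y) *
       (indicator {0..} v * v powr (\<mu> - 1) * exp (- (v * line_decay \<rho> y)))))"
    proof (intro AE_I2, clarify)
      fix y v :: real
      show "norm (G y v) \<le> norm (exp 1 * (cmod (line_powr (- (\<delta> + \<rho> * \<mu>)) y) *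
       (indicator {0..} v * v powr (\<mu> - 1) * exp (- (v * line_decay \<rho> y)))))"
      proof (cases "v \<ge> 0")
        case True
        have "cmod (exp (- (of_real x * line_powr (- \<rho>) y))) \<le> 1"
          using x rp[of y] by (simp add: norm_exp_eq_Re)
        moreover note norm_exp_line_powr_le[OF True, of y]
        ultimately have "cmod (exp (- (of_real x * line_powr (- \<rho>) y))) * cmod (exp (- (of_real v * line_powr (- \<rho>) y)))
          \<le> 1 * exp (- (v * line_decay \<rho> y))"
          by (intro mult_mono) auto
        from mult_left_mono[OF this, of "exp 1 * cmod (line_powr (- (\<delta> + \<rho> * \<mu>)) y) * (v powr (\<mu> - 1))"] True
        show ?thesis unfolding G_alt
          by (simp add: norm_mult norm_exp_eq_Re[of "Complex 1 y"] mult_ac)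
      qed (simp add: G_def)
    qed
  qed
  have inner_v: "(\<integral>v. G y v \<partial>lborel) = of_real (Gamma \<mu>) * (exp (Complex 1 y) * line_powr (- \<delta>) y * exp (- (of_real x * line_powr (- \<rho>) y)))" for y
  proof -
    have "line_powr (- \<rho>) y powr (- of_real \<mu>) = line_powr (\<rho> * \<mu>) y"
      using line_powr_powr[of "-\<rho>" y "-\<mu>"] \<rho> by simp
    then have 1: "(\<integral>v. of_real (indicator {0..} v * v powr (\<mu> - 1)) * exp (- (of_real v * line_powr (- \<rho>) y)) \<partial>lborel)
      = of_real (Gamma \<mu>) * line_powr (\<rho> * \<mu>) y"
      using Gamma_integral_scaled_complex[OF \<mu> rp, of y] by (simp only: has_bochner_integral_iff)
    have 2: "line_powr (- (\<delta> + \<rho> * \<mu>)) y * line_powr (\<rho> * \<mu>) y = line_powr (- \<delta>) y"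
      by (simp add: line_powr_add)
    show ?thesis unfolding G_alt integral_mult_right_zero 1 2[symmetric] by (simp only: mult_ac)
  qed
  have inner_y: "(\<integral>y. G y v \<partial>lborel) = of_real (2 * pi * (indicator {0..} v * v powr (\<mu> - 1) * wright \<rho> (\<delta> + \<rho> * \<mu>) (x + v)))" for v
    using wright_line_integral[OF \<delta>'(2), of \<rho> "x + v"] \<rho>
    unfolding G_def integral_mult_left_zero has_bochner_integral_iff by (simp add: mult_ac)
  have "(\<integral>v. (\<integral>y. G y v \<partial>lborel) \<partial>lborel) = (\<integral>y. (\<integral>v. G y v \<partial>lborel) \<partial>lborel)"
    by (rule lborel_pair.Fubini_integral[OF int])
  also have "\<dots> = of_real (Gamma \<mu>) * of_real (2 * pi * wright \<rho> \<delta> x)"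
    unfolding inner_v integral_mult_right_zero
    using wright_line_integral[OF \<delta>, of \<rho> x] \<rho> by (simp add: has_bochner_integral_iff)
  finally have "complex_of_real (2 * pi * (\<integral>v. indicator {0..} v * v powr (\<mu> - 1) * wright \<rho> (\<delta> + \<rho> * \<mu>) (x + v) \<partial>lborel))
     = of_real (2 * pi * (Gamma \<mu> * wright \<rho> \<delta> x))"
    unfolding inner_y integral_complex_of_real integral_mult_right_zero by simp
  then show ?thesis unfolding of_real_eq_iff by simp
qed

end

section \<open>Beta integrals and convolution in t\<close>

lemma Beta_integral_scaled:
  fixes \<gamma> \<epsilon> t :: real
  assumes "\<gamma> > 0" "\<epsilon> > 0" "t > 0"
  shows "has_bochner_integral lborel (\<lambda>\<tau>. indicator {0..t} \<tau> * ((t - \<tau>) powr (\<gamma> - 1) * \<tau> powr (\<epsilon> - 1)))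
           (Beta \<epsilon> \<gamma> * t powr (\<gamma> + \<epsilon> - 1))"
proof -
  have B: "Beta \<epsilon> \<gamma> \<ge> 0" using assms by (simp add: Beta_def Gamma_real_nonneg)
  have "has_bochner_integral lborel (\<lambda>\<tau>. indicator {0..1} \<tau> * (\<tau> powr (\<epsilon> - 1) * (1 - \<tau>) powr (\<gamma> - 1))) (Beta \<epsilon> \<gamma>)"
    by (rule has_bochner_integral_nn_integral)
      (use assms B nn_integral_has_integral_lebesgue[OF _ has_integral_Beta_real[of \<epsilon> \<gamma>]] in auto)
  then have "has_bochner_integral lborel
      (\<lambda>v. indicator {0..1} (0 + 1 / t * v) * ((0 + 1 / t * v) powr (\<epsilon> - 1) * (1 - (0 + 1 / t * v)) powr (\<gamma> - 1))) (Beta \<epsilon> \<gamma> /\<^sub>R \<bar>1 / t\<bar>)"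
    by (rule lborel_has_bochner_integral_real_affine_iff[THEN iffD1, rotated]) (use assms in simp)
  then have "has_bochner_integral lborel
      (\<lambda>v. t powr (\<gamma> + \<epsilon> - 2) * (indicator {0..1} (0 + 1 / t * v) * ((0 + 1 / t * v) powr (\<epsilon> - 1) * (1 - (0 + 1 / t * v)) powr (\<gamma> - 1))))
      (t powr (\<gamma> + \<epsilon> - 2) * (Beta \<epsilon> \<gamma> /\<^sub>R \<bar>1 / t\<bar>))"
    by (intro has_bochner_integral_mult_right)
  moreover have "t powr (\<gamma> + \<epsilon> - 2) * (Beta \<epsilon> \<gamma> /\<^sub>R \<bar>1 / t\<bar>) = Beta \<epsilon> \<gamma> * t powr (\<gamma> + \<epsilon> - 1)"
  proof -
    have "t powr (\<gamma> + \<epsilon> - 2) * t = t powr (\<gamma> + \<epsilon> - 1)"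
      using assms powr_mult_base[of t "\<gamma> + \<epsilon> - 2"] by (simp add: mult.commute)
    then show ?thesis using assms by simp
  qed
  moreover have "t powr (\<gamma> + \<epsilon> - 2) * (indicator {0..1} (0 + 1 / t * v) * ((0 + 1 / t * v) powr (\<epsilon> - 1) * (1 - (0 + 1 / t * v)) powr (\<gamma> - 1)))
      = indicator {0..t} v * ((t - v) powr (\<gamma> - 1) * v powr (\<epsilon> - 1))" for v
  proof (cases "v \<in> {0..t}")
    case True
    have "(v / t) powr (\<epsilon> - 1) = v powr (\<epsilon> - 1) / t powr (\<epsilon> - 1)"
      using True assms by (simp add: powr_divide)
    moreover have "(1 - v / t) powr (\<gamma> - 1) = (t - v) powr (\<gamma> - 1) / t powr (\<gamma> - 1)"
    proof -
      have "1 - v / t = (t - v) / t" using assms by (simp add: field_simps)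
      then show ?thesis using True assms by (simp add: powr_divide)
    qed
    moreover have "t powr (\<gamma> + \<epsilon> - 2) = t powr (\<gamma> - 1) * t powr (\<epsilon> - 1)"
      by (simp add: powr_add[symmetric] algebra_simps)
    moreover have "indicator {0..1} (v / t) = (1::real)" using True assms by simp
    ultimately show ?thesis using True assms by simp
  next
    case False
    then have "\<not> (0 \<le> v / t \<and> v / t \<le> 1)" using assms by (auto simp: field_simps)
    with False show ?thesis by (auto simp: indicator_def)
  qed
  ultimately show ?thesis by (simp only:)
qed

text \<open>In the n-th term the Beta integral replaces Gamma (\<delta> + \<rho> n) by Gamma
  (\<delta> + \<gamma> + \<rho> n), so the series of exponent \<delta> becomes the one of exponent
  \<delta> + \<gamma>.\<close>

lemma wright_convolution:
  assumes \<gamma>: "\<gamma> > 0" and \<delta>: "\<delta> > 1" and \<rho>: "\<rho> > 0" and t: "t > 0"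
  shows "has_bochner_integral lborel
    (\<lambda>\<tau>. indicator {0..t} \<tau> * ((t - \<tau>) powr (\<gamma> - 1) / Gamma \<gamma> * (\<tau> powr (\<delta> - 1) * wright \<rho> \<delta> (s * \<tau> powr \<rho>))))
    (t powr (\<delta> + \<gamma> - 1) * wright \<rho> (\<delta> + \<gamma>) (s * t powr \<rho>))"
proof -
  define e where "e = (\<lambda>n. \<delta> + \<rho> * real n)"
  have e: "e n > 0" for n unfolding e_def using \<delta> \<rho> by (simp add: add_pos_nonneg)
  define b where "b = (\<lambda>n \<tau>. indicator {0..t} \<tau> * ((t - \<tau>) powr (\<gamma> - 1) * \<tau> powr (e n - 1)))"
  have b_nonneg: "b n \<tau> \<ge> 0" for n \<tau> unfolding b_def by simp
  have b: "has_bochner_integral lborel (b n) (Beta (e n) \<gamma> * t powr (\<gamma> + e n - 1))" for n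
    unfolding b_def by (rule Beta_integral_scaled[OF \<gamma> e t])
  define f where "f = (\<lambda>n \<tau>. b n \<tau> * ((- s) ^ n / (fact n * Gamma \<gamma> * Gamma (e n))))"
  have fsum: "(\<lambda>n. f n \<tau>) sums (indicator {0..t} \<tau> * ((t - \<tau>) powr (\<gamma> - 1) / Gamma \<gamma> * (\<tau> powr (\<delta> - 1) * wright \<rho> \<delta> (s * \<tau> powr \<rho>))))"
    and fnorm: "summable (\<lambda>n. norm (f n \<tau>))" for \<tau>
  proof -
    define A where "A = indicator {0..t} \<tau> * ((t - \<tau>) powr (\<gamma> - 1) / Gamma \<gamma> * \<tau> powr (\<delta> - 1))"
    have f_alt: "f n \<tau> = A * ((- (s * \<tau> powr \<rho>)) ^ n / (fact n * Gamma (\<delta> + \<rho> * real n)))" for n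
    proof (cases "\<tau> > 0")
      case True
      have "\<tau> powr (e n - 1) = \<tau> powr (\<delta> - 1) * (\<tau> powr \<rho>) ^ n"
        using True by (simp add: e_def powr_power powr_add[symmetric] algebra_simps)
      moreover have "(- (s * \<tau> powr \<rho>)) ^ n = (- s) ^ n * (\<tau> powr \<rho>) ^ n"
        by (simp flip: power_mult_distrib)
      ultimately show ?thesis by (simp add: f_def b_def A_def e_def mult_ac)
    qed (auto simp: f_def b_def A_def indicator_def)
    have "(\<lambda>n. f n \<tau>) sums (A * wright \<rho> \<delta> (s * \<tau> powr \<rho>))"
      unfolding f_alt by (intro sums_mult wright_sums \<delta>) (use \<rho> in simp)
    then show "(\<lambda>n. f n \<tau>) sums (indicator {0..t} \<tau> * ((t - \<tau>) powr (\<gamma> - 1) / Gamma \<gamma> * (\<tau> powr (\<delta> - 1) * wright \<rho> \<delta> (s * \<tau> powr \<rho>))))"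
      unfolding A_def by (simp only: mult.assoc)
    have "norm (f n \<tau>) = \<bar>A\<bar> * (\<bar>s * \<tau> powr \<rho>\<bar> ^ n / (fact n * Gamma (\<delta> + \<rho> * real n)))" for n
      unfolding f_alt real_norm_def abs_divide abs_mult[of A] abs_mult[of "fact n"] power_abs
      using Gamma_real_nonneg[OF e[of n]] by (simp add: e_def)
    then show "summable (\<lambda>n. norm (f n \<tau>))"
      using wright_summable[OF \<delta>, of \<rho> "s * \<tau> powr \<rho>"] \<rho> by (simp only:) (intro summable_mult, simp)
  qed
  have G: "Gamma \<gamma> > 0" "Gamma (e n) > 0" "Gamma (e n + \<gamma>) > 0" for n
    using Gamma_real_pos[OF \<gamma>] Gamma_real_pos[OF e] Gamma_real_pos[OF add_pos_pos[OF e \<gamma>]] by auto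
  \<comment> \<open>Stated for every r: r = - s evaluates the terms, r = |s| their norms.\<close>
  have Ival: "Beta (e n) \<gamma> * t powr (\<gamma> + e n - 1) * (r ^ n / (fact n * Gamma \<gamma> * Gamma (e n)))
     = t powr (\<delta> + \<gamma> - 1) * ((r * t powr \<rho>) ^ n / (fact n * Gamma (\<delta> + \<gamma> + \<rho> * real n)))" for n r
  proof -
    have "t powr (\<gamma> + e n - 1) = t powr (\<delta> + \<gamma> - 1) * (t powr \<rho>) ^ n"
      using t by (simp add: e_def powr_power powr_add[symmetric] algebra_simps)
    moreover have "e n + \<gamma> = \<delta> + \<gamma> + \<rho> * real n" by (simp add: e_def)
    ultimately show ?thesis
      using G(1) G(2)[of n] G(3)[of n] by (simp add: Beta_def power_mult_distrib add_ac mult_ac)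
  qed
  have fi: "has_bochner_integral lborel (f n) (t powr (\<delta> + \<gamma> - 1) * ((- (s * t powr \<rho>)) ^ n / (fact n * Gamma (\<delta> + \<gamma> + \<rho> * real n))))" for n
  proof -
    have "has_bochner_integral lborel (f n) (Beta (e n) \<gamma> * t powr (\<gamma> + e n - 1) * ((- s) ^ n / (fact n * Gamma \<gamma> * Gamma (e n))))"
      unfolding f_def by (intro has_bochner_integral_mult_left b)
    then show ?thesis unfolding Ival by simp
  qed
  have si: "summable (\<lambda>n. \<integral>\<tau>. norm (f n \<tau>) \<partial>lborel)"
  proof -
    have "(\<integral>\<tau>. norm (f n \<tau>) \<partial>lborel) = t powr (\<delta> + \<gamma> - 1) * (\<bar>s * t powr \<rho>\<bar> ^ n / (fact n * Gamma (\<delta> + \<gamma> + \<rho> * real n)))" for n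
    proof -
      have "norm (f n \<tau>) = b n \<tau> * (\<bar>s\<bar> ^ n / (fact n * Gamma \<gamma> * Gamma (e n)))" for \<tau>
        unfolding f_def real_norm_def abs_divide abs_mult power_abs
        using G(1) G(2)[of n] b_nonneg[of n \<tau>] by simp
      then have "(\<integral>\<tau>. norm (f n \<tau>) \<partial>lborel) = Beta (e n) \<gamma> * t powr (\<gamma> + e n - 1) * (\<bar>s\<bar> ^ n / (fact n * Gamma \<gamma> * Gamma (e n)))"
        using b[of n] by (simp add: has_bochner_integral_iff)
      then show ?thesis unfolding Ival by (simp add: abs_mult)
    qed
    then show ?thesis
      using wright_summable[of "\<delta> + \<gamma>" \<rho> "s * t powr \<rho>"] \<rho> \<delta> \<gamma> by (simp only:) (intro summable_mult, simp)
  qed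
  have "(\<lambda>n. integral\<^sup>L lborel (f n)) sums (\<integral>\<tau>. (\<Sum>n. f n \<tau>) \<partial>lborel)"
    by (rule sums_integral) (use fi fnorm si in \<open>auto simp: has_bochner_integral_iff\<close>)
  moreover have "(\<lambda>n. integral\<^sup>L lborel (f n)) sums (t powr (\<delta> + \<gamma> - 1) * wright \<rho> (\<delta> + \<gamma>) (s * t powr \<rho>))"
  proof -
    have "integral\<^sup>L lborel (f n) = t powr (\<delta> + \<gamma> - 1) * ((- (s * t powr \<rho>)) ^ n / (fact n * Gamma (\<delta> + \<gamma> + \<rho> * real n)))" for n
      using fi[of n] by (simp only: has_bochner_integral_iff)
    then show ?thesis using \<delta> \<gamma> \<rho> by (simp only:) (intro sums_mult wright_sums, auto)
  qed
  ultimately have "(\<integral>\<tau>. (\<Sum>n. f n \<tau>) \<partial>lborel) = t powr (\<delta> + \<gamma> - 1) * wright \<rho> (\<delta> + \<gamma>) (s * t powr \<rho>)"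
    by (rule sums_unique2)
  moreover have "integrable lborel (\<lambda>\<tau>. \<Sum>n. f n \<tau>)"
    by (rule integrable_suminf) (use fi fnorm si in \<open>auto simp: has_bochner_integral_iff\<close>)
  moreover have "(\<Sum>n. f n \<tau>) = indicator {0..t} \<tau> * ((t - \<tau>) powr (\<gamma> - 1) / Gamma \<gamma> * (\<tau> powr (\<delta> - 1) * wright \<rho> \<delta> (s * \<tau> powr \<rho>)))" for \<tau>
    using fsum[of \<tau>] by (simp only: sums_iff)
  ultimately show ?thesis by (simp only: has_bochner_integral_iff)
qed

text \<open>As a function of \<open>t\<close>, the kernel is the inverse Laplace transform of
  \<open>\<lambda> \<mapsto> \<lambda> powr - \<delta> * exp (- s * \<lambda> powr - \<rho>)\<close>.\<close>

definition wright_kernel :: "real \<Rightarrow> real \<Rightarrow> real \<Rightarrow> real \<Rightarrow> real" where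
  "wright_kernel \<rho> \<delta> t s = indicator {0<..} s * (t powr (\<delta> - 1) * wright \<rho> \<delta> (s * t powr \<rho>))"

definition wright_moment :: "real \<Rightarrow> real \<Rightarrow> real \<Rightarrow> real" where
  "wright_moment \<rho> \<delta> c = (\<integral>v. indicator {0<..} v * v powr c * \<bar>wright \<rho> \<delta> v\<bar> \<partial>lborel)"

lemma borel_measurable_wright_kernel[measurable]:
  assumes "\<delta> > 1" "\<rho> \<ge> 0"
  shows "(\<lambda>(t, s). wright_kernel \<rho> \<delta> t s) \<in> borel_measurable (borel \<Otimes>\<^sub>M borel)"
proof -
  note borel_measurable_wright[OF assms, measurable]
  show ?thesis unfolding wright_kernel_def by measurable
qed

lemma borel_measurable_wright_kernel_snd[measurable]:
  assumes "\<delta> > 1" "\<rho> \<ge> 0"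
  shows "wright_kernel \<rho> \<delta> t \<in> borel_measurable borel"
proof -
  note borel_measurable_wright[OF assms, measurable]
  show ?thesis unfolding wright_kernel_def[abs_def] by measurable
qed

text \<open>\<open>0 powr _\<close> is 0 by definition, which for \<delta> > 1 is also the limit as
  t tends to 0.\<close>

lemma wright_kernel_0: "wright_kernel \<rho> \<delta> 0 s = 0"
  by (simp add: wright_kernel_def)

lemma wright_moment_nonneg: "wright_moment \<rho> \<delta> c \<ge> 0"
  unfolding wright_moment_def by simp

context
  fixes \<rho> :: real
  assumes \<rho>: "0 < \<rho>" "\<rho> < 1"
begin

lemma moment_bound_gt_1:
  assumes "c > -1" "\<delta> > 1 + \<rho> * (c + 1)"
  shows "\<delta> > 1"
proof -
  have "\<rho> * (c + 1) > 0" using assms \<rho> by simp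
  with assms show ?thesis by linarith
qed

text \<open>The majorant weighted with v powr (\<mu> - 1) for \<mu> = c + 1 is integrable under
  exactly these hypotheses.\<close>

lemma has_integral_wright_moment:
  assumes c: "c > -1" and \<delta>: "\<delta> > 1 + \<rho> * (c + 1)"
  shows "has_bochner_integral lborel (\<lambda>v. indicator {0<..} v * v powr c * \<bar>wright \<rho> \<delta> v\<bar>) (wright_moment \<rho> \<delta> c)"
proof -
  note \<delta>1 = moment_bound_gt_1[OF assms]
  have [measurable]: "wright \<rho> \<delta> \<in> borel_measurable borel" using borel_measurable_wright \<delta>1 \<rho> by simp
  have "integrable lborel (\<lambda>v. indicator {0<..} v * v powr c * \<bar>wright \<rho> \<delta> v\<bar>)"
  proof (rule Bochner_Integration.integrable_bound)
    show "integrable lborel (\<lambda>v. indicator {0..} v * v powr (c + 1 - 1) * wright_major \<rho> \<delta> v)"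
      by (rule integrable_wright_major[OF \<rho>]) (use c \<delta> in auto)
    show "AE v in lborel. norm (indicator {0<..} v * v powr c * \<bar>wright \<rho> \<delta> v\<bar>) \<le> norm (indicator {0..} v * v powr (c + 1 - 1) * wright_major \<rho> \<delta> v)"
    proof (rule AE_I2)
      fix v :: real
      show "norm (indicator {0<..} v * v powr c * \<bar>wright \<rho> \<delta> v\<bar>) \<le> norm (indicator {0..} v * v powr (c + 1 - 1) * wright_major \<rho> \<delta> v)"
        using wright_le_major[OF \<rho> \<delta>1, of v] wright_major_nonneg[OF \<rho>, of \<delta> v]
        by (cases "v > 0") (auto simp: abs_mult intro!: mult_left_mono)
    qed
  qed measurable
  then show ?thesis unfolding wright_moment_def by (rule has_bochner_integral_integrable)
qed

text \<open>The substitution v = s t powr \<rho> reduces to t = 1. The exponent collects \<delta> -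
  1 from the prefactor, - \<rho> c from the weight and - \<rho> from the Jacobian.\<close>

lemma wright_kernel_moment:
  assumes c: "c > -1" and \<delta>: "\<delta> > 1 + \<rho> * (c + 1)" and t: "t > 0"
  shows "has_bochner_integral lborel (\<lambda>s. \<bar>wright_kernel \<rho> \<delta> t s\<bar> * s powr c)
           (t powr (\<delta> - 1 - \<rho> * (c + 1)) * wright_moment \<rho> \<delta> c)"
proof -
  define q where "q = t powr \<rho>"
  have q: "q > 0" using t by (simp add: q_def)
  have "has_bochner_integral lborel
     (\<lambda>s. indicator {0<..} (0 + q * s) * (0 + q * s) powr c * \<bar>wright \<rho> \<delta> (0 + q * s)\<bar>) (wright_moment \<rho> \<delta> c /\<^sub>R \<bar>q\<bar>)"
    by (rule lborel_has_bochner_integral_real_affine_iff[THEN iffD1, OF _ has_integral_wright_moment[OF c \<delta>]]) (use q in simp)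
  then have "has_bochner_integral lborel
     (\<lambda>s. t powr (\<delta> - 1 - \<rho> * c) * (indicator {0<..} (0 + q * s) * (0 + q * s) powr c * \<bar>wright \<rho> \<delta> (0 + q * s)\<bar>))
     (t powr (\<delta> - 1 - \<rho> * c) * (wright_moment \<rho> \<delta> c /\<^sub>R \<bar>q\<bar>))"
    by (intro has_bochner_integral_mult_right)
  moreover have "t powr (\<delta> - 1 - \<rho> * c) * (wright_moment \<rho> \<delta> c /\<^sub>R \<bar>q\<bar>) = t powr (\<delta> - 1 - \<rho> * (c + 1)) * wright_moment \<rho> \<delta> c"
  proof -
    have "t powr (\<delta> - 1 - \<rho> * (c + 1)) = t powr (\<delta> - 1 - \<rho> * c - \<rho>)" by (simp add: algebra_simps)
    also have "\<dots> = t powr (\<delta> - 1 - \<rho> * c) / q" by (simp add: powr_diff q_def)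
    finally show ?thesis using q by (simp add: field_simps)
  qed
  moreover have "t powr (\<delta> - 1 - \<rho> * c) * (indicator {0<..} (0 + q * s) * (0 + q * s) powr c * \<bar>wright \<rho> \<delta> (0 + q * s)\<bar>)
     = \<bar>wright_kernel \<rho> \<delta> t s\<bar> * s powr c" for s
  proof (cases "s > 0")
    case True
    have "(q * s) powr c = t powr (\<rho> * c) * s powr c"
      using True q by (simp add: powr_mult q_def powr_powr)
    moreover have "t powr (\<delta> - 1 - \<rho> * c) * t powr (\<rho> * c) = t powr (\<delta> - 1)"
      by (simp add: powr_add[symmetric])
    ultimately have "t powr (\<delta> - 1 - \<rho> * c) * (q * s) powr c = t powr (\<delta> - 1) * s powr c"
      by (metis mult.assoc)
    then show ?thesis using True q
      by (simp add: wright_kernel_def abs_mult q_def[symmetric] mult.commute[of s q] mult_ac)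
  next
    case False
    then have "\<not> 0 < q * s" using q by (simp add: zero_less_mult_iff)
    with False show ?thesis by (simp add: wright_kernel_def)
  qed
  ultimately show ?thesis by (simp only:)
qed

lemma wright_kernel_moment_integrable:
  assumes c: "c > -1" and \<delta>: "\<delta> > 1 + \<rho> * (c + 1)" and t: "t \<ge> 0"
  shows "integrable lborel (\<lambda>s. \<bar>wright_kernel \<rho> \<delta> t s\<bar> * s powr c)"
  using wright_kernel_moment[OF c \<delta>, of t] t
  by (cases "t = 0") (auto simp: wright_kernel_0 has_bochner_integral_iff)

lemma wright_kernel_locally_integrable:
  assumes \<delta>: "\<delta> > 1"
  shows "integrable lborel (\<lambda>s. indicator {..real n} s * wright_kernel \<rho> \<delta> t s)"
proof -
  have c: "continuous_on {0..real n} (\<lambda>s. t powr (\<delta> - 1) * wright \<rho> \<delta> (s * t powr \<rho>))"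
    by (intro continuous_intros continuous_on_compose2[OF continuous_on_wright[OF \<delta>]]) (use \<rho> in auto)
  have "integrable lborel (\<lambda>s. indicator {0..real n} s *\<^sub>R (t powr (\<delta> - 1) * wright \<rho> \<delta> (s * t powr \<rho>)))"
    by (rule borel_integrable_compact[OF _ c]) simp
  then have "integrable lborel (\<lambda>s. indicator {0<..} s *\<^sub>R (indicator {0..real n} s *\<^sub>R (t powr (\<delta> - 1) * wright \<rho> \<delta> (s * t powr \<rho>))))"
    by (rule integrable_mult_indicator[rotated]) simp
  moreover have "indicator {0<..} s *\<^sub>R (indicator {0..real n} s *\<^sub>R (t powr (\<delta> - 1) * wright \<rho> \<delta> (s * t powr \<rho>)))
     = indicator {..real n} s * wright_kernel \<rho> \<delta> t s" for s
    by (auto simp: wright_kernel_def indicator_def)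
  ultimately show ?thesis by (simp only:)
qed

text \<open>At t = 0 the kernel vanishes and its moment is a positive power of \<open>X n\<close>;
  for t > 0 dominated convergence applies. Strong continuity of the new family rests on
  this.\<close>

lemma wright_kernel_L1_continuous:
  assumes c: "c > -1" and \<delta>: "\<delta> > 1 + \<rho> * (c + 1)" and t: "t \<ge> 0"
    and X: "\<And>n. X n \<ge> 0" "X \<longlonglongrightarrow> t"
  shows "(\<lambda>n. \<integral>s. \<bar>wright_kernel \<rho> \<delta> (X n) s - wright_kernel \<rho> \<delta> t s\<bar> * s powr c \<partial>lborel) \<longlonglongrightarrow> 0"
proof (cases "t = 0")
  case True
  define e where "e = \<delta> - 1 - \<rho> * (c + 1)"
  have e: "e > 0" using \<delta> by (simp add: e_def)
  have "(\<integral>s. \<bar>wright_kernel \<rho> \<delta> (X n) s\<bar> * s powr c \<partial>lborel) = X n powr e * wright_moment \<rho> \<delta> c" for n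
    using wright_kernel_moment[OF c \<delta>, of "X n"] X(1)[of n]
    by (cases "X n = 0") (auto simp: wright_kernel_0 has_bochner_integral_iff e_def)
  moreover have "(\<lambda>n. X n powr e * wright_moment \<rho> \<delta> c) \<longlonglongrightarrow> 0 powr e * wright_moment \<rho> \<delta> c"
    by (intro tendsto_mult tendsto_const tendsto_powr') (use X True e in auto)
  ultimately show ?thesis using True by (simp add: wright_kernel_0)
next
  case False
  with t have t: "t > 0" by simp
  note \<delta>1 = moment_bound_gt_1[OF c \<delta>]
  have [measurable]: "wright_kernel \<rho> \<delta> t' \<in> borel_measurable borel" for t'
    using borel_measurable_wright_kernel_snd \<delta>1 \<rho> by simp
  \<comment> \<open>The smallest scaling factor x powr \<rho> for x in [t/2, 2t]; monotonicity of
    the majorant makes it the worst case.\<close>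
  define q where "q = (t / 2) powr \<rho>"
  have q: "q > 0" using t by (simp add: q_def)
  \<comment> \<open>Twice a bound valid for all x in [t/2, 2t], because two kernels are subtracted.
    (2 t) powr (\<delta> - 1) bounds the prefactor, and q powr (- c) restores the weight s powr
    c.\<close>
  define w where "w = (\<lambda>s. 2 * (2 * t) powr (\<delta> - 1) * q powr (- c) * (indicator {0..} (0 + q * s) * (0 + q * s) powr (c + 1 - 1) * wright_major \<rho> \<delta> (0 + q * s)))"
  have "integrable lborel (\<lambda>v. indicator {0..} v * v powr (c + 1 - 1) * wright_major \<rho> \<delta> v)"
    by (rule integrable_wright_major[OF \<rho>]) (use c \<delta> in auto)
  then have w: "integrable lborel w" unfolding w_def
    by (intro integrable_mult_right lborel_integrable_real_affine[where f = "\<lambda>v. indicator {0..} v * v powr (c + 1 - 1) * wright_major \<rho> \<delta> v"])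
      (use q in auto)
  have bound: "\<bar>wright_kernel \<rho> \<delta> x s\<bar> * s powr c \<le> w s / 2" if "t / 2 \<le> x" "x \<le> 2 * t" for x s
  proof (cases "s > 0")
    case True
    have "q \<le> x powr \<rho>" unfolding q_def using that t \<rho> by (intro powr_mono2) auto
    then have "s * q \<le> s * x powr \<rho>" using True by (intro mult_left_mono) auto
    then have "wright_major \<rho> \<delta> (s * x powr \<rho>) \<le> wright_major \<rho> \<delta> (q * s)"
      using True q by (intro wright_major_antimono[OF \<rho> \<delta>1]) (auto simp: mult.commute)
    then have 1: "\<bar>wright \<rho> \<delta> (s * x powr \<rho>)\<bar> \<le> wright_major \<rho> \<delta> (q * s)"
      using wright_le_major[OF \<rho> \<delta>1, of "s * x powr \<rho>"] True by simp
    have 2: "x powr (\<delta> - 1) \<le> (2 * t) powr (\<delta> - 1)"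
      using that t \<delta>1 by (intro powr_mono2) auto
    have "\<bar>wright_kernel \<rho> \<delta> x s\<bar> * s powr c = x powr (\<delta> - 1) * \<bar>wright \<rho> \<delta> (s * x powr \<rho>)\<bar> * s powr c"
      using True by (simp add: wright_kernel_def abs_mult)
    also have "\<dots> \<le> (2 * t) powr (\<delta> - 1) * wright_major \<rho> \<delta> (q * s) * s powr c"
      by (intro mult_right_mono mult_mono 1 2) auto
    also have "\<dots> = (2 * t) powr (\<delta> - 1) * wright_major \<rho> \<delta> (q * s) * (q powr (- c) * (q * s) powr c)"
      using q True by (simp add: powr_mult powr_minus)
    also have "\<dots> = w s / 2"
      using True q by (simp add: w_def)
    finally show ?thesis .
  next
    case False
    then show ?thesis using wright_major_nonneg[OF \<rho>, of \<delta> "q * s"] by (simp add: wright_kernel_def w_def)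
  qed
  have "\<forall>\<^sub>F n in sequentially. t / 2 < X n" "\<forall>\<^sub>F n in sequentially. X n < 2 * t"
    by (rule order_tendstoD(1)[OF X(2)], use t in simp) (rule order_tendstoD(2)[OF X(2)], use t in simp)
  then have "\<forall>\<^sub>F n in sequentially. t / 2 < X n \<and> X n < 2 * t" by (rule eventually_conj)
  then obtain N where N: "\<And>n. n \<ge> N \<Longrightarrow> t / 2 < X n \<and> X n < 2 * t" unfolding eventually_sequentially by blast
  have "(\<lambda>n. \<integral>s. \<bar>wright_kernel \<rho> \<delta> (X (n + N)) s - wright_kernel \<rho> \<delta> t s\<bar> * s powr c \<partial>lborel) \<longlonglongrightarrow> (\<integral>s. 0 \<partial>(lborel :: real measure))"
  proof (rule integral_dominated_convergence[where w = w])
    show "AE s in lborel. (\<lambda>n. \<bar>wright_kernel \<rho> \<delta> (X (n + N)) s - wright_kernel \<rho> \<delta> t s\<bar> * s powr c) \<longlonglongrightarrow> 0"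
    proof (rule AE_I2)
      fix s :: real
      have XN: "(\<lambda>n. X (n + N)) \<longlonglongrightarrow> t" using X(2) by (rule LIMSEQ_ignore_initial_segment)
      have "(\<lambda>n. wright \<rho> \<delta> (s * X (n + N) powr \<rho>)) \<longlonglongrightarrow> wright \<rho> \<delta> (s * t powr \<rho>)"
        by (rule continuous_on_tendsto_compose[OF continuous_on_wright[OF \<delta>1]])
          (use \<rho> t XN in \<open>auto intro!: tendsto_intros\<close>)
      then have "(\<lambda>n. \<bar>wright_kernel \<rho> \<delta> (X (n + N)) s - wright_kernel \<rho> \<delta> t s\<bar> * s powr c) \<longlonglongrightarrow> \<bar>wright_kernel \<rho> \<delta> t s - wright_kernel \<rho> \<delta> t s\<bar> * s powr c"
        unfolding wright_kernel_def by (intro tendsto_intros XN) (use t in auto)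
      then show "(\<lambda>n. \<bar>wright_kernel \<rho> \<delta> (X (n + N)) s - wright_kernel \<rho> \<delta> t s\<bar> * s powr c) \<longlonglongrightarrow> 0" by simp
    qed
    show "AE s in lborel. norm (\<bar>wright_kernel \<rho> \<delta> (X (n + N)) s - wright_kernel \<rho> \<delta> t s\<bar> * s powr c) \<le> w s" for n
    proof (rule AE_I2)
      fix s :: real
      have "\<bar>wright_kernel \<rho> \<delta> (X (n + N)) s - wright_kernel \<rho> \<delta> t s\<bar> * s powr c
        \<le> (\<bar>wright_kernel \<rho> \<delta> (X (n + N)) s\<bar> + \<bar>wright_kernel \<rho> \<delta> t s\<bar>) * s powr c"
        by (intro mult_right_mono) auto
      also have "\<dots> \<le> w s / 2 + w s / 2"
        unfolding distrib_right using N[of "n + N"] t by (intro add_mono bound) auto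
      finally show "norm (\<bar>wright_kernel \<rho> \<delta> (X (n + N)) s - wright_kernel \<rho> \<delta> t s\<bar> * s powr c) \<le> w s" by simp
    qed
  qed (use w in auto)
  then have "(\<lambda>n. \<integral>s. \<bar>wright_kernel \<rho> \<delta> (X (n + N)) s - wright_kernel \<rho> \<delta> t s\<bar> * s powr c \<partial>lborel) \<longlonglongrightarrow> 0" by simp
  then show ?thesis by (rule LIMSEQ_offset)
qed

text \<open>The substitution s = r + t powr (- \<rho>) v reduces to
  \<open>wright_Weyl_integral\<close>; the powers of t combine to \<delta> - 1.\<close>

lemma wright_kernel_Weyl:
  assumes \<mu>: "\<mu> > 0" and \<delta>: "\<delta> > 1" and r: "r \<ge> 0" and t: "t > 0"
  shows "(\<integral>s. indicator {r..} s * (s - r) powr (\<mu> - 1) * wright_kernel \<rho> (\<delta> + \<rho> * \<mu>) t s \<partial>lborel)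
    = Gamma \<mu> * (t powr (\<delta> - 1) * wright \<rho> \<delta> (r * t powr \<rho>))"
proof -
  define q where "q = t powr (- \<rho>)"
  have q: "q > 0" using t by (simp add: q_def)
  have qt: "q * t powr \<rho> = 1" using t by (simp add: q_def powr_minus)
  have "(\<integral>s. indicator {r..} s * (s - r) powr (\<mu> - 1) * wright_kernel \<rho> (\<delta> + \<rho> * \<mu>) t s \<partial>lborel)
    = \<bar>q\<bar> *\<^sub>R (\<integral>v. indicator {r..} (r + q * v) * (r + q * v - r) powr (\<mu> - 1) * wright_kernel \<rho> (\<delta> + \<rho> * \<mu>) t (r + q * v) \<partial>lborel)"
    by (rule lborel_integral_real_affine) (use q in simp)
  also have "\<dots> = q * (\<integral>v. (q powr (\<mu> - 1) * t powr (\<delta> + \<rho> * \<mu> - 1)) * (indicator {0..} v * v powr (\<mu> - 1) * wright \<rho> (\<delta> + \<rho> * \<mu>) (r * t powr \<rho> + v)) \<partial>lborel)"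
  proof -
    have "indicator {r..} (r + q * v) * (r + q * v - r) powr (\<mu> - 1) * wright_kernel \<rho> (\<delta> + \<rho> * \<mu>) t (r + q * v)
      = (q powr (\<mu> - 1) * t powr (\<delta> + \<rho> * \<mu> - 1)) * (indicator {0..} v * v powr (\<mu> - 1) * wright \<rho> (\<delta> + \<rho> * \<mu>) (r * t powr \<rho> + v))" for v
    proof (cases "v > 0")
      case True
      have "(r + q * v) * t powr \<rho> = r * t powr \<rho> + v"
        using qt by (simp add: algebra_simps flip: mult.assoc)
      moreover have "r + q * v > 0" using True q r by (intro add_nonneg_pos) auto
      ultimately show ?thesis
        using True q by (simp add: wright_kernel_def powr_mult mult_ac)
    next
      case False
      then have "v = 0 \<or> \<not> 0 \<le> q * v" using q by (auto simp: zero_le_mult_iff)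
      with False show ?thesis by (auto simp: indicator_def)
    qed
    then show ?thesis using q by simp
  qed
  also have "\<dots> = q * (q powr (\<mu> - 1) * t powr (\<delta> + \<rho> * \<mu> - 1)) * (Gamma \<mu> * wright \<rho> \<delta> (r * t powr \<rho>))"
    using wright_Weyl_integral[OF \<rho> \<mu> \<delta>, of "r * t powr \<rho>"] r by simp
  also have "q * (q powr (\<mu> - 1) * t powr (\<delta> + \<rho> * \<mu> - 1)) = t powr (\<delta> - 1)"
  proof -
    have "q * q powr (\<mu> - 1) = q powr \<mu>" using powr_mult_base[of q "\<mu> - 1"] q by simp
    then have "q * (q powr (\<mu> - 1) * t powr (\<delta> + \<rho> * \<mu> - 1)) = q powr \<mu> * t powr (\<delta> + \<rho> * \<mu> - 1)"
      by (simp only: mult.assoc[symmetric])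
    also have "\<dots> = t powr (\<delta> - 1)"
      by (simp add: q_def powr_powr powr_add[symmetric] algebra_simps)
    finally show ?thesis .
  qed
  finally show ?thesis by (simp only: mult_ac)
qed

text \<open>Fubini, with \<open>wright_convolution\<close> as the inner integral. The growth bound
  on u turns the integral over s into kernel moments, which stay bounded for \<tau> in (0,
  t].\<close>

lemma wright_kernel_convolution:
  fixes u :: "real \<Rightarrow> complex"
  assumes a: "-1 < a" "a \<le> b" and \<delta>: "\<delta> > 1 + \<rho> * (b + 1)" and \<gamma>: "\<gamma> > 0" and t: "t > 0"
    and [measurable]: "u \<in> borel_measurable borel"
    and u: "\<And>s. s > 0 \<Longrightarrow> cmod (u s) \<le> M * (s powr a + s powr b)"
  shows "(\<integral>\<tau>. of_real (indicator {0..t} \<tau> * ((t - \<tau>) powr (\<gamma> - 1) / Gamma \<gamma>)) * (\<integral>s. of_real (wright_kernel \<rho> \<delta> \<tau> s) * u s \<partial>lborel) \<partial>lborel)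
    = (\<integral>s. of_real (wright_kernel \<rho> (\<delta> + \<gamma>) t s) * u s \<partial>lborel)"
proof -
  have b: "b > -1" using a by simp
  have \<delta>a: "\<delta> > 1 + \<rho> * (a + 1)"
    using \<delta> mult_left_mono[of "a + 1" "b + 1" \<rho>] a \<rho> by linarith
  note \<delta>1 = moment_bound_gt_1[OF b \<delta>]
  have M: "M \<ge> 0" using order_trans[OF norm_ge_zero u[of 1]] by simp
  define g where "g = (\<lambda>\<tau>. indicator {0..t} \<tau> * ((t - \<tau>) powr (\<gamma> - 1) / Gamma \<gamma>))"
  have g_nonneg: "g \<tau> \<ge> 0" for \<tau> using Gamma_real_pos[OF \<gamma>] by (simp add: g_def)
  have g_int: "integrable lborel g"
  proof -
    have "integrable lborel (\<lambda>\<tau>. indicator {0..t} \<tau> * ((t - \<tau>) powr (\<gamma> - 1) * \<tau> powr (1 - 1)) / Gamma \<gamma>)"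
      using Beta_integral_scaled[OF \<gamma> zero_less_one t] by (simp add: has_bochner_integral_iff)
    then show ?thesis
    proof (rule integrable_cong_AE_imp)
      show "g \<in> borel_measurable lborel" unfolding g_def by measurable
      \<comment> \<open>\<open>\<tau> powr (1 - 1)\<close> is 1 except at \<tau> = 0, where it is
        0.\<close>
      show "AE \<tau> in lborel. indicator {0..t} \<tau> * ((t - \<tau>) powr (\<gamma> - 1) * \<tau> powr (1 - 1)) / Gamma \<gamma> = g \<tau>"
        using AE_lborel_singleton[of 0] by eventually_elim (auto simp: g_def)
    qed
  qed
  have [measurable]: "(\<lambda>(t, s). wright_kernel \<rho> \<delta> t s) \<in> borel_measurable (borel \<Otimes>\<^sub>M borel)"
    using borel_measurable_wright_kernel \<delta>1 \<rho> by simp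
  have [measurable]: "wright_kernel \<rho> \<delta> t' \<in> borel_measurable borel" for t'
    using borel_measurable_wright_kernel_snd \<delta>1 \<rho> by simp
  define f where "f = (\<lambda>\<tau> s. of_real (g \<tau>) * (of_real (wright_kernel \<rho> \<delta> \<tau> s) * u s))"
  have [measurable]: "g \<in> borel_measurable borel" unfolding g_def by measurable
  have f_meas[measurable]: "case_prod f \<in> borel_measurable (lborel \<Otimes>\<^sub>M lborel)"
    unfolding f_def by measurable
  define D where "D = (\<lambda>\<tau> s. M * (\<bar>wright_kernel \<rho> \<delta> \<tau> s\<bar> * s powr a + \<bar>wright_kernel \<rho> \<delta> \<tau> s\<bar> * s powr b))"
  have D: "norm (of_real (wright_kernel \<rho> \<delta> \<tau> s) * u s) \<le> D \<tau> s" for \<tau> s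
  proof (cases "s > 0")
    case True
    from mult_left_mono[OF u[OF True], of "\<bar>wright_kernel \<rho> \<delta> \<tau> s\<bar>"] show ?thesis
      by (simp add: D_def norm_mult algebra_simps)
  qed (simp add: D_def wright_kernel_def)
  have D_int: "integrable lborel (D \<tau>)" if "\<tau> \<ge> 0" for \<tau>
    unfolding D_def by (intro integrable_mult_right Bochner_Integration.integrable_add wright_kernel_moment_integrable a(1) b \<delta>a \<delta> that)
  \<comment> \<open>Both powers of \<tau> have positive exponents by the moment conditions, so the
    moments on (0, t] are largest at \<tau> = t.\<close>
  define E where "E = M * (t powr (\<delta> - 1 - \<rho> * (a + 1)) * wright_moment \<rho> \<delta> a + t powr (\<delta> - 1 - \<rho> * (b + 1)) * wright_moment \<rho> \<delta> b)"
  have D_le: "(\<integral>s. D \<tau> s \<partial>lborel) \<le> E" if "0 < \<tau>" "\<tau> \<le> t" for \<tau>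
  proof -
    have "(\<integral>s. D \<tau> s \<partial>lborel) = M * (\<tau> powr (\<delta> - 1 - \<rho> * (a + 1)) * wright_moment \<rho> \<delta> a + \<tau> powr (\<delta> - 1 - \<rho> * (b + 1)) * wright_moment \<rho> \<delta> b)"
      using wright_kernel_moment[OF a(1) \<delta>a that(1)] wright_kernel_moment[OF b \<delta> that(1)]
      unfolding D_def by (simp add: has_bochner_integral_iff)
    also have "\<dots> \<le> E" unfolding E_def using M that \<delta>a \<delta>
      by (intro mult_left_mono add_mono mult_right_mono powr_mono2 wright_moment_nonneg) auto
    finally show ?thesis .
  qed
  have fi: "integrable lborel (\<lambda>s. f \<tau> s)" for \<tau>
  proof (cases "\<tau> \<in> {0..t}")
    case True
    have "integrable lborel (\<lambda>s. of_real (wright_kernel \<rho> \<delta> \<tau> s) * u s)"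
      by (rule Bochner_Integration.integrable_bound[OF D_int]) (use True in \<open>auto intro!: AE_I2 order_trans[OF D abs_ge_self]\<close>)
    then show ?thesis unfolding f_def by (intro integrable_mult_right)
  qed (simp add: f_def g_def)
  have int: "integrable (lborel \<Otimes>\<^sub>M lborel) (case_prod f)"
  proof (rule lborel_pair.Fubini_integrable[OF f_meas])
    show "AE \<tau> in lborel. integrable lborel (\<lambda>s. case_prod f (\<tau>, s))" using fi by simp
    show "integrable lborel (\<lambda>\<tau>. \<integral>s. norm (case_prod f (\<tau>, s)) \<partial>lborel)"
    proof (rule Bochner_Integration.integrable_bound[OF integrable_mult_left[OF g_int, of E]])
      show "AE \<tau> in lborel. norm (\<integral>s. norm (case_prod f (\<tau>, s)) \<partial>lborel) \<le> norm (g \<tau> * E)"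
        using AE_lborel_singleton[of 0]
      proof eventually_elim
        case (elim \<tau>)
        show ?case
        proof (cases "\<tau> \<in> {0..t}")
          case True
          have "(\<integral>s. norm (f \<tau> s) \<partial>lborel) \<le> (\<integral>s. g \<tau> * D \<tau> s \<partial>lborel)"
          proof (rule integral_mono)
            show "integrable lborel (\<lambda>s. norm (f \<tau> s))" by (intro integrable_norm fi)
            show "integrable lborel (\<lambda>s. g \<tau> * D \<tau> s)" using True by (intro integrable_mult_right D_int) auto
            show "norm (f \<tau> s) \<le> g \<tau> * D \<tau> s" for s
              using mult_left_mono[OF D[of \<tau> s] g_nonneg[of \<tau>]] g_nonneg[of \<tau>] by (simp add: f_def norm_mult)
          qed
          also have "\<dots> = g \<tau> * (\<integral>s. D \<tau> s \<partial>lborel)" by simp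
          also have "\<dots> \<le> g \<tau> * E" using True elim by (intro mult_left_mono D_le g_nonneg) auto
          finally show ?thesis by simp
        qed (simp add: f_def g_def)
      qed
    qed measurable
  qed
  have "(\<integral>\<tau>. of_real (g \<tau>) * (\<integral>s. of_real (wright_kernel \<rho> \<delta> \<tau> s) * u s \<partial>lborel) \<partial>lborel) = (\<integral>\<tau>. (\<integral>s. f \<tau> s \<partial>lborel) \<partial>lborel)"
    unfolding f_def by simp
  also have "\<dots> = (\<integral>s. (\<integral>\<tau>. f \<tau> s \<partial>lborel) \<partial>lborel)"
    by (rule lborel_pair.Fubini_integral[OF int, symmetric])
  also have "\<dots> = (\<integral>s. of_real (wright_kernel \<rho> (\<delta> + \<gamma>) t s) * u s \<partial>lborel)"
  proof (rule Bochner_Integration.integral_cong[OF refl])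
    fix s :: real
    have "(\<integral>\<tau>. f \<tau> s \<partial>lborel) = (\<integral>\<tau>. of_real (g \<tau> * wright_kernel \<rho> \<delta> \<tau> s) * u s \<partial>lborel)"
      unfolding f_def by (simp add: mult_ac)
    also have "\<dots> = of_real (\<integral>\<tau>. g \<tau> * wright_kernel \<rho> \<delta> \<tau> s \<partial>lborel) * u s"
      unfolding integral_mult_left_zero integral_complex_of_real ..
    also have "(\<integral>\<tau>. g \<tau> * wright_kernel \<rho> \<delta> \<tau> s \<partial>lborel) = wright_kernel \<rho> (\<delta> + \<gamma>) t s"
    proof (cases "s > 0")
      case True
      have "(\<integral>\<tau>. g \<tau> * wright_kernel \<rho> \<delta> \<tau> s \<partial>lborel) = (\<integral>\<tau>. indicator {0..t} \<tau> * ((t - \<tau>) powr (\<gamma> - 1) / Gamma \<gamma> * (\<tau> powr (\<delta> - 1) * wright \<rho> \<delta> (s * \<tau> powr \<rho>))) \<partial>lborel)"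
        using True by (simp add: g_def wright_kernel_def mult.assoc)
      also have "\<dots> = t powr (\<delta> + \<gamma> - 1) * wright \<rho> (\<delta> + \<gamma>) (s * t powr \<rho>)"
        using wright_convolution[OF \<gamma> \<delta>1 \<rho>(1) t, of s] by (simp only: has_bochner_integral_iff)
      finally show ?thesis using True by (simp add: wright_kernel_def)
    qed (simp add: wright_kernel_def)
    finally show "(\<integral>\<tau>. f \<tau> s \<partial>lborel) = of_real (wright_kernel \<rho> (\<delta> + \<gamma>) t s) * u s" .
  qed
  finally show ?thesis unfolding g_def .
qed

text \<open>The scalar resolvent equation u = g (\<beta> + 1) c + g \<alpha> * r is integrated
  against the kernel of exponent \<delta> + \<rho> \<alpha>. The first term is a Weyl integral based
  at 0, where the Wright function is 1 / Gamma. In the second, Fubini moves the fractional integral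
  from r onto the kernel as a Weyl integral of order \<alpha>.\<close>

lemma wright_kernel_Weyl_function:
  fixes u r :: "real \<Rightarrow> complex"
  assumes a: "-1 < a" "a \<le> b" and \<delta>: "\<delta> > 1 + \<rho> * (b + 1)" and \<alpha>: "\<alpha> > 0" and t: "t > 0"
    and \<beta>: "\<beta> \<ge> 0" and \<delta>\<beta>: "\<delta> + \<rho> * \<alpha> > 1 + \<rho> * (\<beta> + 1)"
    and [measurable]: "r \<in> borel_measurable borel"
    and r: "\<And>s. s > 0 \<Longrightarrow> cmod (r s) \<le> M * (s powr a + s powr b)"
    and u: "\<And>s. s > 0 \<Longrightarrow> u s = of_real (s powr \<beta> / Gamma (\<beta> + 1)) * c + (\<integral>v. of_real (indicator {0..s} v * ((s - v) powr (\<alpha> - 1) / Gamma \<alpha>)) * r v \<partial>lborel)"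
  shows "(\<integral>s. of_real (wright_kernel \<rho> (\<delta> + \<rho> * \<alpha>) t s) * u s \<partial>lborel)
    = of_real (t powr (\<delta> + \<rho> * \<alpha> - \<rho> * (\<beta> + 1) - 1) / Gamma (\<delta> + \<rho> * \<alpha> - \<rho> * (\<beta> + 1))) * c + (\<integral>s. of_real (wright_kernel \<rho> \<delta> t s) * r s \<partial>lborel)"
proof -
  have b: "b > -1" using a by simp
  have \<delta>a: "\<delta> > 1 + \<rho> * (a + 1)"
    using \<delta> mult_left_mono[of "a + 1" "b + 1" \<rho>] a \<rho> by linarith
  note \<delta>1 = moment_bound_gt_1[OF b \<delta>]
  define \<delta>' where "\<delta>' = \<delta> + \<rho> * \<alpha>"
  have \<delta>'1: "\<delta>' > 1" using \<delta>1 mult_pos_pos[OF \<rho>(1) \<alpha>] by (simp add: \<delta>'_def)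
  have M: "M \<ge> 0" using order_trans[OF norm_ge_zero r[of 1]] by simp
  have [measurable]: "wright_kernel \<rho> \<delta>' t \<in> borel_measurable borel"
    using borel_measurable_wright_kernel_snd \<delta>'1 \<rho> by simp
  have G: "Gamma \<alpha> > 0" by (rule Gamma_real_pos[OF \<alpha>])
  define K where "K = wright_kernel \<rho> \<delta>' t"
  have K0: "K s = 0" if "s \<le> 0" for s using that by (simp add: K_def wright_kernel_def)
  have [measurable]: "K \<in> borel_measurable borel" unfolding K_def by measurable
  define g where "g = (\<lambda>s v. indicator {0..s} v * ((s - v) powr (\<alpha> - 1) / Gamma \<alpha>))"
  have g_alt: "g s v = (if 0 \<le> v \<and> v \<le> s then (s - v) powr (\<alpha> - 1) / Gamma \<alpha> else 0)" for s v
    by (simp add: g_def indicator_def)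
  have g_nonneg: "g s v \<ge> 0" for s v using G by (simp add: g_alt)
  have g_meas[measurable]: "(\<lambda>(s, v). g s v) \<in> borel_measurable (borel \<Otimes>\<^sub>M borel)"
    unfolding g_alt by measurable
  define f where "f = (\<lambda>s v. of_real (K s) * (of_real (g s v) * r v))"
  have f_meas[measurable]: "case_prod f \<in> borel_measurable (lborel \<Otimes>\<^sub>M lborel)"
    unfolding f_def by measurable
  \<comment> \<open>\<open>B c\<close> is the fractional integral of order \<alpha> of s powr c, a
    multiple of s powr (\<alpha> + c).\<close>
  define B where "B = (\<lambda>c s. Beta (c + 1) \<alpha> * s powr (\<alpha> + (c + 1) - 1) / Gamma \<alpha>)"
  have gB: "has_bochner_integral lborel (\<lambda>v. g s v * v powr c) (B c s)" if "s > 0" "c > -1" for s c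
  proof -
    have "has_bochner_integral lborel (\<lambda>v. indicator {0..s} v * ((s - v) powr (\<alpha> - 1) * v powr (c + 1 - 1)) / Gamma \<alpha>) (B c s)"
      unfolding B_def by (intro has_bochner_integral_divide_zero Beta_integral_scaled) (use that \<alpha> in auto)
    then show ?thesis by (simp add: g_def mult_ac)
  qed
  define D where "D = (\<lambda>s v. M * (g s v * v powr a + g s v * v powr b))"
  have D_hb: "has_bochner_integral lborel (D s) (M * (B a s + B b s))" if "s > 0" for s
    unfolding D_def using that a b by (intro has_bochner_integral_mult_right has_bochner_integral_add gB)
  have gD: "AE v in lborel. norm (of_real (g s v) * r v) \<le> D s v" for s
    using AE_lborel_singleton[of 0]
  proof eventually_elim
    case (elim v)
    show ?case
    proof (cases "v > 0")
      case True
      from mult_left_mono[OF r[OF True] g_nonneg[of s v]] show ?thesis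
        using g_nonneg[of s v] by (simp add: D_def norm_mult algebra_simps)
    next
      case False
      with elim show ?thesis by (simp add: g_def D_def)
    qed
  qed
  have gr_int: "integrable lborel (\<lambda>v. of_real (g s v) * r v)" if "s > 0" for s
  proof (rule Bochner_Integration.integrable_bound)
    show "integrable lborel (D s)" using D_hb[OF that] by (simp add: has_bochner_integral_iff)
    show "AE v in lborel. norm (of_real (g s v) * r v) \<le> norm (D s v)"
      using gD[of s] by eventually_elim simp
  qed measurable
  have fi: "integrable lborel (\<lambda>v. f s v)" for s
    using gr_int[of s] K0[of s] unfolding f_def by (cases "s > 0") auto
  have KB: "integrable lborel (\<lambda>s. \<bar>K s\<bar> * B c s)" if c: "c > -1" "\<delta> > 1 + \<rho> * (c + 1)" for c
  proof -
    have "integrable lborel (\<lambda>s. \<bar>K s\<bar> * s powr (\<alpha> + c))"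
      unfolding K_def
    proof (rule wright_kernel_moment_integrable)
      show "\<alpha> + c > -1" "t \<ge> 0" using c \<alpha> t by auto
      \<comment> \<open>The gain \<rho> \<alpha> in the exponent of the kernel pays exactly for the
        additional growth s powr \<alpha>.\<close>
      show "\<delta>' > 1 + \<rho> * (\<alpha> + c + 1)" using c by (simp add: \<delta>'_def algebra_simps)
    qed
    from integrable_mult_right[OF this, of "Beta (c + 1) \<alpha> / Gamma \<alpha>"] show ?thesis
      by (simp add: B_def mult_ac)
  qed
  have int: "integrable (lborel \<Otimes>\<^sub>M lborel) (case_prod f)"
  proof (rule lborel_pair.Fubini_integrable[OF f_meas])
    show "AE s in lborel. integrable lborel (\<lambda>v. case_prod f (s, v))" using fi by simp
    show "integrable lborel (\<lambda>s. \<integral>v. norm (case_prod f (s, v)) \<partial>lborel)"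
    proof (rule Bochner_Integration.integrable_bound)
      show "integrable lborel (\<lambda>s. M * (\<bar>K s\<bar> * B a s + \<bar>K s\<bar> * B b s))"
        by (intro integrable_mult_right Bochner_Integration.integrable_add KB a(1) b \<delta>a \<delta>)
      show "AE s in lborel. norm (\<integral>v. norm (case_prod f (s, v)) \<partial>lborel) \<le> norm (M * (\<bar>K s\<bar> * B a s + \<bar>K s\<bar> * B b s))"
      proof (rule AE_I2)
        fix s
        show "norm (\<integral>v. norm (case_prod f (s, v)) \<partial>lborel) \<le> norm (M * (\<bar>K s\<bar> * B a s + \<bar>K s\<bar> * B b s))"
        proof (cases "s > 0")
          case True
          have "(\<integral>v. norm (f s v) \<partial>lborel) \<le> (\<integral>v. \<bar>K s\<bar> * D s v \<partial>lborel)"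
          proof (rule integral_mono_AE)
            show "integrable lborel (\<lambda>v. norm (f s v))" by (intro integrable_norm fi)
            show "integrable lborel (\<lambda>v. \<bar>K s\<bar> * D s v)" using D_hb[OF True] by (simp add: has_bochner_integral_iff)
            show "AE v in lborel. norm (f s v) \<le> \<bar>K s\<bar> * D s v"
              using gD[of s]
            proof eventually_elim
              case (elim v)
              from mult_left_mono[OF this, of "\<bar>K s\<bar>"] show ?case by (simp add: f_def norm_mult)
            qed
          qed
          also have "\<dots> = M * (\<bar>K s\<bar> * B a s + \<bar>K s\<bar> * B b s)"
            using D_hb[OF True] by (simp add: has_bochner_integral_iff algebra_simps)
          finally show ?thesis by simp
        qed (simp add: f_def K0)
      qed
    qed measurable
  qed
  have K\<beta>: "integrable lborel (\<lambda>s. K s * s powr \<beta>)"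
  proof (rule Bochner_Integration.integrable_bound)
    show "integrable lborel (\<lambda>s. \<bar>K s\<bar> * s powr \<beta>)"
      unfolding K_def by (rule wright_kernel_moment_integrable) (use \<beta> \<delta>\<beta> t in \<open>auto simp: \<delta>'_def\<close>)
  qed (auto simp: abs_mult)
  have K\<beta>_val: "(\<integral>s. K s * s powr \<beta> \<partial>lborel) = Gamma (\<beta> + 1) * (t powr (\<delta>' - \<rho> * (\<beta> + 1) - 1) / Gamma (\<delta>' - \<rho> * (\<beta> + 1)))"
  proof -
    define \<epsilon> where "\<epsilon> = \<delta>' - \<rho> * (\<beta> + 1)"
    have \<epsilon>: "\<epsilon> > 1" using \<delta>\<beta> by (simp add: \<epsilon>_def \<delta>'_def)
    \<comment> \<open>The moment of order \<beta> read as a Weyl integral of order \<beta> + 1 based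
      at 0.\<close>
    have e: "K s * s powr \<beta> = indicator {0..} s * (s - 0) powr (\<beta> + 1 - 1) * wright_kernel \<rho> (\<epsilon> + \<rho> * (\<beta> + 1)) t s" for s
      by (cases "s > 0") (auto simp: K_def \<epsilon>_def wright_kernel_def)
    have "(\<integral>s. K s * s powr \<beta> \<partial>lborel) = Gamma (\<beta> + 1) * (t powr (\<epsilon> - 1) * wright \<rho> \<epsilon> (0 * t powr \<rho>))"
      unfolding e by (rule wright_kernel_Weyl) (use \<beta> \<epsilon> t in auto)
    then show ?thesis using wright_0[OF \<epsilon>, of \<rho>] \<rho> by (simp add: \<epsilon>_def)
  qed
  have "(\<integral>s. of_real (K s) * u s \<partial>lborel) = (\<integral>s. of_real (K s * s powr \<beta> / Gamma (\<beta> + 1)) * c + (\<integral>v. f s v \<partial>lborel) \<partial>lborel)"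
  proof (rule Bochner_Integration.integral_cong[OF refl])
    fix s
    show "of_real (K s) * u s = of_real (K s * s powr \<beta> / Gamma (\<beta> + 1)) * c + (\<integral>v. f s v \<partial>lborel)"
    proof (cases "s > 0")
      case True
      show ?thesis unfolding u[OF True] f_def g_def integral_mult_right_zero
        by (simp add: distrib_left)
    qed (simp add: K0 f_def)
  qed
  also have "\<dots> = (\<integral>s. of_real (K s * s powr \<beta> / Gamma (\<beta> + 1)) * c \<partial>lborel) + (\<integral>s. (\<integral>v. f s v \<partial>lborel) \<partial>lborel)"
    by (intro Bochner_Integration.integral_add integrable_mult_left integrable_of_real integrable_divide K\<beta>
        lborel_pair.integrable_fst[OF int])
  also have "(\<integral>s. of_real (K s * s powr \<beta> / Gamma (\<beta> + 1)) * c \<partial>lborel) = of_real (t powr (\<delta>' - \<rho> * (\<beta> + 1) - 1) / Gamma (\<delta>' - \<rho> * (\<beta> + 1))) * c"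
  proof -
    have "Gamma (\<beta> + 1) \<noteq> 0" using Gamma_real_pos[of "\<beta> + 1"] \<beta> by linarith
    then show ?thesis
      unfolding integral_mult_left_zero integral_complex_of_real integral_divide_zero K\<beta>_val by simp
  qed
  also have "(\<integral>s. (\<integral>v. f s v \<partial>lborel) \<partial>lborel) = (\<integral>v. (\<integral>s. f s v \<partial>lborel) \<partial>lborel)"
    by (rule lborel_pair.Fubini_integral[OF int, symmetric])
  also have "\<dots> = (\<integral>v. of_real (wright_kernel \<rho> \<delta> t v) * r v \<partial>lborel)"
  proof (rule integral_cong_AE)
    show "(\<lambda>v. \<integral>s. f s v \<partial>lborel) \<in> borel_measurable lborel"
      by measurable
    have [measurable]: "wright_kernel \<rho> \<delta> t \<in> borel_measurable borel"
      using borel_measurable_wright_kernel_snd \<delta>1 \<rho> by simp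
    show "(\<lambda>v. of_real (wright_kernel \<rho> \<delta> t v) * r v) \<in> borel_measurable lborel" by measurable
    show "AE v in lborel. (\<integral>s. f s v \<partial>lborel) = of_real (wright_kernel \<rho> \<delta> t v) * r v"
      using AE_lborel_singleton[of 0]
    proof eventually_elim
      case (elim v)
      show ?case
      proof (cases "v > 0")
        case True
        have "f s v = of_real (indicator {v..} s * (s - v) powr (\<alpha> - 1) * K s) * (r v / of_real (Gamma \<alpha>))" for s
          using True by (auto simp: f_def g_def indicator_def)
        then have "(\<integral>s. f s v \<partial>lborel) = of_real (\<integral>s. indicator {v..} s * (s - v) powr (\<alpha> - 1) * K s \<partial>lborel) * (r v / of_real (Gamma \<alpha>))"
          by (simp only: integral_mult_left_zero integral_complex_of_real)
        also have "(\<integral>s. indicator {v..} s * (s - v) powr (\<alpha> - 1) * K s \<partial>lborel) = Gamma \<alpha> * (t powr (\<delta> - 1) * wright \<rho> \<delta> (v * t powr \<rho>))"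
          unfolding K_def \<delta>'_def by (rule wright_kernel_Weyl) (use True \<alpha> \<delta>1 t in auto)
        finally show ?thesis using True G by (simp add: wright_kernel_def)
      next
        case False
        with elim have "f s v = 0" for s by (simp add: f_def g_def)
        with False show ?thesis by (simp add: wright_kernel_def)
      qed
    qed
  qed
  finally show ?thesis unfolding K_def \<delta>'_def .
qed

end

section \<open>The kernels \<open>g\<close> and multivalued linear operators\<close>

lemma g_kernel_nonzero: "t \<noteq> 0 \<Longrightarrow> g_kernel z t = t powr (z - 1) / Gamma z"
  by (simp add: g_kernel_def)

lemma Gamma_nonzero: "z > 0 \<Longrightarrow> Gamma z \<noteq> (0 :: real)"
  by (rule Gamma_real_pos[THEN less_imp_neq, THEN not_sym])

lemma borel_measurable_g_kernel[measurable]: "g_kernel z \<in> borel_measurable borel"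
  unfolding g_kernel_def[abs_def] by measurable

lemma continuous_on_g_kernel:
  assumes "z \<ge> 1"
  shows "continuous_on {0..} (g_kernel z)"
proof (cases "z = 1")
  case True
  have "continuous_on {0..} (\<lambda>_::real. 1::real)" by simp
  then show ?thesis
    by (rule continuous_on_eq) (use True in \<open>auto simp: g_kernel_def\<close>)
next
  case False
  with assms have "z > 1" by simp
  then have "continuous_on {0..} (\<lambda>t. t powr (z - 1) / Gamma z)"
    using \<open>z > 1\<close> Gamma_nonzero[of z] by (intro continuous_intros continuous_on_powr') auto
  then show ?thesis
    by (rule continuous_on_eq) (use False in \<open>auto simp: g_kernel_def\<close>)
qed

lemma integrable_g_kernel_shift:
  assumes "\<gamma> > 0" "t > 0"
  shows "integrable lborel (\<lambda>s. indicator {0..t} s * g_kernel \<gamma> (t - s))"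
proof -
  have "integrable lborel (\<lambda>s. indicator {0..t} s * ((t - s) powr (\<gamma> - 1) * s powr (1 - 1)) / Gamma \<gamma>)"
    using Beta_integral_scaled[OF assms(1) zero_less_one assms(2)] by (simp add: has_bochner_integral_iff)
  then show ?thesis
  proof (rule integrable_cong_AE_imp)
    \<comment> \<open>The endpoints are removed because \<open>s powr (1 - 1)\<close> is 0 at s = 0,
      and for \<gamma> = 1 the kernel is 1 at s = t whereas \<open>0 powr 0\<close> is 0.\<close>
    show "AE s in lborel. indicator {0..t} s * ((t - s) powr (\<gamma> - 1) * s powr (1 - 1)) / Gamma \<gamma> = indicator {0..t} s * g_kernel \<gamma> (t - s)"
      using AE_lborel_singleton[of 0] AE_lborel_singleton[of t]
      by eventually_elim (auto simp: g_kernel_nonzero)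
  qed measurable
qed

lemma absolutely_integrable_g_kernel:
  assumes "\<gamma> > 0" "T \<ge> 0"
  shows "(\<lambda>t. complex_of_real (g_kernel \<gamma> t)) absolutely_integrable_on {0..T}"
proof (cases "T = 0")
  case True
  then show ?thesis
    using absolutely_integrable_on_null[of 0 "0::real" "\<lambda>t. complex_of_real (g_kernel \<gamma> t)"] by simp
next
  case False
  with assms have "T > 0" by simp
  \<comment> \<open>The reflection of s to T - s carries the shifted kernel to the kernel
    itself.\<close>
  from lborel_integrable_real_affine[OF integrable_g_kernel_shift[OF assms(1) this], of "-1" T]
  have "integrable lborel (\<lambda>s. indicator {0..T} (T + - 1 * s) * g_kernel \<gamma> (T - (T + - 1 * s)))" by simp
  moreover have "indicator {0..T} (T + - 1 * s) * g_kernel \<gamma> (T - (T + - 1 * s)) = indicator {0..T} s * g_kernel \<gamma> s" for s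
    by (auto simp: indicator_def)
  ultimately have "integrable lborel (\<lambda>s. indicator {0..T} s * g_kernel \<gamma> s)" by (simp only:)
  then have "integrable lborel (\<lambda>s. complex_of_real (indicator {0..T} s * g_kernel \<gamma> s))"
    by (rule integrable_of_real)
  then have "integrable lborel (\<lambda>s. indicator {0..T} s *\<^sub>R complex_of_real (g_kernel \<gamma> s))"
    by (simp add: scaleR_conv_of_real)
  then show ?thesis
    unfolding set_integrable_def by (subst integrable_completion) measurable
qed

lemma g_kernel_convolution:
  assumes "\<gamma> > 0" "\<kappa> > 0" "t > 0"
  shows "has_bochner_integral lborel (\<lambda>s. indicator {0..t} s * g_kernel \<gamma> (t - s) * g_kernel \<kappa> s) (g_kernel (\<gamma> + \<kappa>) t)"
proof -
  have G: "Gamma \<gamma> \<noteq> 0" "Gamma \<kappa> \<noteq> 0" using assms by (auto dest: Gamma_nonzero)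
  have "has_bochner_integral lborel (\<lambda>s. indicator {0..t} s * ((t - s) powr (\<gamma> - 1) * s powr (\<kappa> - 1)) / (Gamma \<gamma> * Gamma \<kappa>))
     (Beta \<kappa> \<gamma> * t powr (\<gamma> + \<kappa> - 1) / (Gamma \<gamma> * Gamma \<kappa>))"
    by (intro has_bochner_integral_divide_zero Beta_integral_scaled assms)
  moreover have "Beta \<kappa> \<gamma> * t powr (\<gamma> + \<kappa> - 1) / (Gamma \<gamma> * Gamma \<kappa>) = g_kernel (\<gamma> + \<kappa>) t"
    using G assms by (simp add: Beta_def g_kernel_nonzero add.commute[of \<gamma> \<kappa>])
  moreover have "AE s in lborel. indicator {0..t} s * ((t - s) powr (\<gamma> - 1) * s powr (\<kappa> - 1)) / (Gamma \<gamma> * Gamma \<kappa>) = indicator {0..t} s * g_kernel \<gamma> (t - s) * g_kernel \<kappa> s"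
    using AE_lborel_singleton[of 0] AE_lborel_singleton[of t]
    by eventually_elim (auto simp: g_kernel_nonzero)
  ultimately show ?thesis
    using has_bochner_integral_cong_AE[of "\<lambda>s. indicator {0..t} s * ((t - s) powr (\<gamma> - 1) * s powr (\<kappa> - 1)) / (Gamma \<gamma> * Gamma \<kappa>)" lborel
        "\<lambda>s. indicator {0..t} s * g_kernel \<gamma> (t - s) * g_kernel \<kappa> s" "g_kernel (\<gamma> + \<kappa>) t"]
    by simp
qed

text \<open>Together with \<open>is_MLOI\<close> this reduces multivalued linearity to linearity of
  the graph, a condition symmetric in the two components and therefore inherited by the
  inverse.\<close>

lemma is_MLO_graph:
  assumes "is_MLO A"
  shows "(x, y) \<in> A \<Longrightarrow> (x', y') \<in> A \<Longrightarrow> (x + x', y + y') \<in> A"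
    and "(x, y) \<in> A \<Longrightarrow> (c *\<^sub>C x, c *\<^sub>C y) \<in> A"
    and "(0, 0) \<in> A"
proof -
  have add: "(x + x', y + y') \<in> A" if "(x, y) \<in> A" "(x', y') \<in> A" for x y x' y'
    using assms that unfolding is_MLO_def by blast
  have scale: "(c *\<^sub>C x, c *\<^sub>C y) \<in> A" if "(x, y) \<in> A" for x y c
    using assms that unfolding is_MLO_def by blast
  show "(x, y) \<in> A \<Longrightarrow> (x', y') \<in> A \<Longrightarrow> (x + x', y + y') \<in> A"
    and "(x, y) \<in> A \<Longrightarrow> (c *\<^sub>C x, c *\<^sub>C y) \<in> A" by (fact add) (fact scale)
  have "0 \<in> Domain A"
    using assms unfolding is_MLO_def by (auto intro: complex_vector.subspace_0)
  then obtain z where "(0, z) \<in> A" by blast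
  from scale[OF this, of 0] show "(0, 0) \<in> A"
    by (simp add: complex_vector.scale_zero_left)
qed

lemma is_MLOI:
  assumes "\<And>x y x' y'. (x, y) \<in> A \<Longrightarrow> (x', y') \<in> A \<Longrightarrow> (x + x', y + y') \<in> A"
    and "\<And>x y c. (x, y) \<in> A \<Longrightarrow> (c *\<^sub>C x, c *\<^sub>C y) \<in> A"
    and "(0, 0) \<in> A"
  shows "is_MLO A"
proof -
  have "complex_vector.subspace (Domain A)"
    by (rule complex_vector.subspaceI) (use assms in blast)+
  with assms show ?thesis unfolding is_MLO_def by blast
qed

lemma is_MLO_converse: "is_MLO A \<Longrightarrow> is_MLO (A\<inverse>)"
  by (rule is_MLOI) (auto intro: is_MLO_graph)

lemma op_commutes_MLO_iff: "op_commutes_MLO T A \<longleftrightarrow> (\<forall>(x, y)\<in>A. (T x, T y) \<in> A)"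
  unfolding op_commutes_MLO_def op_graph_def by (auto simp: relcomp_unfold)

section \<open>The resolvent family of the inverse\<close>

definition kernel_integral :: "(real \<Rightarrow> real) \<Rightarrow> (real \<Rightarrow> 'a::sequentially_complete_lcs) \<Rightarrow> 'a" where
  "kernel_integral g f = (THE y. weak_integral g f y)"

lemma kernel_integral_eq: "weak_integral g f y \<Longrightarrow> kernel_integral g f = y"
  unfolding kernel_integral_def by (rule the_equality) (auto intro: weak_integral_unique)

context
  fixes A :: "('a::sequentially_complete_lcs \<times> 'a) set"
    and C :: "'a \<Rightarrow> 'a" and R :: "real \<Rightarrow> 'a \<Rightarrow> 'a"
    and \<alpha> \<beta> \<rho> a b \<eta> :: real
  assumes \<alpha>: "0 < \<alpha>" and \<rho>: "0 < \<rho>" "\<rho> < 1" and \<beta>: "0 \<le> \<beta>"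
    and A: "is_MLO A" "closed A" and C: "C \<in> cont_linear_ops" "op_commutes_MLO C A"
    and R: "regularized_resolvent_family
           (\<lambda>t. complex_of_real (g_kernel \<alpha> t)) (\<lambda>t. complex_of_real (g_kernel (\<beta> + 1) t)) C A R"
    and ab: "-1 < a" "a \<le> b"
    and Rb: "equicontinuous_ops {(\<lambda>x. inverse (t powr a + t powr b) *\<^sub>R R t x) |t. t > 0}"
    and \<eta>: "\<eta> > 1 + b" "\<eta> \<ge> 1 + \<beta>"
begin

private abbreviation "\<delta> \<equiv> 1 + \<rho> * \<eta>"
private abbreviation "\<kappa> \<equiv> 1 + \<rho> * (\<eta> - \<beta> - 1)"
private abbreviation "K \<equiv> wright_kernel \<rho> \<delta>"

definition inverse_part :: "real \<Rightarrow> 'a \<Rightarrow> 'a" where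
  "inverse_part t x = kernel_integral (wright_kernel \<rho> (1 + \<rho> * \<eta>) t) (\<lambda>s. R s x)"

text \<open>At t = 0 the kernel \<open>g_kernel\<close> is 1 if its exponent is 1 and 0 if it is
  larger. With \<open>W_0\<close> this makes the family at 0 equal to C for \<eta> = \<beta> + 1 and
  zero for \<eta> > \<beta> + 1.\<close>

definition inverse_family :: "real \<Rightarrow> 'a \<Rightarrow> 'a" where
  "inverse_family t x = g_kernel (1 + \<rho> * (\<eta> - \<beta> - 1)) t *\<^sub>R C x - inverse_part t x"

private abbreviation "W \<equiv> inverse_part"
private abbreviation "S \<equiv> inverse_family"

lemma b_gt: "-1 < b" using ab by simp

text \<open>The moment conditions on the kernel for orders b and a, both consequences of \<eta> > 1
  + b.\<close>

lemma \<delta>_gt: "\<delta> > 1 + \<rho> * (b + 1)" "\<delta> > 1 + \<rho> * (a + 1)" "\<delta> > 1"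
proof -
  show "\<delta> > 1 + \<rho> * (b + 1)" "\<delta> > 1 + \<rho> * (a + 1)"
    using mult_strict_left_mono[of "b + 1" \<eta> \<rho>] mult_strict_left_mono[of "a + 1" \<eta> \<rho>] \<eta> ab \<rho> by auto
  with moment_bound_gt_1[OF \<rho> b_gt] show "\<delta> > 1" by blast
qed

lemma \<kappa>_ge_1: "\<kappa> \<ge> 1" using \<rho> \<eta> by simp

lemma \<alpha>\<rho>_pos: "\<alpha> * \<rho> > 0" using \<alpha> \<rho> by simp

lemma R_cont: "continuous_on {0..} (\<lambda>t. R t x)"
  and R_op: "t \<ge> 0 \<Longrightarrow> R t \<in> cont_linear_ops"
  and R_integral: "t \<ge> 0 \<Longrightarrow> (y, x) \<in> A \<Longrightarrow> has_lcs_integral (lebesgue_on {0..t})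
      (\<lambda>s. complex_of_real (g_kernel \<alpha> (t - s)) *\<^sub>C R s x) (R t y - complex_of_real (g_kernel (\<beta> + 1) t) *\<^sub>C C y)"
  and R_C: "t \<ge> 0 \<Longrightarrow> R t (C x) = C (R t x)"
  and R_A: "t \<ge> 0 \<Longrightarrow> (x, y) \<in> A \<Longrightarrow> (R t x, R t y) \<in> A"
proof -
  note R' = R[unfolded regularized_resolvent_family_def]
  show "continuous_on {0..} (\<lambda>t. R t x)" using R' by blast
  show "t \<ge> 0 \<Longrightarrow> R t \<in> cont_linear_ops" using R' by blast
  show "t \<ge> 0 \<Longrightarrow> (y, x) \<in> A \<Longrightarrow> has_lcs_integral (lebesgue_on {0..t})
      (\<lambda>s. complex_of_real (g_kernel \<alpha> (t - s)) *\<^sub>C R s x) (R t y - complex_of_real (g_kernel (\<beta> + 1) t) *\<^sub>C C y)"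
    using R' by blast
  have "t \<ge> 0 \<Longrightarrow> R t \<circ> C = C \<circ> R t" using R' by blast
  then show "t \<ge> 0 \<Longrightarrow> R t (C x) = C (R t x)" by (simp add: fun_eq_iff)
  have "t \<ge> 0 \<Longrightarrow> op_commutes_MLO (R t) A" using R' by blast
  then show "t \<ge> 0 \<Longrightarrow> (x, y) \<in> A \<Longrightarrow> (R t x, R t y) \<in> A"
    unfolding op_commutes_MLO_iff by blast
qed

lemma R_bound:
  assumes p: "continuous_seminorm p"
  obtains q where "continuous_seminorm q" "\<And>s x. s > 0 \<Longrightarrow> p (R s x) \<le> (s powr a + s powr b) * q x"
proof -
  obtain q where q: "continuous_seminorm q"
    "\<forall>T\<in>{(\<lambda>x. inverse (t powr a + t powr b) *\<^sub>R R t x) |t. t > 0}. \<forall>x. p (T x) \<le> q x"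
    using equicontinuous_ops_seminormD[OF Rb p] by blast
  have "p (R s x) \<le> (s powr a + s powr b) * q x" if s: "s > 0" for s x
  proof -
    have pos: "s powr a + s powr b > 0" using s by (intro add_pos_pos) auto
    have "(\<lambda>x. inverse (s powr a + s powr b) *\<^sub>R R s x) \<in> {(\<lambda>x. inverse (t powr a + t powr b) *\<^sub>R R t x) |t. t > 0}"
      using s by blast
    from q(2)[rule_format, OF this] have "p (inverse (s powr a + s powr b) *\<^sub>R R s x) \<le> q x" .
    then show ?thesis using pos by (simp add: seminorm_scaleR[OF p] field_simps)
  qed
  with q(1) show ?thesis using that by blast
qed

section \<open>The operators W and S: existence, algebra and bounds\<close>

lemma K_meas: "K t \<in> borel_measurable borel"
  using borel_measurable_wright_kernel_snd[OF \<delta>_gt(3)] \<rho> by simp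

lemma K_neg: "s \<le> 0 \<Longrightarrow> K t s = 0" by (simp add: wright_kernel_def)

lemma K_majorant_integrable:
  "t \<ge> 0 \<Longrightarrow> integrable lborel (\<lambda>s. \<bar>K t s\<bar> * s powr a + \<bar>K t s\<bar> * s powr b)"
  by (intro Bochner_Integration.integrable_add wright_kernel_moment_integrable[OF \<rho>] ab(1) b_gt \<delta>_gt)

lemma K_R_le:
  assumes "continuous_seminorm q" "\<And>s x. s > 0 \<Longrightarrow> p (R s x) \<le> (s powr a + s powr b) * q x"
    and "\<And>s. s \<le> 0 \<Longrightarrow> k s = 0"
  shows "\<bar>k s\<bar> * p (R s x) \<le> (\<bar>k s\<bar> * s powr a + \<bar>k s\<bar> * s powr b) * q x"
proof (cases "s > 0")
  case True
  from mult_left_mono[OF assms(2)[OF True, of x], of "\<bar>k s\<bar>"] show ?thesis by (simp add: algebra_simps)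
qed (simp add: assms(3))

lemma K_R_majorant:
  assumes t: "t \<ge> 0" and p: "continuous_seminorm p"
  shows "\<exists>h. integrable lborel h \<and> (\<forall>s. \<bar>K t s\<bar> * p (R s x) \<le> h s)"
proof -
  obtain q where q: "continuous_seminorm q" "\<And>s x. s > 0 \<Longrightarrow> p (R s x) \<le> (s powr a + s powr b) * q x"
    using R_bound[OF p] by blast
  show ?thesis
    by (rule exI[of _ "\<lambda>s. (\<bar>K t s\<bar> * s powr a + \<bar>K t s\<bar> * s powr b) * q x"])
      (intro conjI allI integrable_mult_left K_majorant_integrable t K_R_le[OF q K_neg])
qed

lemma weak_integral_W:
  assumes t: "t \<ge> 0"
  shows "weak_integral (K t) (\<lambda>s. R s x) (W t x)"
proof -
  have "\<exists>y. weak_integral (K t) (\<lambda>s. R s x) y"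
    using truncated_weak_integral_tendsto[OF R_cont K_meas wright_kernel_locally_integrable[OF \<rho> \<delta>_gt(3)]
        K_neg[OF less_imp_le] K_R_majorant[OF t]] by blast
  then show ?thesis using kernel_integral_eq unfolding inverse_part_def by metis
qed

text \<open>R is arbitrary at negative arguments, where the kernel vanishes. Identities for R s with
  s \<ge> 0 thus pass to W t by uniqueness of weak integrals.\<close>

lemma W_eqI:
  assumes t: "t \<ge> 0" and "weak_integral (K t) f y" and f: "\<And>s. s \<ge> 0 \<Longrightarrow> f s = R s x"
  shows "W t x = y"
proof -
  have "weak_integral (K t) f y \<longleftrightarrow> weak_integral (K t) (\<lambda>s. R s x) y"
    by (rule weak_integral_cong, rule f) (metis K_neg linear)
  with assms(2) have "weak_integral (K t) (\<lambda>s. R s x) y" by (simp only:)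
  then show ?thesis by (rule weak_integral_unique[OF weak_integral_W[OF t]])
qed

lemma W_0: "W 0 x = 0"
  by (rule W_eqI[where f = "\<lambda>s. R s x"]) (auto simp: weak_integral_def wright_kernel_0 functional_0)

lemma W_linear:
  assumes t: "t \<ge> 0"
  shows "W t (x + y) = W t x + W t y" "W t (c *\<^sub>C x) = c *\<^sub>C W t x"
proof -
  show "W t (x + y) = W t x + W t y"
    by (rule W_eqI[OF t weak_integral_add[OF weak_integral_W[OF t] weak_integral_W[OF t]]])
      (simp add: cont_linear_opsD(1)[OF R_op])
  show "W t (c *\<^sub>C x) = c *\<^sub>C W t x"
    by (rule W_eqI[OF t weak_integral_op[OF weak_integral_W[OF t] scaleC_cont_linear_ops]])
      (simp add: cont_linear_opsD(2)[OF R_op])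
qed

lemma W_C:
  assumes t: "t \<ge> 0"
  shows "W t (C x) = C (W t x)"
  by (rule W_eqI[OF t weak_integral_op[OF weak_integral_W[OF t] C(1)]]) (simp add: R_C)

text \<open>The pairs (R s x, R s y) lie in the closed linear graph A, hence so does the pair of
  their integrals against the same kernel.\<close>

lemma W_A:
  assumes t: "t \<ge> 0" and xy: "(x, y) \<in> A"
  shows "(W t x, W t y) \<in> A"
proof (rule weak_integral_closed_relation[OF A(2) is_MLO_graph(1)[OF A(1)] _ is_MLO_graph(3)[OF A(1)]
      R_cont R_cont R_A[OF _ xy] K_meas wright_kernel_locally_integrable[OF \<rho> \<delta>_gt(3)] K_neg[OF less_imp_le]
      K_R_majorant[OF t] K_R_majorant[OF t] weak_integral_W[OF t] weak_integral_W[OF t]])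
  show "(r *\<^sub>R u, r *\<^sub>R v) \<in> A" if "(u, v) \<in> A" for r u v
    unfolding scaleR_scaleC by (rule is_MLO_graph(2)[OF A(1) that])
qed

lemma W_bound:
  assumes t: "t > 0" and p: "continuous_seminorm p" and q: "continuous_seminorm q"
    and pq: "\<And>s x. s > 0 \<Longrightarrow> p (R s x) \<le> (s powr a + s powr b) * q x"
  shows "p (W t x) \<le> (t powr (\<rho> * (\<eta> - a - 1)) * wright_moment \<rho> \<delta> a + t powr (\<rho> * (\<eta> - b - 1)) * wright_moment \<rho> \<delta> b) * q x"
proof -
  have "p (W t x) \<le> (\<integral>s. (\<bar>K t s\<bar> * s powr a + \<bar>K t s\<bar> * s powr b) * q x \<partial>lborel)"
    using t by (intro weak_integral_bound[OF weak_integral_W p] integrable_mult_left K_majorant_integrable K_R_le[OF q pq K_neg]) auto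
  also have "\<dots> = (t powr (\<delta> - 1 - \<rho> * (a + 1)) * wright_moment \<rho> \<delta> a + t powr (\<delta> - 1 - \<rho> * (b + 1)) * wright_moment \<rho> \<delta> b) * q x"
    using wright_kernel_moment[OF \<rho> ab(1) \<delta>_gt(2) t] wright_kernel_moment[OF \<rho> b_gt \<delta>_gt(1) t]
    by (simp add: has_bochner_integral_iff)
  also have "\<delta> - 1 - \<rho> * (a + 1) = \<rho> * (\<eta> - a - 1)" by (simp add: algebra_simps)
  also have "\<delta> - 1 - \<rho> * (b + 1) = \<rho> * (\<eta> - b - 1)" by (simp add: algebra_simps)
  finally show ?thesis .
qed

lemma S_linear:
  assumes "t \<ge> 0"
  shows "S t (x + y) = S t x + S t y" "S t (c *\<^sub>C x) = c *\<^sub>C S t x"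
  by (simp_all add: inverse_family_def W_linear[OF assms] cont_linear_opsD[OF C(1)] scaleR_scaleC
      scaleC_add_right complex_vector.scale_right_diff_distrib scaleC_scaleC mult.commute)

text \<open>One seminorm serves all t > 0: the moments in \<open>W_bound\<close> do not depend on t,
  so all dependence on t is in the three powers.\<close>

lemma S_bound:
  assumes p: "continuous_seminorm p"
  obtains q where "continuous_seminorm q"
    "\<And>t x. t > 0 \<Longrightarrow> p (S t x) \<le> (t powr (\<rho> * (\<eta> - \<beta> - 1)) + t powr (\<rho> * (\<eta> - a - 1)) + t powr (\<rho> * (\<eta> - b - 1))) * q x"
proof -
  obtain q where q: "continuous_seminorm q" "\<And>s x. s > 0 \<Longrightarrow> p (R s x) \<le> (s powr a + s powr b) * q x"
    using R_bound[OF p] by blast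
  obtain qC where qC: "continuous_seminorm qC" "\<And>x. p (C x) \<le> qC x"
    using cont_linear_ops_seminormD[OF C(1) p] by blast
  define m where "m = wright_moment \<rho> \<delta> a + wright_moment \<rho> \<delta> b"
  have ma: "wright_moment \<rho> \<delta> a \<ge> 0" and mb: "wright_moment \<rho> \<delta> b \<ge> 0" by (rule wright_moment_nonneg)+
  have G: "Gamma \<kappa> > 0" using \<kappa>_ge_1 by (intro Gamma_real_pos) simp
  define q' where "q' = (\<lambda>x. (1 / Gamma \<kappa>) * qC x + m * q x)"
  have q': "continuous_seminorm q'"
    unfolding q'_def using G ma mb by (intro continuous_seminorm_add_scale q qC) (auto simp: m_def)
  have "p (S t x) \<le> (t powr (\<rho> * (\<eta> - \<beta> - 1)) + t powr (\<rho> * (\<eta> - a - 1)) + t powr (\<rho> * (\<eta> - b - 1))) * q' x" if t: "t > 0" for t x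
  proof -
    define tk ta tb where "tk = t powr (\<rho> * (\<eta> - \<beta> - 1))" and "ta = t powr (\<rho> * (\<eta> - a - 1))" and "tb = t powr (\<rho> * (\<eta> - b - 1))"
    have pos: "tk \<ge> 0" "ta \<ge> 0" "tb \<ge> 0" by (simp_all add: tk_def ta_def tb_def)
    have qn: "q x \<ge> 0" "qC x \<ge> 0" using seminorm_nonneg[OF q(1)] seminorm_nonneg[OF qC(1)] by auto
    have g: "g_kernel \<kappa> t = tk / Gamma \<kappa>" using t by (simp add: g_kernel_nonzero tk_def)
    have "p (S t x) \<le> p (g_kernel \<kappa> t *\<^sub>R C x) + p (W t x)"
      unfolding inverse_family_def using seminorm_add[OF p, of "g_kernel \<kappa> t *\<^sub>R C x" "- W t x"] seminorm_minus[OF p] by simp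
    also have "p (g_kernel \<kappa> t *\<^sub>R C x) = tk / Gamma \<kappa> * p (C x)"
      using G pos by (simp add: seminorm_scaleR[OF p] g)
    also have "tk / Gamma \<kappa> * p (C x) + p (W t x) \<le> tk / Gamma \<kappa> * qC x + (ta * wright_moment \<rho> \<delta> a + tb * wright_moment \<rho> \<delta> b) * q x"
      unfolding ta_def tb_def by (intro add_mono W_bound[OF t p q] mult_left_mono qC(2)) (use G pos in auto)
    also have "\<dots> \<le> (tk + ta + tb) * ((1 / Gamma \<kappa>) * qC x) + (tk + ta + tb) * m * q x"
    proof (intro add_mono mult_right_mono)
      have "tk * ((1 / Gamma \<kappa>) * qC x) \<le> (tk + ta + tb) * ((1 / Gamma \<kappa>) * qC x)"
        by (intro mult_right_mono) (use pos qn G in auto)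
      then show "tk / Gamma \<kappa> * qC x \<le> (tk + ta + tb) * ((1 / Gamma \<kappa>) * qC x)" by simp
      have "ta * wright_moment \<rho> \<delta> a + tb * wright_moment \<rho> \<delta> b \<le> (tk + ta + tb) * wright_moment \<rho> \<delta> a + (tk + ta + tb) * wright_moment \<rho> \<delta> b"
        using ma mb pos by (intro add_mono mult_right_mono) auto
      then show "ta * wright_moment \<rho> \<delta> a + tb * wright_moment \<rho> \<delta> b \<le> (tk + ta + tb) * m"
        by (simp add: m_def distrib_left)
    qed (use qn in auto)
    also have "\<dots> = (tk + ta + tb) * q' x" by (simp add: q'_def algebra_simps)
    finally show ?thesis unfolding tk_def ta_def tb_def .
  qed
  with q' show ?thesis using that by blast
qed

lemma S_op:
  assumes t: "t \<ge> 0"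
  shows "S t \<in> cont_linear_ops"
proof (rule cont_linear_opsI[OF S_linear[OF t]])
  fix p :: "'a \<Rightarrow> real" assume p: "continuous_seminorm p"
  show "\<exists>q. continuous_seminorm q \<and> (\<forall>x. p (S t x) \<le> q x)"
  proof (cases "t = 0")
    case True
    obtain qC where qC: "continuous_seminorm qC" "\<And>x. p (C x) \<le> qC x"
      using cont_linear_ops_seminormD[OF C(1) p] by blast
    \<comment> \<open>The summand with coefficient 0 only fits the two-term form of
      \<open>continuous_seminorm_add_scale\<close>.\<close>
    have "continuous_seminorm (\<lambda>x. \<bar>g_kernel \<kappa> 0\<bar> * qC x + 0 * qC x)"
      by (intro continuous_seminorm_add_scale qC) auto
    moreover have "p (S t x) \<le> \<bar>g_kernel \<kappa> 0\<bar> * qC x + 0 * qC x" for x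
      using True mult_left_mono[OF qC(2), of "\<bar>g_kernel \<kappa> 0\<bar>" x]
      by (simp add: inverse_family_def W_0 seminorm_scaleR[OF p])
    ultimately show ?thesis by blast
  next
    case False
    with t have t: "t > 0" by simp
    let ?c = "t powr (\<rho> * (\<eta> - \<beta> - 1)) + t powr (\<rho> * (\<eta> - a - 1)) + t powr (\<rho> * (\<eta> - b - 1))"
    obtain q where q: "continuous_seminorm q" "\<And>x. p (S t x) \<le> ?c * q x"
      using S_bound[OF p] t by metis
    have "continuous_seminorm (\<lambda>x. ?c * q x + 0 * q x)"
      by (intro continuous_seminorm_add_scale q) auto
    with q(2) show ?thesis by (intro exI[of _ "\<lambda>x. ?c * q x + 0 * q x"]) simp
  qed
qed

section \<open>Strong continuity\<close>

lemma W_sequentially_continuous: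
  assumes t: "t \<ge> 0" and X: "\<And>n. X n \<ge> 0" "X \<longlonglongrightarrow> t"
  shows "(\<lambda>n. W (X n) x) \<longlonglongrightarrow> W t x"
  unfolding tendsto_iff_seminorms
proof (intro allI impI)
  fix p :: "'a \<Rightarrow> real" assume p: "continuous_seminorm p"
  obtain q where q: "continuous_seminorm q" "\<And>s x. s > 0 \<Longrightarrow> p (R s x) \<le> (s powr a + s powr b) * q x"
    using R_bound[OF p] by blast
  define d where "d = (\<lambda>n s. K (X n) s - K t s)"
  have [measurable]: "K t \<in> borel_measurable borel" "d n \<in> borel_measurable borel" for t n
    using K_meas unfolding d_def by measurable
  have di: "integrable lborel (\<lambda>s. \<bar>d n s\<bar> * s powr c)" if c: "c > -1" "\<delta> > 1 + \<rho> * (c + 1)" for n c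
  proof (rule Bochner_Integration.integrable_bound)
    show "integrable lborel (\<lambda>s. \<bar>K (X n) s\<bar> * s powr c + \<bar>K t s\<bar> * s powr c)"
      by (intro Bochner_Integration.integrable_add wright_kernel_moment_integrable[OF \<rho>] c X t)
    show "AE s in lborel. norm (\<bar>d n s\<bar> * s powr c) \<le> norm (\<bar>K (X n) s\<bar> * s powr c + \<bar>K t s\<bar> * s powr c)"
    proof (rule AE_I2)
      fix s
      have "\<bar>d n s\<bar> * s powr c \<le> (\<bar>K (X n) s\<bar> + \<bar>K t s\<bar>) * s powr c"
        unfolding d_def by (intro mult_right_mono) auto
      then show "norm (\<bar>d n s\<bar> * s powr c) \<le> norm (\<bar>K (X n) s\<bar> * s powr c + \<bar>K t s\<bar> * s powr c)"
        by (simp add: distrib_right)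
    qed
  qed measurable
  have le: "p (W (X n) x - W t x) \<le> ((\<integral>s. \<bar>d n s\<bar> * s powr a \<partial>lborel) + (\<integral>s. \<bar>d n s\<bar> * s powr b \<partial>lborel)) * q x" for n
  proof -
    have dK: "d n s = 0" if "s \<le> 0" for s using that by (simp add: d_def K_neg)
    \<comment> \<open>The difference is the integral of R against a difference of kernels, so
      weighted convergence of the kernels in mean for c = a and c = b is enough.\<close>
    have "weak_integral (d n) (\<lambda>s. R s x) (W (X n) x - W t x)"
      unfolding d_def by (intro weak_integral_diff_kernel weak_integral_W X t)
    then have "p (W (X n) x - W t x) \<le> (\<integral>s. (\<bar>d n s\<bar> * s powr a + \<bar>d n s\<bar> * s powr b) * q x \<partial>lborel)"
      by (rule weak_integral_bound[OF _ p])
        (intro integrable_mult_left Bochner_Integration.integrable_add di ab(1) b_gt \<delta>_gt K_R_le[OF q dK])+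
    then show ?thesis using di[OF ab(1) \<delta>_gt(2)] di[OF b_gt \<delta>_gt(1)] by simp
  qed
  have "(\<lambda>n. ((\<integral>s. \<bar>d n s\<bar> * s powr a \<partial>lborel) + (\<integral>s. \<bar>d n s\<bar> * s powr b \<partial>lborel)) * q x) \<longlonglongrightarrow> (0 + 0) * q x"
    unfolding d_def
    by (intro tendsto_mult tendsto_add tendsto_const wright_kernel_L1_continuous[OF \<rho>] ab(1) b_gt \<delta>_gt t X)
  then have lim: "(\<lambda>n. ((\<integral>s. \<bar>d n s\<bar> * s powr a \<partial>lborel) + (\<integral>s. \<bar>d n s\<bar> * s powr b \<partial>lborel)) * q x) \<longlonglongrightarrow> 0"
    by simp
  show "(\<lambda>n. p (W (X n) x - W t x)) \<longlonglongrightarrow> 0"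
    by (rule tendsto_sandwich[OF _ _ tendsto_const lim])
      (use le seminorm_nonneg[OF p] in \<open>auto intro!: always_eventually\<close>)
qed

lemma S_cont: "continuous_on {0..} (\<lambda>t. S t x)"
  unfolding continuous_on_def
proof (intro ballI, subst tendsto_at_iff_sequentially, intro allI impI)
  fix t :: real and X :: "nat \<Rightarrow> real"
  assume t: "t \<in> {0..}" and X: "\<forall>i. X i \<in> {0..} - {t}" "X \<longlonglongrightarrow> t"
  have X0: "X n \<ge> 0" for n using X(1) by auto
  have "(\<lambda>n. g_kernel \<kappa> (X n)) \<longlonglongrightarrow> g_kernel \<kappa> t"
    by (rule continuous_on_tendsto_compose[OF continuous_on_g_kernel[OF \<kappa>_ge_1] X(2) t]) (use X0 in auto)
  then have "(\<lambda>n. complex_of_real (g_kernel \<kappa> (X n)) *\<^sub>C C x - W (X n) x) \<longlonglongrightarrow> complex_of_real (g_kernel \<kappa> t) *\<^sub>C C x - W t x"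
    using t X0 X(2) by (intro tendsto_diff tendsto_scaleC tendsto_of_real tendsto_const W_sequentially_continuous) auto
  then show "((\<lambda>t. S t x) \<circ> X) \<longlonglongrightarrow> S t x"
    by (simp add: inverse_family_def o_def scaleR_scaleC)
qed

section \<open>The resolvent equation of the inverse, seen through functionals\<close>

definition scalar_family :: "('a \<Rightarrow> complex) \<Rightarrow> 'a \<Rightarrow> real \<Rightarrow> complex" where
  "scalar_family \<psi> x s = indicator {0..} s *\<^sub>R \<psi> (R s x)"

text \<open>These four facts are the input for the scalar kernel lemmas: measurability, growth, the
  representation of W, and the resolvent equation of R. The indicator in the definition removes the
  unspecified values of R at negative arguments, without which the orbit need not be Borel.\<close>

lemma scalar_family:
  fixes \<psi> :: "'a \<Rightarrow> complex"
  assumes \<psi>: "cont_functional \<psi>"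
  shows "scalar_family \<psi> x \<in> borel_measurable borel"
    and "\<exists>M. \<forall>s>0. cmod (scalar_family \<psi> x s) \<le> M * (s powr a + s powr b)"
    and "t \<ge> 0 \<Longrightarrow> \<psi> (W t x) = (\<integral>s. of_real (K t s) * scalar_family \<psi> x s \<partial>lborel)"
    and "(y, x) \<in> A \<Longrightarrow> t > 0 \<Longrightarrow> scalar_family \<psi> y t = of_real (t powr \<beta> / Gamma (\<beta> + 1)) * \<psi> (C y) +
           (\<integral>v. of_real (indicator {0..t} v * ((t - v) powr (\<alpha> - 1) / Gamma \<alpha>)) * scalar_family \<psi> x v \<partial>lborel)"
proof -
  let ?r = "scalar_family \<psi>"
  note r_def = scalar_family_def
  have c: "continuous_on {0..} (\<lambda>s. \<psi> (R s x))" for x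
    by (rule continuous_on_compose2[OF functional_cont[OF \<psi>] R_cont]) auto
  show r_meas: "?r x \<in> borel_measurable borel" for x
    unfolding r_def[abs_def] using borel_measurable_continuous_on_indicator[OF _ c] by simp
  show "\<exists>M. \<forall>s>0. cmod (?r x s) \<le> M * (s powr a + s powr b)"
  proof -
    obtain q where "continuous_seminorm q"
      and q: "\<And>s x. s > 0 \<Longrightarrow> cmod (\<psi> (R s x)) \<le> (s powr a + s powr b) * q x"
      using R_bound[OF continuous_seminorm_functional[OF \<psi>]] by blast
    then show ?thesis by (intro exI[of _ "q x"]) (simp add: r_def mult.commute)
  qed
  show "\<psi> (W t x) = (\<integral>s. of_real (K t s) * ?r x s \<partial>lborel)" if t: "t \<ge> 0"
  proof -
    have "of_real (K t s) * \<psi> (R s x) = of_real (K t s) * ?r x s" for s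
      using K_neg[of s t] by (cases "s \<ge> 0") (auto simp: r_def)
    then show ?thesis
      using weak_integralD[OF weak_integral_W[OF t] \<psi>, of x] by (simp only: has_bochner_integral_iff)
  qed
  show "?r y t = of_real (t powr \<beta> / Gamma (\<beta> + 1)) * \<psi> (C y) +
           (\<integral>v. of_real (indicator {0..t} v * ((t - v) powr (\<alpha> - 1) / Gamma \<alpha>)) * ?r x v \<partial>lborel)"
    if yx: "(y, x) \<in> A" and t: "t > 0"
  proof -
    note r_meas[measurable]
    let ?F = "\<lambda>v. complex_of_real (g_kernel \<alpha> (t - v)) * \<psi> (R v x)"
    have eq: "indicator {0..t} v *\<^sub>R ?F v = of_real (indicator {0..t} v * g_kernel \<alpha> (t - v)) * ?r x v" for v
      by (auto simp: r_def indicator_def)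
    have m: "(\<lambda>v. indicator {0..t} v *\<^sub>R ?F v) \<in> borel_measurable borel"
      unfolding eq by measurable
    then have "(\<lambda>v. indicator {0..t} v *\<^sub>R ?F v) \<in> borel_measurable lebesgue"
      by (intro measurable_completion) simp
    then have m': "?F \<in> borel_measurable (lebesgue_on {0..t})"
      by (subst borel_measurable_restrict_space_iff) auto
    have "has_bochner_integral (lebesgue_on {0..t}) (\<lambda>v. \<psi> (complex_of_real (g_kernel \<alpha> (t - v)) *\<^sub>C R v x))
        (\<psi> (R t y - complex_of_real (g_kernel (\<beta> + 1) t) *\<^sub>C C y))"
      by (rule has_lcs_integral_functional[OF R_integral[OF less_imp_le[OF t] yx] \<psi>])
        (unfold functional_scaleC[OF \<psi>], rule m')
    then have "has_bochner_integral (lebesgue_on {0..t}) ?F (\<psi> (R t y) - of_real (g_kernel (\<beta> + 1) t) * \<psi> (C y))"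
      by (simp only: functional_scaleC[OF \<psi>] functional_diff[OF \<psi>])
    then have "has_bochner_integral lborel (\<lambda>v. indicator {0..t} v *\<^sub>R ?F v) (\<psi> (R t y) - of_real (g_kernel (\<beta> + 1) t) * \<psi> (C y))"
      by (rule has_bochner_integral_lebesgue_on_iff[OF atLeastAtMost_borel m, THEN iffD1])
    then have "(\<integral>v. of_real (indicator {0..t} v * g_kernel \<alpha> (t - v)) * ?r x v \<partial>lborel) = \<psi> (R t y) - of_real (g_kernel (\<beta> + 1) t) * \<psi> (C y)"
      unfolding eq by (simp only: has_bochner_integral_iff)
    moreover have "(\<integral>v. of_real (indicator {0..t} v * g_kernel \<alpha> (t - v)) * ?r x v \<partial>lborel)
      = (\<integral>v. of_real (indicator {0..t} v * ((t - v) powr (\<alpha> - 1) / Gamma \<alpha>)) * ?r x v \<partial>lborel)"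
    proof (rule integral_cong_AE)
      \<comment> \<open>The point v = t is removed because for \<alpha> = 1 the kernel is 1 at 0
        while \<open>0 powr 0\<close> is 0.\<close>
      show "AE v in lborel. of_real (indicator {0..t} v * g_kernel \<alpha> (t - v)) * ?r x v = of_real (indicator {0..t} v * ((t - v) powr (\<alpha> - 1) / Gamma \<alpha>)) * ?r x v"
        using AE_lborel_singleton[of t] by eventually_elim (simp add: g_kernel_nonzero)
    qed measurable
    moreover have "g_kernel (\<beta> + 1) t = t powr \<beta> / Gamma (\<beta> + 1)" using t by (simp add: g_kernel_nonzero)
    ultimately have J: "(\<integral>v. of_real (indicator {0..t} v * ((t - v) powr (\<alpha> - 1) / Gamma \<alpha>)) * ?r x v \<partial>lborel)
        = \<psi> (R t y) - of_real (t powr \<beta> / Gamma (\<beta> + 1)) * \<psi> (C y)"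
      by (simp only:)
    have "?r y t = \<psi> (R t y)" using t by (simp add: r_def)
    then show ?thesis unfolding J by (simp only: add_diff_eq add_diff_cancel_left')
  qed
qed

text \<open>For (y, x) in A the convolution of g (\<alpha> \<rho>) with W y equals g (\<alpha>
  \<rho> + \<kappa>) C y + W x, by \<open>wright_kernel_convolution\<close> and
  \<open>wright_kernel_Weyl_function\<close>. Convolution with the C-term of S y gives the same
  multiple of C y, and only - W t x survives.\<close>

lemma inverse_resolvent_equation:
  assumes yx: "(y, x) \<in> A" and t: "t > 0"
  shows "weak_integral (\<lambda>s. indicator {0..t} s * g_kernel (\<alpha> * \<rho>) (t - s)) (\<lambda>s. S s y) (- W t x)"
  unfolding weak_integral_def
proof (intro allI impI)
  fix \<psi> :: "'a \<Rightarrow> complex" assume \<psi>: "cont_functional \<psi>"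
  let ?r = "scalar_family \<psi>"
  note rR = scalar_family[OF \<psi>]
  obtain Mx where Mx: "\<And>s. s > 0 \<Longrightarrow> cmod (?r x s) \<le> Mx * (s powr a + s powr b)" using rR(2)[of x] by blast
  obtain My where My: "\<And>s. s > 0 \<Longrightarrow> cmod (?r y s) \<le> My * (s powr a + s powr b)" using rR(2)[of y] by blast
  note rR(1)[measurable]
  define g where "g = (\<lambda>s. indicator {0..t} s * g_kernel (\<alpha> * \<rho>) (t - s))"
  have [measurable]: "g \<in> borel_measurable borel" unfolding g_def by measurable
  have g0: "g s = 0" if "s \<notin> {0..t}" for s using that by (simp add: g_def)
  have g_int: "integrable lborel g" unfolding g_def by (rule integrable_g_kernel_shift[OF \<alpha>\<rho>_pos t])
  have S_int: "integrable lborel (\<lambda>s. of_real (g s) * \<psi> (S s y))"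
    by (rule functional_kernel_integrable[OF \<psi> continuous_on_subset[OF S_cont] g_int g0]) auto
  have k_int: "has_bochner_integral lborel (\<lambda>s. of_real (g s * g_kernel \<kappa> s) * \<psi> (C y)) (of_real (g_kernel ((\<alpha> * \<rho>) + \<kappa>) t) * \<psi> (C y))"
    unfolding g_def
    by (intro has_bochner_integral_mult_left has_bochner_integral_of_real g_kernel_convolution) (use \<alpha>\<rho>_pos \<kappa>_ge_1 t in auto)
  have split: "of_real (g s) * \<psi> (S s y) = of_real (g s * g_kernel \<kappa> s) * \<psi> (C y) - of_real (g s) * \<psi> (W s y)" for s
    by (simp add: inverse_family_def functional_diff[OF \<psi>] functional_scaleR[OF \<psi>] algebra_simps)
  \<comment> \<open>S is continuous, hence integrable against g; W inherits this by subtraction from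
    the C-term.\<close>
  have "integrable lborel (\<lambda>s. of_real (g s * g_kernel \<kappa> s) * \<psi> (C y) - of_real (g s) * \<psi> (S s y))"
    using k_int S_int by (intro Bochner_Integration.integrable_diff) (auto simp: has_bochner_integral_iff)
  then have W_int: "integrable lborel (\<lambda>s. of_real (g s) * \<psi> (W s y))"
    unfolding split by simp
  have \<kappa>\<alpha>\<rho>: "\<delta> + \<rho> * \<alpha> - \<rho> * (\<beta> + 1) = (\<alpha> * \<rho>) + \<kappa>" by (simp add: algebra_simps)
  have "(\<integral>s. of_real (g s) * \<psi> (W s y) \<partial>lborel)
     = (\<integral>s. of_real (indicator {0..t} s * ((t - s) powr ((\<alpha> * \<rho>) - 1) / Gamma (\<alpha> * \<rho>))) * (\<integral>v. of_real (K s v) * ?r y v \<partial>lborel) \<partial>lborel)"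
  proof (rule integral_cong_AE)
    have [measurable]: "(\<lambda>(t, s). K t s) \<in> borel_measurable (borel \<Otimes>\<^sub>M borel)"
      using borel_measurable_wright_kernel[OF \<delta>_gt(3)] \<rho> by simp
    show "(\<lambda>s. of_real (indicator {0..t} s * ((t - s) powr ((\<alpha> * \<rho>) - 1) / Gamma (\<alpha> * \<rho>))) * (\<integral>v. of_real (K s v) * ?r y v \<partial>lborel)) \<in> borel_measurable lborel"
      by measurable
    show "AE s in lborel. of_real (g s) * \<psi> (W s y) = of_real (indicator {0..t} s * ((t - s) powr ((\<alpha> * \<rho>) - 1) / Gamma (\<alpha> * \<rho>))) * (\<integral>v. of_real (K s v) * ?r y v \<partial>lborel)"
      using AE_lborel_singleton[of t]
    proof eventually_elim
      case (elim s)
      show ?case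
      proof (cases "s \<in> {0..t}")
        case True
        then have "g s = indicator {0..t} s * ((t - s) powr ((\<alpha> * \<rho>) - 1) / Gamma (\<alpha> * \<rho>))"
          using elim by (simp add: g_def g_kernel_nonzero)
        moreover have "\<psi> (W s y) = (\<integral>v. of_real (K s v) * ?r y v \<partial>lborel)" using rR(3)[of s y] True by simp
        ultimately show ?thesis by (simp only:)
      qed (simp add: g_def)
    qed
  qed (use W_int in auto)
  also have "\<dots> = (\<integral>v. of_real (wright_kernel \<rho> (\<delta> + (\<alpha> * \<rho>)) t v) * ?r y v \<partial>lborel)"
    by (rule wright_kernel_convolution[OF \<rho> ab \<delta>_gt(1) \<alpha>\<rho>_pos t rR(1) My])
  also have "\<dots> = (\<integral>v. of_real (wright_kernel \<rho> (\<delta> + \<rho> * \<alpha>) t v) * ?r y v \<partial>lborel)"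
    by (simp only: mult.commute[of \<alpha> \<rho>])
  also have "\<dots> = of_real (t powr (\<delta> + \<rho> * \<alpha> - \<rho> * (\<beta> + 1) - 1) / Gamma (\<delta> + \<rho> * \<alpha> - \<rho> * (\<beta> + 1))) * \<psi> (C y) + (\<integral>v. of_real (K t v) * ?r x v \<partial>lborel)"
  proof (rule wright_kernel_Weyl_function[OF \<rho> ab \<delta>_gt(1) \<alpha> t \<beta> _ rR(1) Mx rR(4)[OF yx]])
    have "\<rho> * (\<beta> + 1) \<le> \<rho> * \<eta>" using \<eta> \<rho> by (intro mult_left_mono) auto
    moreover have "\<rho> * \<alpha> > 0" using \<rho> \<alpha> by simp
    ultimately show "\<delta> + \<rho> * \<alpha> > 1 + \<rho> * (\<beta> + 1)" by linarith
  qed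
  also have "\<dots> = of_real (g_kernel ((\<alpha> * \<rho>) + \<kappa>) t) * \<psi> (C y) + \<psi> (W t x)"
    unfolding \<kappa>\<alpha>\<rho> using t rR(3)[of t x] by (simp add: g_kernel_nonzero)
  finally have W_val: "(\<integral>s. of_real (g s) * \<psi> (W s y) \<partial>lborel) = of_real (g_kernel ((\<alpha> * \<rho>) + \<kappa>) t) * \<psi> (C y) + \<psi> (W t x)" .
  have "has_bochner_integral lborel (\<lambda>s. of_real (g s * g_kernel \<kappa> s) * \<psi> (C y) - of_real (g s) * \<psi> (W s y))
     (of_real (g_kernel ((\<alpha> * \<rho>) + \<kappa>) t) * \<psi> (C y) - (of_real (g_kernel ((\<alpha> * \<rho>) + \<kappa>) t) * \<psi> (C y) + \<psi> (W t x)))"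
    by (intro has_bochner_integral_diff k_int) (use W_int W_val in \<open>simp add: has_bochner_integral_iff\<close>)
  then have "has_bochner_integral lborel (\<lambda>s. of_real (g s) * \<psi> (S s y)) (\<psi> (- W t x))"
    unfolding split[symmetric] by (simp add: functional_minus[OF \<psi>])
  then show "has_bochner_integral lborel (\<lambda>s. of_real (indicator {0..t} s * g_kernel (\<alpha> * \<rho>) (t - s)) * \<psi> (S s y)) (\<psi> (- W t x))"
    unfolding g_def .
qed

lemma inverse_resolvent_integral:
  assumes yx: "(y, x) \<in> A" and t: "t \<ge> 0"
  shows "has_lcs_integral (lebesgue_on {0..t}) (\<lambda>s. complex_of_real (g_kernel (\<alpha> * \<rho>) (t - s)) *\<^sub>C S s y)
    (S t x - complex_of_real (g_kernel \<kappa> t) *\<^sub>C C x)"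
proof -
  have St: "S t x - complex_of_real (g_kernel \<kappa> t) *\<^sub>C C x = - W t x"
    by (simp add: inverse_family_def scaleR_scaleC)
  have c: "continuous_on {0..t} (\<lambda>s. S s y)" by (rule continuous_on_subset[OF S_cont]) auto
  show ?thesis
    unfolding St
  proof (cases "t = 0")
    case False
    with t have t': "t > 0" by simp
    show "has_lcs_integral (lebesgue_on {0..t}) (\<lambda>s. complex_of_real (g_kernel (\<alpha> * \<rho>) (t - s)) *\<^sub>C S s y) (- W t x)"
      by (rule weak_integral_imp_has_lcs_integral[OF t c integrable_g_kernel_shift[OF \<alpha>\<rho>_pos t'] inverse_resolvent_equation[OF yx t']])
  next
    \<comment> \<open>At t = 0 the interval is a null set and W 0 x = 0, so both sides vanish; the
      lemmas on kernels require t > 0.\<close>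
    case True
    have eq: "indicator {0..t} s * g_kernel (\<alpha> * \<rho>) (t - s) = indicator {0} s *\<^sub>R g_kernel (\<alpha> * \<rho>) 0" for s
      using True by (auto simp: indicator_def)
    have hb: "has_bochner_integral lborel (\<lambda>s. indicator {0::real} s *\<^sub>R k) (measure lborel {0::real} *\<^sub>R k)"
      for k :: "'b::{banach, second_countable_topology}"
      by (rule has_bochner_integral_indicator) auto
    have "weak_integral (\<lambda>s. indicator {0..t} s * g_kernel (\<alpha> * \<rho>) (t - s)) (\<lambda>s. S s y) (- W t x)"
      unfolding weak_integral_def
    proof (intro allI impI)
      fix \<psi> :: "'a \<Rightarrow> complex" assume \<psi>: "cont_functional \<psi>"
      have "of_real (indicator {0..t} s * g_kernel (\<alpha> * \<rho>) (t - s)) * \<psi> (S s y) = indicator {0} s *\<^sub>R (of_real (g_kernel (\<alpha> * \<rho>) 0) * \<psi> (S 0 y))" for s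
        using True by (auto simp: indicator_def)
      with hb[of "of_real (g_kernel (\<alpha> * \<rho>) 0) * \<psi> (S 0 y)"]
      show "has_bochner_integral lborel (\<lambda>s. of_real (indicator {0..t} s * g_kernel (\<alpha> * \<rho>) (t - s)) * \<psi> (S s y)) (\<psi> (- W t x))"
        using True by (simp add: W_0 functional_0[OF \<psi>])
    qed
    then show "has_lcs_integral (lebesgue_on {0..t}) (\<lambda>s. complex_of_real (g_kernel (\<alpha> * \<rho>) (t - s)) *\<^sub>C S s y) (- W t x)"
      by (intro weak_integral_imp_has_lcs_integral[OF t c])
        (use hb[of "g_kernel (\<alpha> * \<rho>) 0"] in \<open>simp_all add: eq has_bochner_integral_iff\<close>)
  qed
qed

section \<open>The axioms of a resolvent family for the inverse, and equicontinuity\<close>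

lemma S_A:
  assumes t: "t \<ge> 0" and xy: "(x, y) \<in> A"
  shows "(S t x, S t y) \<in> A"
proof -
  have "(C x, C y) \<in> A" using C(2) xy unfolding op_commutes_MLO_iff by blast
  then have "(complex_of_real (g_kernel \<kappa> t) *\<^sub>C C x, complex_of_real (g_kernel \<kappa> t) *\<^sub>C C y) \<in> A"
    by (rule is_MLO_graph(2)[OF A(1)])
  from is_MLO_graph(1)[OF A(1) this is_MLO_graph(2)[OF A(1) W_A[OF t xy], of "-1"]]
  show ?thesis
    by (simp add: inverse_family_def scaleR_scaleC complex_vector.scale_minus_left scaleC_one)
qed

lemma inverse_family_regularized:
  "regularized_resolvent_family (\<lambda>t. complex_of_real (g_kernel (\<alpha> * \<rho>) t)) (\<lambda>t. complex_of_real (g_kernel \<kappa> t)) C (A\<inverse>) S"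
  unfolding regularized_resolvent_family_def
proof (intro conjI)
  show "continuous_on {0..} (\<lambda>t. complex_of_real (g_kernel \<kappa> t))"
    by (intro continuous_intros continuous_on_g_kernel \<kappa>_ge_1)
  have "Gamma \<kappa> > 0" using \<kappa>_ge_1 by (intro Gamma_real_pos) simp
  then show "\<exists>t\<ge>0. complex_of_real (g_kernel \<kappa> t) \<noteq> 0"
    by (intro exI[of _ 1]) (simp add: g_kernel_nonzero)
  show "\<forall>T\<ge>0. (\<lambda>t. complex_of_real (g_kernel (\<alpha> * \<rho>) t)) absolutely_integrable_on {0..T}"
    using absolutely_integrable_g_kernel[OF \<alpha>\<rho>_pos] by blast
  show "\<not> (AE t in lebesgue_on {0..}. complex_of_real (g_kernel (\<alpha> * \<rho>) t) = 0)"
  proof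
    assume "AE t in lebesgue_on {0..}. complex_of_real (g_kernel (\<alpha> * \<rho>) t) = 0"
    then have "AE t in lebesgue. t \<in> {0..} \<longrightarrow> complex_of_real (g_kernel (\<alpha> * \<rho>) t) = 0"
      by (subst (asm) AE_restrict_space_iff) auto
    then have ae: "AE t::real in lebesgue. t \<notin> {0<..}"
    proof eventually_elim
      case (elim t)
      have "g_kernel (\<alpha> * \<rho>) t > 0" if "t > 0"
        using that Gamma_real_pos[OF \<alpha>\<rho>_pos] by (simp add: g_kernel_nonzero)
      with elim show ?case by force
    qed
    have "{0<..} \<in> null_sets (lebesgue :: real measure)"
      using ae by (subst AE_iff_null_sets) auto
    then have "{0<..1::real} \<in> null_sets lebesgue"
      by (rule null_sets_subset) auto
    then have "emeasure lebesgue {0<..1::real} = 0" by blast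
    then show False by simp
  qed
  show "is_MLO (A\<inverse>)" by (rule is_MLO_converse[OF A(1)])
  show "C \<in> cont_linear_ops" by (rule C(1))
  show "op_commutes_MLO C (A\<inverse>)" using C(2) unfolding op_commutes_MLO_iff by auto
  show "\<forall>t\<ge>0. S t \<in> cont_linear_ops" using S_op by blast
  show "\<forall>x. continuous_on {0..} (\<lambda>t. S t x)" using S_cont by blast
  show "\<forall>t\<ge>0. \<forall>(x, y)\<in>A\<inverse>. has_lcs_integral (lebesgue_on {0..t})
      (\<lambda>s. complex_of_real (g_kernel (\<alpha> * \<rho>) (t - s)) *\<^sub>C S s y) (S t x - complex_of_real (g_kernel \<kappa> t) *\<^sub>C C x)"
    using inverse_resolvent_integral by auto
  show "\<forall>t\<ge>0. S t \<circ> C = C \<circ> S t"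
    by (auto simp: fun_eq_iff inverse_family_def W_C cont_linear_opsD[OF C(1)])
  show "\<forall>t\<ge>0. op_commutes_MLO (S t) (A\<inverse>)"
    using S_A unfolding op_commutes_MLO_iff by auto
qed

text \<open>\<open>S_bound\<close> contains the powers for both a and b, whereas F guarantees only
  one of them on each side of 1. Since \<rho> (\<eta> - b - 1) \<le> \<rho> (\<eta> - a - 1), the
  missing power is the smaller one there, which costs the factor 2.\<close>

lemma inverse_family_equicontinuous:
  assumes F: "\<And>t. t > 0 \<Longrightarrow>
      F t = t powr (\<rho> * (\<eta> - \<beta> - 1)) +
            (t powr (\<rho> * (\<eta> - b - 1)) * indicator {0<..1} t +
             t powr (\<rho> * (\<eta> - a - 1)) * indicator {1..} t)"
  shows "equicontinuous_ops {(\<lambda>x. inverse (F t) *\<^sub>R S t x) |t. t > 0}"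
proof (rule equicontinuous_opsI)
  have F_ge: "t powr (\<rho> * (\<eta> - \<beta> - 1)) + t powr (\<rho> * (\<eta> - a - 1)) + t powr (\<rho> * (\<eta> - b - 1)) \<le> 2 * F t"
    and F_pos: "F t > 0" if t: "t > 0" for t
  proof -
    have ea: "\<rho> * (\<eta> - b - 1) \<le> \<rho> * (\<eta> - a - 1)" using \<rho> ab by (intro mult_left_mono) auto
    have pos: "t powr (\<rho> * (\<eta> - \<beta> - 1)) > 0" "t powr (\<rho> * (\<eta> - a - 1)) > 0" "t powr (\<rho> * (\<eta> - b - 1)) > 0"
      using t by auto
    consider "t \<le> 1" | "t \<ge> 1" by linarith
    then show "t powr (\<rho> * (\<eta> - \<beta> - 1)) + t powr (\<rho> * (\<eta> - a - 1)) + t powr (\<rho> * (\<eta> - b - 1)) \<le> 2 * F t"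
    proof cases
      case 1
      then have "t powr (\<rho> * (\<eta> - a - 1)) \<le> t powr (\<rho> * (\<eta> - b - 1))"
        using t ea by (intro powr_mono') auto
      \<comment> \<open>Only an inequality, because at t = 1 both indicators are 1.\<close>
      moreover have "F t \<ge> t powr (\<rho> * (\<eta> - \<beta> - 1)) + t powr (\<rho> * (\<eta> - b - 1))"
        unfolding F[OF t] using 1 t by (simp add: indicator_def)
      ultimately show ?thesis using pos by linarith
    next
      case 2
      then have "t powr (\<rho> * (\<eta> - b - 1)) \<le> t powr (\<rho> * (\<eta> - a - 1))"
        using ea by (intro powr_mono) auto
      moreover have "F t \<ge> t powr (\<rho> * (\<eta> - \<beta> - 1)) + t powr (\<rho> * (\<eta> - a - 1))"
        unfolding F[OF t] using 2 t by (simp add: indicator_def)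
      ultimately show ?thesis using pos by linarith
    qed
    show "F t > 0" unfolding F[OF t] using pos by (intro add_pos_nonneg add_nonneg_nonneg) auto
  qed
  show "{(\<lambda>x. inverse (F t) *\<^sub>R S t x) |t. t > 0} \<subseteq> cont_linear_ops"
  proof clarify
    fix t :: real assume t: "t > 0"
    show "(\<lambda>x. inverse (F t) *\<^sub>R S t x) \<in> cont_linear_ops"
    proof (rule cont_linear_opsI)
      fix p :: "'a \<Rightarrow> real" assume p: "continuous_seminorm p"
      obtain q where q: "continuous_seminorm q" "\<And>x. p (S t x) \<le> q x"
        using cont_linear_ops_seminormD[OF S_op[of t] p] t by auto
      have "continuous_seminorm (\<lambda>x. inverse (F t) * q x + 0 * q x)"
        using F_pos[OF t] by (intro continuous_seminorm_add_scale q) auto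
      moreover have "p (inverse (F t) *\<^sub>R S t x) \<le> inverse (F t) * q x + 0 * q x" for x
        using mult_left_mono[OF q(2)[of x], of "inverse (F t)"] F_pos[OF t] by (simp add: seminorm_scaleR[OF p])
      ultimately show "\<exists>q. continuous_seminorm q \<and> (\<forall>x. p (inverse (F t) *\<^sub>R S t x) \<le> q x)" by blast
    qed (use t in \<open>simp_all add: S_linear scaleC_add_right scaleR_scaleC scaleC_scaleC mult.commute\<close>)
  qed
  fix p :: "'a \<Rightarrow> real" assume p: "continuous_seminorm p"
  obtain q where q: "continuous_seminorm q"
    "\<And>t x. t > 0 \<Longrightarrow> p (S t x) \<le> (t powr (\<rho> * (\<eta> - \<beta> - 1)) + t powr (\<rho> * (\<eta> - a - 1)) + t powr (\<rho> * (\<eta> - b - 1))) * q x"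
    using S_bound[OF p] by blast
  have q2: "continuous_seminorm (\<lambda>x. 2 * q x + 0 * q x)"
    by (intro continuous_seminorm_add_scale q) auto
  have "p (inverse (F t) *\<^sub>R S t x) \<le> 2 * q x" if t: "t > 0" for t x
  proof -
    have "p (S t x) \<le> 2 * F t * q x"
      using q(2)[OF t, of x] mult_right_mono[OF F_ge[OF t] seminorm_nonneg[OF q(1), of x]] by simp
    then show ?thesis using F_pos[OF t] by (simp add: seminorm_scaleR[OF p] field_simps)
  qed
  then have "\<forall>T\<in>{(\<lambda>x. inverse (F t) *\<^sub>R S t x) |t. t > 0}. \<forall>x. p (T x) \<le> 2 * q x + 0 * q x"
    by clarsimp
  with q2 show "\<exists>q. continuous_seminorm q \<and> (\<forall>T\<in>{(\<lambda>x. inverse (F t) *\<^sub>R S t x) |t. t > 0}. \<forall>x. p (T x) \<le> q x)"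
    by (intro exI conjI)
qed

end

theorem theorem2p13:
  fixes A :: "('a::sequentially_complete_lcs \<times> 'a) set"
    and C :: "'a \<Rightarrow> 'a"
    and R :: "real \<Rightarrow> 'a \<Rightarrow> 'a"
    and \<alpha> \<sigma> \<beta> a b \<eta> :: real
    and F :: "real \<Rightarrow> real"
  assumes "0 < \<alpha>" "\<alpha> < 2" and "-1 < \<sigma>" "\<sigma> < 0" and "0 \<le> \<beta>"
    and "is_MLO A" and "closed A"
    and "C \<in> cont_linear_ops" and "op_commutes_MLO C A"
    and "regularized_resolvent_family
           (\<lambda>t. complex_of_real (g_kernel \<alpha> t)) (\<lambda>t. complex_of_real (g_kernel (\<beta> + 1) t)) C A R"
    and "exponentially_equicontinuous R"
    and "-1 < a" and "a \<le> b"
    and "equicontinuous_ops {(\<lambda>x. inverse (t powr a + t powr b) *\<^sub>R R t x) |t. t > 0}"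
    and "\<eta> > 1 + b" and "\<eta> \<ge> 1 + \<beta>"
    and F_def: "\<And>t. t > 0 \<Longrightarrow>
      F t = t powr (\<bar>\<sigma>\<bar> * (\<eta> - \<beta> - 1)) +
            (t powr (\<bar>\<sigma>\<bar> * (\<eta> - b - 1)) * indicator {0<..1} t +
             t powr (\<bar>\<sigma>\<bar> * (\<eta> - a - 1)) * indicator {1..} t)"
  shows "\<exists>S :: real \<Rightarrow> 'a \<Rightarrow> 'a.
    regularized_resolvent_family
      (\<lambda>t. complex_of_real (g_kernel (\<alpha> * \<bar>\<sigma>\<bar>) t))
      (\<lambda>t. complex_of_real (g_kernel (1 + \<bar>\<sigma>\<bar> * (\<eta> - \<beta> - 1)) t)) C (A\<inverse>) S \<and>
    equicontinuous_ops {(\<lambda>x. inverse (F t) *\<^sub>R S t x) |t. t > 0}"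
proof -
  have \<rho>: "0 < \<bar>\<sigma>\<bar>" "\<bar>\<sigma>\<bar> < 1" using assms by auto
  note hyps = assms(1) \<rho> assms(5-10,12-16)
  show ?thesis
    by (rule exI, rule conjI[OF inverse_family_regularized[OF hyps] inverse_family_equicontinuous[OF hyps F_def]])
qed

end
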